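(* Suppose that $1\le p\le q\le\infty$, $(p,q)\ne(\infty,\infty)$, $a,b>-\frac1q$, $c,d>-\frac1p$, $r$ is a nonnegative integer, $k$ is a positive integer, and $$h=k-\left(\frac1p-\frac1q\right).$$ Then there exists a constant $C=C(p,q,a,b,c,d,r,k)$ such that for any function $f$ with $f^{(r+k-1)}$ absolutely continuous on $(-1,1)$ and $f^{(r+k)}w^{(a+h,b+h)}\in L_p$ we have $$\left\|f^{(r)}w^{(a,b)}\right\|_q\le C\left(\left\|f\,w^{(c,d)}\right\|_p+\left\|f^{(r+k)}w^{(a+h,b+h)}\right\|_p\right).$$ This inequality is sharp in the following sense. If $a-c<r+\left(\frac1p-\frac1q\right)$, then for any $\varepsilon>0$ there exists a sequence $\{f_n\}\subset C^{k+r}[-1,1]$ such that $$\left\|f_n^{(r)}w^{(a,b)}\right\|_q\cdot\left(\left\|f_n w^{(c,d)}\right\|_p+\left\|f_n^{(r+k)}w^{(a+h+\varepsilon,\,b+h)}\right\|_p\right)^{-1}\to\infty\quad\text{as } n\to\infty.$$ The analogous statement holds with respect to the parameter $b$: if $b-d<r+\left(\frac1p-\frac1q\right)$, then for any $\varepsilon>0$ there exists a sequence $\{f_n\}\subset C^{k+r}[-1,1]$ such that $$\left\|f_n^{(r)}w^{(a,b)}\right\|_q\cdot\left(\left\|f_n w^{(c,d)}\right\|_p+\left\|f_n^{(r+k)}w^{(a+h,\,b+h+\varepsilon)}\right\|_p\right)^{-1}\to\infty\quad\text{as } n\to\infty.$$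
   Context: For real $a,b$, $w^{(a,b)}(x)=(1-x)^a(1+x)^b$. $L_p=L_p[-1,1]$ with the unweighted norm $\|g\|_p=\left(\int_{-1}^1|g(x)|^pdx\right)^{1/p}$ for $1\le p<\infty$, and $\|g\|_\infty=\max_{x\in[-1,1]}|g(x)|$ (understood as the supremum over $(-1,1)$ when $g$ is defined only on the open interval). $\frac1q:=0$ for $q=\infty$. *)

theory Defs
  imports "HOL-Analysis.Analysis"
begin

definition jacobi_weight :: "real \<Rightarrow> real \<Rightarrow> real \<Rightarrow> real" where
  "jacobi_weight a b x = (1 - x) powr a * (1 + x) powr b"

text \<open>Exponents range over the extended half-line, with the convention that the reciprocal
  of infinity is the real number 0.\<close>

definition exponent_recip :: "ennreal \<Rightarrow> real" where
  "exponent_recip p = (if p = \<infinity> then 0 else 1 / enn2real p)"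

text \<open>The norm takes values in the extended half-line, so it is also meaningful (namely infinite)
  for functions outside the space. For the infinite exponent it is the true supremum over the
  open interval, not an essential supremum: values at the end points, where powers of
  0 are 0 by convention, must not enter.\<close>

definition Lp_norm :: "ennreal \<Rightarrow> (real \<Rightarrow> real) \<Rightarrow> ennreal" where
  "Lp_norm p g =
    (if p = \<infinity> then (SUP x\<in>{-1<..<1}. ennreal \<bar>g x\<bar>)
     else (let I = (\<integral>\<^sup>+x\<in>{-1..1}. ennreal (\<bar>g x\<bar> powr enn2real p) \<partial>lebesgue)
           in if I = \<infinity> then \<infinity> else ennreal (enn2real I powr (1 / enn2real p))))"

definition in_Lp :: "ennreal \<Rightarrow> (real \<Rightarrow> real) \<Rightarrow> bool" where
  "in_Lp p g \<longleftrightarrow> g \<in> borel_measurable (lebesgue_on {-1..1}) \<and> Lp_norm p g < \<infinity>"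

definition abs_continuous_on :: "real set \<Rightarrow> (real \<Rightarrow> real) \<Rightarrow> bool" where
  "abs_continuous_on S f \<longleftrightarrow>
    (\<forall>\<epsilon>>0. \<exists>\<delta>>0. \<forall>(n::nat) (u::nat \<Rightarrow> real) (v::nat \<Rightarrow> real).
      (\<forall>i<n. u i \<le> v i \<and> {u i..v i} \<subseteq> S) \<and>
      disjoint_family_on (\<lambda>i. {u i<..<v i}) {..<n} \<and>
      (\<Sum>i<n. v i - u i) < \<delta>
      \<longrightarrow> (\<Sum>i<n. \<bar>f (v i) - f (u i)\<bar>) < \<epsilon>)"

text \<open>On the open interval, absolute continuity is understood on every compact subinterval.
  This is implied by \<^const>\<open>abs_continuous_on\<close> for the whole open interval.\<close>

definition abs_continuous_open :: "(real \<Rightarrow> real) \<Rightarrow> bool" where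
  "abs_continuous_open f \<longleftrightarrow>
    (\<forall>\<alpha> \<beta>. -1 < \<alpha> \<and> \<alpha> \<le> \<beta> \<and> \<beta> < 1 \<longrightarrow> abs_continuous_on {\<alpha>..\<beta>} f)"

text \<open>Here and below, the \<open>j\<close>-th derivative on the open interval is \<open>(deriv ^^ j) f\<close>. The
  derivative of order \<open>Suc m\<close> then exists almost everywhere, and on the exceptional null set
  \<^const>\<open>deriv\<close> has an irrelevant default value.\<close>

definition deriv_abs_continuous :: "nat \<Rightarrow> (real \<Rightarrow> real) \<Rightarrow> bool" where
  "deriv_abs_continuous m f \<longleftrightarrow>
    (\<forall>i<m. (deriv ^^ i) f differentiable_on {-1<..<1}) \<and>
    abs_continuous_open ((deriv ^^ m) f)"

text \<open>Derivatives at the end points of a closed interval are one-sided; a chain of derivative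
  functions is used because \<^const>\<open>deriv\<close> is two-sided. Values of \<open>f\<close> outside \<open>S\<close> play no role.\<close>

definition Cm_on :: "nat \<Rightarrow> real set \<Rightarrow> (real \<Rightarrow> real) \<Rightarrow> bool" where
  "Cm_on m S f \<longleftrightarrow>
    (\<exists>F :: nat \<Rightarrow> real \<Rightarrow> real.
      (\<forall>x\<in>S. F 0 x = f x) \<and>
      (\<forall>i<m. \<forall>x\<in>S. (F i has_real_derivative F (Suc i) x) (at x within S)) \<and>
      continuous_on S (F m))"

end

theory Submission
  imports Defs
begin

text \<open>
  Away from the end points, the derivatives of \<open>f\<close> of order below \<open>r + k\<close> are controlled by the two norms on
  the right, by applying the mean value theorem repeatedly to separated points where \<open>f\<close> is small.
  Integrating \<open>k\<close> times from \<open>0\<close> towards an end point then bounds the \<open>r\<close>-th derivative at distance \<open>y\<close> from it by a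
  constant plus the integral over \<open>t > y\<close> of \<open>t ^ (k - 1)\<close> times the top derivative at distance \<open>t\<close>, so that a single
  weighted Hardy inequality in \<open>L\<^sub>p\<close> applies. The passage from \<open>p\<close> to \<open>q\<close> interpolates with the supremum
  bound, which follows from the same Hardy inequality because tail integrals are monotone.

  Since the top derivative exists only almost everywhere, the argument needs Lebesgue's theorem for
  functions of bounded variation. It is proved after Austin: at a point where difference quotients
  oscillate around \<open>0\<close>, a partition interval can be refined so as to add variation, and a Vitali
  covering shows that a nearly optimal partition leaves room for only a small set of such points.

  Sharpness is witnessed by \<open>(1 - x + \<delta>) powr \<sigma>\<close> as \<open>\<delta>\<close> tends to \<open>0\<close>, with \<open>\<sigma> = r - a - 1 / q - \<eta>\<close> for a small \<open>\<eta>\<close>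
  that makes \<open>\<sigma>\<close> avoid the nonnegative integers: the left-hand side grows like \<open>\<delta> powr - \<eta>\<close> while the
  right-hand side stays bounded.
\<close>

section \<open>Variation and differentiability almost everywhere\<close>

text \<open>The number \<open>h\<close> is forced by scaling. Put
  \<open>\<alpha> = a + 1 / q - 1 / p\<close>. Hardy's inequality requires
  \<open>-1 < \<alpha> * p\<close>, which is exactly \<open>- 1 / q < a\<close>, and it raises the
  power of the distance \<open>t\<close> by 1; with the factor \<open>t ^ (k - 1)\<close> the top
  derivative meets the power \<open>\<alpha> + k = a + h\<close>. The supremum bound, at the power
  \<open>a + 1 / q\<close>, has the same right-hand side, so the interpolation brings in no further
  condition. The obstacle is regularity: the top derivative is known only almost everywhere and is
  not known in advance to be integrable up to the end points, nor even on compact subintervals. The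
  fundamental theorem is therefore proved for the gauge integral, which accepts a derivative without
  prior integrability, and increments are then compared with extended nonnegative integrals, where
  divergence is harmless. Both end points are treated at once through a sign \<open>s\<close>, equal
  to 1 or -1: \<open>s - s * y\<close> is the point at distance \<open>y\<close> from the end point
  \<open>s\<close>, and \<open>y = 1\<close> is the origin, where the two halves meet.\<close>

text \<open>A partition grows by one cell on its right, so that estimates for single cells can be
  summed by induction over it. It is a relation because \<open>s\<close> depends on the partition
  and not only on \<open>u\<close> and \<open>v\<close>.\<close>

inductive variation_sum :: "(real \<Rightarrow> real) \<Rightarrow> real \<Rightarrow> real \<Rightarrow> real \<Rightarrow> bool" for F where
  refl: "variation_sum F u u 0"
| step: "variation_sum F u w s \<Longrightarrow> w \<le> v \<Longrightarrow> variation_sum F u v (s + \<bar>F v - F w\<bar>)"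

lemma variation_sum_le: "variation_sum F u v s \<Longrightarrow> u \<le> v"
  by (induction rule: variation_sum.induct) auto

lemma variation_sum_single: "u \<le> v \<Longrightarrow> variation_sum F u v \<bar>F v - F u\<bar>"
  using variation_sum.step[OF variation_sum.refl, of u v F] by simp

lemma variation_sum_append:
  assumes "variation_sum F w v t" "variation_sum F u w s"
  shows "variation_sum F u v (s + t)"
  using assms
proof (induction rule: variation_sum.induct)
  case (step w' y t v)
  then show ?case using variation_sum.step[of F u y "s + t" v] by (simp add: algebra_simps)
qed simp

definition bounded_variation_on :: "(real \<Rightarrow> real) \<Rightarrow> real \<Rightarrow> real \<Rightarrow> bool" where
  "bounded_variation_on F c d \<longleftrightarrow>
    (\<exists>K. \<forall>u v s. c \<le> u \<longrightarrow> v \<le> d \<longrightarrow> variation_sum F u v s \<longrightarrow> s \<le> K)"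

text \<open>A supremum of reals, hence informative only together with
  \<open>bounded_variation_on\<close> and for \<open>u \<le> v\<close>.\<close>

definition total_variation :: "(real \<Rightarrow> real) \<Rightarrow> real \<Rightarrow> real \<Rightarrow> real" where
  "total_variation F u v = Sup {s. variation_sum F u v s}"

lemma total_variation_upper:
  assumes "bounded_variation_on F c d" "c \<le> u" "v \<le> d" "variation_sum F u v s"
  shows "s \<le> total_variation F u v"
  unfolding total_variation_def
proof (rule cSup_upper)
  show "bdd_above {s. variation_sum F u v s}"
    using assms unfolding bounded_variation_on_def bdd_above_def by blast
qed (use assms in auto)

lemma total_variation_abs:
  assumes "bounded_variation_on F c d" "c \<le> u" "v \<le> d" "u \<le> v"
  shows "\<bar>F v - F u\<bar> \<le> total_variation F u v"
  using total_variation_upper[OF assms(1-3) variation_sum_single[OF assms(4)]] .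

lemma total_variation_superadditive:
  assumes "bounded_variation_on F c d" "c \<le> u" "v \<le> d" "u \<le> w" "w \<le> v"
  shows "total_variation F u w + total_variation F w v \<le> total_variation F u v"
proof -
  have 1: "s + t \<le> total_variation F u v" if "variation_sum F u w s" "variation_sum F w v t" for s t
    using total_variation_upper[OF assms(1-3) variation_sum_append[OF that(2,1)]] .
  have "total_variation F u w \<le> total_variation F u v - t" if t: "variation_sum F w v t" for t
    unfolding total_variation_def[of F u w]
  proof (rule cSup_least)
    show "{s. variation_sum F u w s} \<noteq> {}" using variation_sum_single assms(4) by blast
    show "s \<le> total_variation F u v - t" if "s \<in> {s. variation_sum F u w s}" for s
      using 1[of s t] that t by simp
  qed
  then have 2: "t \<le> total_variation F u v - total_variation F u w" if "variation_sum F w v t" for t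
    using that by (smt (verit))
  have "total_variation F w v \<le> total_variation F u v - total_variation F u w"
    unfolding total_variation_def[of F w v]
  proof (rule cSup_least)
    show "{s. variation_sum F w v s} \<noteq> {}" using variation_sum_single assms(5) by blast
  qed (use 2 in auto)
  then show ?thesis by simp
qed

text \<open>The intervals of \<open>D\<close> and the gaps between them partition
  \<open>{u..v}\<close>. The gaps carry the part of \<open>F v - F u\<close> that \<open>D\<close>
  does not account for, so their variation is at least the absolute value of that residual. The
  residual is large precisely when the increments over \<open>D\<close> run against
  \<open>F v - F u\<close>, which is the source of the gain in Austin's argument.\<close>

lemma total_variation_disjoint_family:
  assumes bv: "bounded_variation_on F c d" and fin: "finite D"
    and "c \<le> u" "v \<le> d" "u \<le> v"
    and "\<And>s t. (s, t) \<in> D \<Longrightarrow> u \<le> s \<and> s < t \<and> t \<le> v"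
    and "pairwise (\<lambda>I J. disjnt {fst I..snd I} {fst J..snd J}) D"
  shows "(\<Sum>(s,t)\<in>D. \<bar>F t - F s\<bar>) + \<bar>F v - F u - (\<Sum>(s,t)\<in>D. F t - F s)\<bar> \<le> total_variation F u v"
  using fin assms(3-)
proof (induction D arbitrary: u v rule: finite_psubset_induct)
  case (psubset D)
  show ?case
  proof (cases "D = {}")
    case True
    then show ?thesis using total_variation_abs[OF bv psubset.prems(1-3)] by simp
  next
    case False
    \<comment> \<open>Any one interval \<open>(s, t)\<close> separates the remaining ones into those
      left of \<open>s\<close> and those right of \<open>t\<close>, so the induction hypothesis can
      be applied on \<open>{u..s}\<close> and on \<open>{t..v}\<close>.\<close>
    then obtain s t where st: "(s, t) \<in> D" by fastforce
    note inD = psubset.prems(4)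
    have pw: "disjnt {fst I..snd I} {fst J..snd J}" if "I \<in> D" "J \<in> D" "I \<noteq> J" for I J
      using psubset.prems(5) that unfolding pairwise_def by blast
    define D1 where "D1 = {I\<in>D. snd I < s}"
    define D2 where "D2 = {I\<in>D. t < fst I}"
    have s_t: "u \<le> s" "s < t" "t \<le> v" using inD[OF st] by auto
    have "(s, t) \<notin> D1" "(s, t) \<notin> D2" using s_t unfolding D1_def D2_def by auto
    then have sub: "D1 \<subset> D" "D2 \<subset> D" using st unfolding D1_def D2_def by blast+
    have Deq: "D = insert (s, t) (D1 \<union> D2)"
    proof -
      have "I \<in> D1 \<union> D2" if "I \<in> D" "I \<noteq> (s, t)" for I
      proof (rule ccontr)
        assume "I \<notin> D1 \<union> D2"
        then have "s \<le> snd I" "fst I \<le> t" using that unfolding D1_def D2_def by auto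
        moreover have "fst I < snd I" using inD[of "fst I" "snd I"] that by simp
        ultimately have "max s (fst I) \<in> {fst I..snd I} \<inter> {s..t}" using s_t by auto
        then show False using pw[OF that(1) st that(2)] by (auto simp: disjnt_def)
      qed
      then show ?thesis using st unfolding D1_def D2_def by auto
    qed
    have fin12: "finite D1" "finite D2" using psubset.hyps sub finite_subset by blast+
    have disj: "D1 \<inter> D2 = {}" "(s, t) \<notin> D1 \<union> D2"
    proof -
      have "False" if "I \<in> D1" "I \<in> D2" for I
        using that inD[of "fst I" "snd I"] s_t unfolding D1_def D2_def by auto
      then show "D1 \<inter> D2 = {}" by blast
      show "(s, t) \<notin> D1 \<union> D2" using s_t unfolding D1_def D2_def by auto
    qed
    have split: "sum g D = g (s, t) + (sum g D1 + sum g D2)" for g :: "real \<times> real \<Rightarrow> real"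
      unfolding Deq using fin12 disj by (simp add: sum.union_disjoint)
    have pw12: "pairwise (\<lambda>I J. disjnt {fst I..snd I} {fst J..snd J}) D1"
      "pairwise (\<lambda>I J. disjnt {fst I..snd I} {fst J..snd J}) D2"
      using psubset.prems(5) sub pairwise_subset by blast+
    have 1: "(\<Sum>(s,t)\<in>D1. \<bar>F t - F s\<bar>) + \<bar>F s - F u - (\<Sum>(s,t)\<in>D1. F t - F s)\<bar> \<le> total_variation F u s"
      by (rule psubset.IH[OF sub(1)]) (use inD s_t psubset.prems pw12 in \<open>force simp: D1_def\<close>)+
    have 2: "(\<Sum>(s,t)\<in>D2. \<bar>F t - F s\<bar>) + \<bar>F v - F t - (\<Sum>(s,t)\<in>D2. F t - F s)\<bar> \<le> total_variation F t v"
      by (rule psubset.IH[OF sub(2)]) (use inD s_t psubset.prems pw12 in \<open>force simp: D2_def\<close>)+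
    have 3: "\<bar>F t - F s\<bar> \<le> total_variation F s t"
      by (rule total_variation_abs[OF bv]) (use s_t psubset.prems in auto)
    have 4: "total_variation F u s + total_variation F s t \<le> total_variation F u t"
      by (rule total_variation_superadditive[OF bv]) (use s_t psubset.prems in auto)
    have 5: "total_variation F u t + total_variation F t v \<le> total_variation F u v"
      by (rule total_variation_superadditive[OF bv]) (use s_t psubset.prems in auto)
    \<comment> \<open>The residual of \<open>D\<close> on \<open>{u..v}\<close> is the sum of the
      residuals of \<open>D1\<close> on \<open>{u..s}\<close> and of \<open>D2\<close> on
      \<open>{t..v}\<close>; the triangle inequality finishes.\<close>
    show ?thesis unfolding split using 1 2 3 4 5 by (simp add: split_beta)
  qed
qed

section \<open>Vitali coverings and the exceptional points of a function of bounded
  variation\<close>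

text \<open>The point \<open>x\<close> is an end point of the interval, so an increment divided by
  the length is a one-sided difference quotient at \<open>x\<close>, from the left or from the
  right.\<close>

definition small_interval_at :: "real \<Rightarrow> real \<Rightarrow> real \<Rightarrow> real \<Rightarrow> bool" where
  "small_interval_at x e s t \<longleftrightarrow> s < t \<and> (x = s \<or> x = t) \<and> t - s < e"

text \<open>Vitali's theorem covers \<open>E\<close>, up to a null set, by countably many disjoint
  intervals, and the measure of a countable union is bounded as soon as all finite subunions are.
  Thus an estimate for finite disjoint families is enough. Since \<open>E\<close> may fail to be
  measurable, the bound is carried by a measurable set \<open>T\<close> around it.\<close>

lemma Vitali_interval_cover:
  assumes E: "E \<subseteq> {w<..<v}"
    and fine: "\<And>x e. x \<in> E \<Longrightarrow> 0 < e \<Longrightarrow> \<exists>s t. small_interval_at x e s t \<and> P s t"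
    and bound: "\<And>D. finite D \<Longrightarrow> (\<And>s t. (s, t) \<in> D \<Longrightarrow> w < s \<and> s < t \<and> t < v \<and> P s t) \<Longrightarrow>
        pairwise (\<lambda>I J. disjnt {fst I..snd I} {fst J..snd J}) D \<Longrightarrow> (\<Sum>(s,t)\<in>D. t - s) \<le> M"
  obtains T where "T \<in> lmeasurable" "E \<subseteq> T" "measure lebesgue T \<le> M"
proof -
  define K where "K = {(s, t). w < s \<and> s < t \<and> t < v \<and> P s t}"
  define a where "a = (\<lambda>I :: real \<times> real. (fst I + snd I) / 2)"
  define r where "r = (\<lambda>I :: real \<times> real. (snd I - fst I) / 2)"
  have cb: "cball (a I) (r I) = {fst I..snd I}" for I
    unfolding a_def r_def by (auto simp: cball_eq_atLeastAtMost field_simps)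
  have "\<And>i. i \<in> K \<Longrightarrow> 0 < r i" unfolding K_def r_def by auto
  moreover have "\<exists>i. i \<in> K \<and> x \<in> cball (a i) (r i) \<and> r i < e" if x: "x \<in> E" and e: "0 < e" for x e
  proof -
    have xw: "w < x" "x < v" using E x by auto
    \<comment> \<open>Intervals at \<open>x\<close> shorter than the distance from \<open>x\<close>
      to \<open>w\<close> and \<open>v\<close> stay strictly inside, as membership in
      \<open>K\<close> demands.\<close>
    define e' where "e' = min e (min (x - w) (v - x))"
    have "e' > 0" using e xw unfolding e'_def by simp
    then obtain s t where st: "small_interval_at x e' s t" "P s t" using fine[OF x] by blast
    have "e' \<le> e" "e' \<le> x - w" "e' \<le> v - x" unfolding e'_def by auto
    then have "(s, t) \<in> K" "x \<in> {s..t}" "r (s, t) < e"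
      using st unfolding small_interval_at_def K_def r_def by auto
    then show ?thesis unfolding cb by (intro exI[of _ "(s, t)"]) auto
  qed
  ultimately obtain C where C: "countable C" "C \<subseteq> K"
    and pw: "pairwise (\<lambda>i j. disjnt (cball (a i) (r i)) (cball (a j) (r j))) C"
    and neg: "negligible (E - (\<Union>i\<in>C. cball (a i) (r i)))"
    by (rule Vitali_covering_theorem_cballs[of K r E a]) blast+
  have meas: "measure lebesgue (\<Union>i\<in>I'. {fst i..snd i}) \<le> M" if I': "I' \<subseteq> C" "finite I'" for I'
  proof -
    have "measure lebesgue (\<Union>i\<in>I'. {fst i..snd i}) \<le> (\<Sum>i\<in>I'. measure lebesgue {fst i..snd i})"
      using I' by (intro measure_UNION_le) auto
    also have "\<dots> = (\<Sum>(s,t)\<in>I'. t - s)"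
      using I' C(2) unfolding K_def by (intro sum.cong) (auto simp: split_beta subset_iff intro: less_imp_le)
    also have "\<dots> \<le> M"
      using I' C(2) pw unfolding cb K_def
      by (intro bound) (auto intro: pairwise_subset)
    finally show ?thesis .
  qed
  have "(\<Union>i\<in>C. {fst i..snd i}) \<in> lmeasurable" "measure lebesgue (\<Union>i\<in>C. {fst i..snd i}) \<le> M"
    using fmeasurable_UN_bound[OF C(1) _ meas] measure_UN_bound[OF C(1) _ meas] by auto
  moreover have "E - (\<Union>i\<in>C. {fst i..snd i}) \<in> null_sets lebesgue"
    using neg unfolding cb negligible_iff_null_sets .
  moreover have "U \<union> (E - U) \<in> lmeasurable \<and> measure lebesgue (U \<union> (E - U)) \<le> M"
    if "U \<in> lmeasurable" "measure lebesgue U \<le> M" "E - U \<in> null_sets lebesgue" for U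
    using that measure_Un_null_set[OF fmeasurableD[OF that(1)] that(3)]
    by (metis fmeasurable.Un fmeasurableI_null_sets)
  ultimately have "\<exists>T. T \<in> lmeasurable \<and> E \<subseteq> T \<and> measure lebesgue T \<le> M"
    by blast
  then show ?thesis using that by blast
qed


text \<open>Tilting turns oscillation between two arbitrary slopes into oscillation around 0. Along
  any partition it changes the variation by at most \<open>\<bar>\<mu>\<bar>\<close> times the
  length.\<close>

lemma bounded_variation_on_diff_linear:
  assumes "bounded_variation_on F c d"
  shows "bounded_variation_on (\<lambda>x. F x - \<mu> * x) c d"
proof -
  obtain K where K: "\<And>u v s. c \<le> u \<Longrightarrow> v \<le> d \<Longrightarrow> variation_sum F u v s \<Longrightarrow> s \<le> K"
    using assms unfolding bounded_variation_on_def by blast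
  have comp: "\<exists>s'. variation_sum F u v s' \<and> s \<le> s' + \<bar>\<mu>\<bar> * (v - u)"
    if "variation_sum (\<lambda>x. F x - \<mu> * x) u v s" for u v s
    using that
  proof (induction rule: variation_sum.induct)
    case (refl u)
    show ?case using variation_sum.refl[of F u] by force
  next
    case (step u w s v)
    then obtain s' where s': "variation_sum F u w s'" "s \<le> s' + \<bar>\<mu>\<bar> * (w - u)" by blast
    have "\<bar>(F v - \<mu> * v) - (F w - \<mu> * w)\<bar> = \<bar>(F v - F w) - \<mu> * (v - w)\<bar>"
      by (simp add: algebra_simps)
    also have "\<dots> \<le> \<bar>F v - F w\<bar> + \<bar>\<mu> * (v - w)\<bar>" by linarith
    also have "\<bar>\<mu> * (v - w)\<bar> = \<bar>\<mu>\<bar> * (v - w)" using step by (simp add: abs_mult)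
    finally have "s + \<bar>(F v - \<mu> * v) - (F w - \<mu> * w)\<bar> \<le> (s' + \<bar>F v - F w\<bar>) + \<bar>\<mu>\<bar> * (v - u)"
      using s'(2) by (simp add: algebra_simps)
    then show ?case using variation_sum.step[OF s'(1) step.hyps(2)] by blast
  qed
  have "s \<le> K + \<bar>\<mu>\<bar> * (d - c)"
    if "c \<le> u" "v \<le> d" and vs: "variation_sum (\<lambda>x. F x - \<mu> * x) u v s" for u v s
  proof -
    obtain s' where s': "variation_sum F u v s'" "s \<le> s' + \<bar>\<mu>\<bar> * (v - u)" using comp[OF vs] by blast
    have "\<bar>\<mu>\<bar> * (v - u) \<le> \<bar>\<mu>\<bar> * (d - c)" using that by (intro mult_left_mono) auto
    then show ?thesis using K[OF that(1,2) s'(1)] s'(2) by linarith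
  qed
  then show ?thesis unfolding bounded_variation_on_def by blast
qed

text \<open>Austin's refinement of one cell. Near every point of \<open>E\<close> there are
  intervals whose increment opposes the sign of \<open>G v - G w\<close> and exceeds
  \<open>\<alpha>\<close> times their length. Disjoint ones of total length \<open>L\<close>
  contribute more than \<open>\<alpha> * L\<close> to the variation, and the rest of the cell must
  make up for the lost increment by as much again. So the refined variation exceeds
  \<open>\<bar>G v - G w\<bar>\<close> by at least \<open>2 * \<alpha> * L\<close>, which bounds
  \<open>L\<close>.\<close>

lemma oscillation_cell:
  assumes bv: "bounded_variation_on G c d" "c \<le> w" "v \<le> d" "w \<le> v" and \<alpha>: "0 < \<alpha>"
    and neg: "\<And>x e. x \<in> E \<Longrightarrow> 0 < e \<Longrightarrow> \<exists>s t. small_interval_at x e s t \<and> G t - G s < - \<alpha> * (t - s)"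
    and pos: "\<And>x e. x \<in> E \<Longrightarrow> 0 < e \<Longrightarrow> \<exists>s t. small_interval_at x e s t \<and> G t - G s > \<alpha> * (t - s)"
  shows "\<exists>T\<in>lmeasurable. E \<inter> {w..v} \<subseteq> T \<and>
    measure lebesgue T \<le> (total_variation G w v - \<bar>G v - G w\<bar>) / (2 * \<alpha>)"
proof -
  define M where "M = (total_variation G w v - \<bar>G v - G w\<bar>) / (2 * \<alpha>)"
  \<comment> \<open>The sign of the increment over the cell. \<open>P\<close> then selects the
    opposing intervals, supplied by \<open>neg\<close> when the cell rises and by \<open>pos\<close>
    when it falls.\<close>
  define \<sigma> :: real where "\<sigma> = (if G w \<le> G v then 1 else - 1)"
  have \<sigma>: "\<sigma> * (G v - G w) = \<bar>G v - G w\<bar>" "\<bar>\<sigma>\<bar> = 1" unfolding \<sigma>_def by auto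
  define P where "P s t \<longleftrightarrow> \<sigma> * (G t - G s) < - \<alpha> * (t - s)" for s t
  obtain T where T: "T \<in> lmeasurable" "E \<inter> {w<..<v} \<subseteq> T" "measure lebesgue T \<le> M"
  proof (rule Vitali_interval_cover[of "E \<inter> {w<..<v}" w v P M])
    show "\<exists>s t. small_interval_at x e s t \<and> P s t" if xe: "x \<in> E \<inter> {w<..<v}" "0 < e" for x e
    proof (cases "G w \<le> G v")
      case True
      then show ?thesis using neg[of x e] xe unfolding P_def \<sigma>_def by simp
    next
      case False
      obtain s t where st: "small_interval_at x e s t" "G t - G s > \<alpha> * (t - s)"
        using pos[of x e] xe by blast
      then have "P s t" using False unfolding P_def \<sigma>_def by simp
      then show ?thesis using st by blast
    qed
    fix D assume D: "finite D" "\<And>s t. (s, t) \<in> D \<Longrightarrow> w < s \<and> s < t \<and> t < v \<and> P s t"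
      "pairwise (\<lambda>I J. disjnt {fst I..snd I} {fst J..snd J}) D"
    define S where "S = (\<Sum>(s,t)\<in>D. G t - G s)"
    define L where "L = (\<Sum>(s,t)\<in>D. t - s)"
    have "(\<Sum>(s,t)\<in>D. \<bar>G t - G s\<bar>) + \<bar>G v - G w - S\<bar> \<le> total_variation G w v"
      unfolding S_def
      by (rule total_variation_disjoint_family[OF bv(1) D(1) bv(2-4) _ D(3)]) (drule D(2), simp)
    \<comment> \<open>All increments over \<open>D\<close> have the sign opposite to
      \<open>\<sigma>\<close>, so no cancellation occurs.\<close>
    moreover have "(\<Sum>(s,t)\<in>D. \<bar>G t - G s\<bar>) = - \<sigma> * S"
      unfolding S_def sum_distrib_left
    proof (rule sum.cong)
      fix I assume "I \<in> D"
      then obtain s t where I: "I = (s, t)" "s < t" "P s t" using D(2)[of "fst I" "snd I"] by (cases I) auto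
      have "0 < \<alpha> * (t - s)" using I \<alpha> by simp
      then have "\<sigma> * (G t - G s) < 0" using I(3) unfolding P_def by linarith
      then show "(case I of (s, t) \<Rightarrow> \<bar>G t - G s\<bar>) = - \<sigma> * (case I of (s, t) \<Rightarrow> G t - G s)"
        unfolding I(1) \<sigma>_def by (simp split: if_splits)
    qed simp
    moreover have "\<sigma> * S \<le> - \<alpha> * L"
      unfolding S_def L_def sum_distrib_left
    proof (rule sum_mono)
      fix I assume "I \<in> D"
      then show "\<sigma> * (case I of (s, t) \<Rightarrow> G t - G s) \<le> - \<alpha> * (case I of (s, t) \<Rightarrow> t - s)"
        using D(2)[of "fst I" "snd I"] unfolding P_def by (cases I) auto
    qed
    moreover have "\<sigma> * (G v - G w - S) \<le> \<bar>G v - G w - S\<bar>"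
      unfolding \<sigma>_def by auto
    moreover have "\<sigma> * (G v - G w - S) = \<sigma> * (G v - G w) - \<sigma> * S"
      by (simp add: right_diff_distrib)
    ultimately have "2 * (\<alpha> * L) \<le> total_variation G w v - \<bar>G v - G w\<bar>"
      using \<sigma>(1) by linarith
    then show "L \<le> M" unfolding M_def using \<alpha> by (simp add: pos_le_divide_eq mult.commute mult.left_commute)
  qed auto
  \<comment> \<open>The covering argument works in the open cell; its end points only add a null
    set.\<close>
  have "{w, v} \<in> null_sets lebesgue" by (simp add: negligible_iff_null_sets[symmetric])
  then have "T \<union> {w, v} \<in> lmeasurable" "measure lebesgue (T \<union> {w, v}) \<le> M"
    using T measure_Un_null_set[OF fmeasurableD[OF T(1)], of "{w, v}"] fmeasurable.Un[OF T(1) fmeasurableI_null_sets[of "{w, v}"]]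
    by simp_all
  moreover have "E \<inter> {w..v} \<subseteq> T \<union> {w, v}" using T(2) by force
  ultimately show ?thesis unfolding M_def by blast
qed

text \<open>Every cell bounds its share of \<open>E\<close> by its own deficit, total variation
  minus absolute increment. Superadditivity collects these deficits into that of the whole
  partition.\<close>

lemma oscillation_partition:
  assumes vs: "variation_sum G u v S"
    and bv: "bounded_variation_on G c d" "c \<le> u" "v \<le> d" and \<alpha>: "0 < \<alpha>"
    and neg: "\<And>x e. x \<in> E \<Longrightarrow> 0 < e \<Longrightarrow> \<exists>s t. small_interval_at x e s t \<and> G t - G s < - \<alpha> * (t - s)"
    and pos: "\<And>x e. x \<in> E \<Longrightarrow> 0 < e \<Longrightarrow> \<exists>s t. small_interval_at x e s t \<and> G t - G s > \<alpha> * (t - s)"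
  shows "\<exists>T\<in>lmeasurable. E \<inter> {u..v} \<subseteq> T \<and> measure lebesgue T \<le> (total_variation G u v - S) / (2 * \<alpha>)"
  using vs bv(2,3)
proof (induction rule: variation_sum.induct)
  case (refl u)
  show ?case using oscillation_cell[OF bv(1) refl order_refl \<alpha> neg pos] by simp
next
  case (step u w s v)
  have uw: "u \<le> w" using variation_sum_le[OF step.hyps(1)] .
  obtain T1 where T1: "T1 \<in> lmeasurable" "E \<inter> {u..w} \<subseteq> T1"
    "measure lebesgue T1 \<le> (total_variation G u w - s) / (2 * \<alpha>)"
    using step.IH[OF step.prems(1)] step.prems(2) step.hyps(2) by (auto dest: order_trans)
  have "c \<le> w" using step.prems(1) uw by simp
  then obtain T2 where T2: "T2 \<in> lmeasurable" "E \<inter> {w..v} \<subseteq> T2"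
    "measure lebesgue T2 \<le> (total_variation G w v - \<bar>G v - G w\<bar>) / (2 * \<alpha>)"
    using oscillation_cell[OF bv(1) _ step.prems(2) step.hyps(2) \<alpha> neg pos] by blast
  have "measure lebesgue (T1 \<union> T2) \<le> measure lebesgue T1 + measure lebesgue T2"
    using T1(1) T2(1) by (intro measure_Un_le) auto
  also have "\<dots> \<le> (total_variation G u w - s) / (2 * \<alpha>) + (total_variation G w v - \<bar>G v - G w\<bar>) / (2 * \<alpha>)"
    using T1(3) T2(3) by linarith
  also have "\<dots> = (total_variation G u w + total_variation G w v - (s + \<bar>G v - G w\<bar>)) / (2 * \<alpha>)"
    by (simp add: add_divide_distrib diff_divide_distrib)
  also have "\<dots> \<le> (total_variation G u v - (s + \<bar>G v - G w\<bar>)) / (2 * \<alpha>)"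
    using total_variation_superadditive[OF bv(1) step.prems uw step.hyps(2)] \<alpha>
    by (intro divide_right_mono) auto
  finally have "measure lebesgue (T1 \<union> T2) \<le> (total_variation G u v - (s + \<bar>G v - G w\<bar>)) / (2 * \<alpha>)" .
  moreover have "E \<inter> {u..v} \<subseteq> T1 \<union> T2" using T1(2) T2(2) by force
  ultimately show ?case using fmeasurable.Un[OF T1(1) T2(1)] by blast
qed

text \<open>A partition whose variation comes within \<open>2 * \<alpha> * e\<close> of the supremum
  leaves a deficit that allows \<open>E\<close> at most measure \<open>e\<close>.\<close>

lemma oscillation_negligible:
  assumes bv: "bounded_variation_on G c d" and E: "E \<subseteq> {c..d}" and \<alpha>: "0 < \<alpha>"
    and neg: "\<And>x e. x \<in> E \<Longrightarrow> 0 < e \<Longrightarrow> \<exists>s t. small_interval_at x e s t \<and> G t - G s < - \<alpha> * (t - s)"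
    and pos: "\<And>x e. x \<in> E \<Longrightarrow> 0 < e \<Longrightarrow> \<exists>s t. small_interval_at x e s t \<and> G t - G s > \<alpha> * (t - s)"
  shows "negligible E"
proof (cases "c \<le> d")
  case True
  show ?thesis
    unfolding negligible_outer_le
  proof (intro allI impI)
    fix e :: real assume e: "e > 0"
    have "\<exists>S\<in>{s. variation_sum G c d s}. total_variation G c d - 2 * \<alpha> * e < S"
      unfolding total_variation_def
      by (rule less_cSupD) (use e \<alpha> variation_sum_single[OF True, of G] in auto)
    then obtain S where S: "variation_sum G c d S" "total_variation G c d - 2 * \<alpha> * e < S" by blast
    obtain T where T: "T \<in> lmeasurable" "E \<inter> {c..d} \<subseteq> T"
      "measure lebesgue T \<le> (total_variation G c d - S) / (2 * \<alpha>)"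
      using oscillation_partition[OF S(1) bv order_refl order_refl \<alpha> neg pos] by auto
    have "(total_variation G c d - S) / (2 * \<alpha>) \<le> e"
      using S(2) \<alpha> by (simp add: pos_divide_le_eq algebra_simps)
    then show "\<exists>T. E \<subseteq> T \<and> T \<in> lmeasurable \<and> measure lebesgue T \<le> e"
      using T E by (intro exI[of _ T]) auto
  qed
qed (use E in auto)

text \<open>Disjoint intervals of slope above \<open>m\<close> and total length \<open>L\<close>
  consume more than \<open>m * L\<close> of the total variation, so \<open>L\<close> is small once
  \<open>m\<close> is large.\<close>

lemma steep_negligible:
  assumes bv: "bounded_variation_on F c d" and E: "E \<subseteq> {c<..<d}"
    and steep: "\<And>x e m. x \<in> E \<Longrightarrow> 0 < e \<Longrightarrow> \<exists>s t. small_interval_at x e s t \<and> \<bar>F t - F s\<bar> > m * (t - s)"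
  shows "negligible E"
proof (cases "c \<le> d")
  case True
  show ?thesis
    unfolding negligible_outer_le
  proof (intro allI impI)
    fix e :: real assume e: "e > 0"
    define V where "V = total_variation F c d"
    have V: "V \<ge> 0" using total_variation_abs[OF bv order_refl order_refl True] unfolding V_def by linarith
    \<comment> \<open>The summand 1 keeps \<open>m\<close> positive when the total variation
      vanishes.\<close>
    define m where "m = (V + 1) / e"
    have m: "m > 0" "V \<le> m * e" using V e unfolding m_def by auto
    obtain T where "T \<in> lmeasurable" "E \<subseteq> T" "measure lebesgue T \<le> e"
    proof (rule Vitali_interval_cover[OF E, of "\<lambda>s t. \<bar>F t - F s\<bar> > m * (t - s)" e])
      fix D assume D: "finite D"
        "\<And>s t. (s, t) \<in> D \<Longrightarrow> c < s \<and> s < t \<and> t < d \<and> m * (t - s) < \<bar>F t - F s\<bar>"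
        "pairwise (\<lambda>I J. disjnt {fst I..snd I} {fst J..snd J}) D"
      have "m * (\<Sum>(s,t)\<in>D. t - s) \<le> (\<Sum>(s,t)\<in>D. \<bar>F t - F s\<bar>)"
        unfolding sum_distrib_left by (intro sum_mono) (auto dest!: D(2))
      also have "\<dots> \<le> V"
      proof -
        have "(\<Sum>(s,t)\<in>D. \<bar>F t - F s\<bar>) + \<bar>F d - F c - (\<Sum>(s,t)\<in>D. F t - F s)\<bar> \<le> V"
          unfolding V_def
          by (rule total_variation_disjoint_family[OF bv D(1) order_refl order_refl True _ D(3)]) (drule D(2), simp)
        then show ?thesis by linarith
      qed
      finally have "m * (\<Sum>(s,t)\<in>D. t - s) \<le> m * e" using m by linarith
      then show "(\<Sum>(s,t)\<in>D. t - s) \<le> e" using m(1) by simp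
    qed (use steep in auto)
    then show "\<exists>T. E \<subseteq> T \<and> T \<in> lmeasurable \<and> measure lebesgue T \<le> e" by blast
  qed
qed (use E in auto)

text \<open>Bounded difference quotients have finite lower and upper limits, and equality of these
  is differentiability. The slopes in \<open>osc\<close> are rational so that failure of the
  condition produces only countably many exceptional sets.\<close>

lemma differentiable_or_oscillating:
  fixes F :: "real \<Rightarrow> real"
  assumes steep: "\<exists>e>0. \<exists>m. \<forall>s t. small_interval_at x e s t \<longrightarrow> \<bar>F t - F s\<bar> \<le> m * (t - s)"
    and osc: "\<And>r r' :: rat. r < r' \<Longrightarrow> \<exists>e>0. (\<forall>s t. small_interval_at x e s t \<longrightarrow> of_rat r * (t - s) \<le> F t - F s) \<or>
        (\<forall>s t. small_interval_at x e s t \<longrightarrow> F t - F s \<le> of_rat r' * (t - s))"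
  shows "F differentiable at x"
proof -
  define Q where "Q y = (F y - F x) / (y - x)" for y
  have sym: "small_interval_at x e (min x y) (max x y)" "F (max x y) - F (min x y) = Q y * (max x y - min x y)"
    if "y \<noteq> x" "dist y x < e" for y e
    using that unfolding small_interval_at_def Q_def by (auto simp: dist_real_def max_def min_def field_simps)
  obtain e m where em: "e > 0" "\<And>s t. small_interval_at x e s t \<Longrightarrow> \<bar>F t - F s\<bar> \<le> m * (t - s)"
    using steep by blast
  have "\<bar>Q y\<bar> \<le> m" if y: "y \<noteq> x" "dist y x < e" for y
  proof -
    have "\<bar>Q y * (max x y - min x y)\<bar> \<le> m * (max x y - min x y)"
      using em(2)[OF sym(1)[OF y]] sym(2)[OF y] by simp
    moreover have "max x y - min x y > 0" using y(1) by (auto simp: max_def min_def)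
    ultimately show ?thesis by (simp add: abs_mult)
  qed
  then have ev: "eventually (\<lambda>y. - m \<le> Q y \<and> Q y \<le> m) (at x)"
    unfolding eventually_at using em(1) by (intro exI[of _ e]) force
  have L1: "ereal (-m) \<le> Liminf (at x) (\<lambda>y. ereal (Q y))"
    by (rule Liminf_bounded) (use ev in \<open>auto elim: eventually_mono\<close>)
  have L2: "Limsup (at x) (\<lambda>y. ereal (Q y)) \<le> ereal m"
    by (rule Limsup_bounded) (use ev in \<open>auto elim: eventually_mono\<close>)
  have L3: "Liminf (at x) (\<lambda>y. ereal (Q y)) \<le> Limsup (at x) (\<lambda>y. ereal (Q y))"
    by (rule Liminf_le_Limsup) simp
  have L4: "Limsup (at x) (\<lambda>y. ereal (Q y)) \<le> Liminf (at x) (\<lambda>y. ereal (Q y))"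
  proof (rule ccontr)
    assume "\<not> ?thesis"
    then obtain a where a: "Liminf (at x) (\<lambda>y. ereal (Q y)) < ereal a" "ereal a < Limsup (at x) (\<lambda>y. ereal (Q y))"
      using ereal_dense2 by (metis not_le)
    obtain b where b: "ereal a < ereal b" "ereal b < Limsup (at x) (\<lambda>y. ereal (Q y))"
      using ereal_dense2[OF a(2)] by blast
    \<comment> \<open>Two rationals \<open>r0 < r\<close> strictly between the lower and the upper
      limit: either alternative of \<open>osc\<close> pushes one of the limits past one of
      them.\<close>
    obtain r :: rat where r: "a < of_rat r" "of_rat r < b" using of_rat_dense[of a b] b by auto
    obtain r0 :: rat where r0: "a < of_rat r0" "of_rat r0 < (of_rat r :: real)" using of_rat_dense[OF r(1)] by blast
    then have "r0 < r" by (simp add: of_rat_less)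
    then obtain e' where e': "e' > 0" and
      cases: "(\<forall>s t. small_interval_at x e' s t \<longrightarrow> of_rat r0 * (t - s) \<le> F t - F s) \<or>
        (\<forall>s t. small_interval_at x e' s t \<longrightarrow> F t - F s \<le> of_rat r * (t - s))"
      using osc by blast
    have pos: "max x y - min x y > 0" if "y \<noteq> x" for y using that by (auto simp: max_def min_def)
    show False
      using cases
    proof
      assume *: "\<forall>s t. small_interval_at x e' s t \<longrightarrow> of_rat r0 * (t - s) \<le> F t - F s"
      have "of_rat r0 \<le> Q y" if "y \<noteq> x" "dist y x < e'" for y
        using *[rule_format, OF sym(1)[OF that]] sym(2)[OF that] pos[OF that(1)] by simp
      then have "eventually (\<lambda>y. ereal (of_rat r0) \<le> ereal (Q y)) (at x)"
        unfolding eventually_at using e' by auto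
      then have "ereal (of_rat r0) \<le> Liminf (at x) (\<lambda>y. ereal (Q y))" by (rule Liminf_bounded)
      then show False using a(1) r0(1) by (meson ereal_less_eq(3) less_imp_le not_le order_trans less_ereal.simps(1) order.strict_trans2)
    next
      assume *: "\<forall>s t. small_interval_at x e' s t \<longrightarrow> F t - F s \<le> of_rat r * (t - s)"
      have "Q y \<le> of_rat r" if "y \<noteq> x" "dist y x < e'" for y
        using *[rule_format, OF sym(1)[OF that]] sym(2)[OF that] pos[OF that(1)] by simp
      then have "eventually (\<lambda>y. ereal (Q y) \<le> ereal (of_rat r)) (at x)"
        unfolding eventually_at using e' by auto
      then have "Limsup (at x) (\<lambda>y. ereal (Q y)) \<le> ereal (of_rat r)" by (rule Limsup_bounded)
      then show False using b(2) r(2) by (meson less_ereal.simps(1) less_le_trans not_less order.strict_trans)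
    qed
  qed
  define l where "l = Limsup (at x) (\<lambda>y. ereal (Q y))"
  have "((\<lambda>y. ereal (Q y)) \<longlongrightarrow> l) (at x)"
    unfolding l_def using L3 L4 by (intro Liminf_eq_Limsup) auto
  moreover have "l = ereal (real_of_ereal l)"
  proof -
    have "ereal (-m) \<le> l" "l \<le> ereal m" using L1 L2 L3 unfolding l_def by auto
    then show ?thesis by (cases l) auto
  qed
  ultimately have "(Q \<longlongrightarrow> real_of_ereal l) (at x)" by (metis lim_ereal)
  then have "(F has_field_derivative real_of_ereal l) (at x)"
    unfolding has_field_derivative_iff Q_def by simp
  then show ?thesis using real_differentiable_def by blast
qed

text \<open>An exceptional point either has unbounded quotients, which is \<open>A\<close>, or for
  some rational pair has quotients below the smaller and above the larger slope at every scale,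
  which is \<open>B\<close>. Both sets are null, the second for each of countably many
  pairs.\<close>

lemma bounded_variation_differentiable_AE:
  assumes bv: "bounded_variation_on F c d"
  shows "negligible {x\<in>{c<..<d}. \<not> F differentiable at x}"
proof -
  define A where "A = {x\<in>{c<..<d}. \<forall>e>0. \<forall>m. \<exists>s t. small_interval_at x e s t \<and> \<bar>F t - F s\<bar> > m * (t - s)}"
  define B where "B p = {x\<in>{c<..<d}. \<forall>e>0.
      (\<exists>s t. small_interval_at x e s t \<and> F t - F s < of_rat (fst p) * (t - s)) \<and>
      (\<exists>s t. small_interval_at x e s t \<and> F t - F s > of_rat (snd p) * (t - s))}" for p :: "rat \<times> rat"
  have "negligible A"
    by (rule steep_negligible[OF bv]) (auto simp: A_def)
  moreover have "negligible (B p)" if p: "fst p < snd p" for p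
  proof -
    define r :: real where "r = of_rat (fst p)"
    define r' :: real where "r' = of_rat (snd p)"
    have rr: "r < r'" using p unfolding r_def r'_def by (simp add: of_rat_less)
    show ?thesis
    \<comment> \<open>After subtracting the mean slope \<open>(r + r') / 2\<close> the oscillation
      is symmetric around 0, with amplitude half the gap between the slopes.\<close>
    proof (rule oscillation_negligible[OF bounded_variation_on_diff_linear[OF bv], of _ "(r' - r) / 2" "(r + r') / 2"])
      show "0 < (r' - r) / 2" using rr by simp
      fix x e :: real assume x: "x \<in> B p" and e: "0 < e"
      have lin2: "- ((r' - r) / 2) * z = r * z - (r + r') / 2 * z" "(r' - r) / 2 * z = r' * z - (r + r') / 2 * z" for z
        by (simp_all add: field_simps)
      have lin: "F t - m * t - (F s - m * s) = F t - F s - m * (t - s)" for m s t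
        by (simp add: algebra_simps)
      show "\<exists>s t. small_interval_at x e s t \<and>
             F t - (r + r') / 2 * t - (F s - (r + r') / 2 * s) < - ((r' - r) / 2) * (t - s)"
      proof -
        obtain s t where st: "small_interval_at x e s t" "F t - F s < r * (t - s)" using x e unfolding B_def r_def by blast
        then show ?thesis unfolding lin lin2 by (intro exI[of _ s] exI[of _ t]) simp
      qed
      show "\<exists>s t. small_interval_at x e s t \<and>
             F t - (r + r') / 2 * t - (F s - (r + r') / 2 * s) > (r' - r) / 2 * (t - s)"
      proof -
        obtain s t where st: "small_interval_at x e s t" "F t - F s > r' * (t - s)" using x e unfolding B_def r'_def by blast
        then show ?thesis unfolding lin lin2 by (intro exI[of _ s] exI[of _ t]) simp
      qed
    qed (auto simp: B_def)
  qed
  then have "negligible (\<Union>p\<in>{p. fst p < snd p}. B p)"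
    by (intro negligible_countable_Union) auto
  ultimately have "negligible (A \<union> (\<Union>p\<in>{p. fst p < snd p}. B p))" by (rule negligible_Un)
  moreover have "{x\<in>{c<..<d}. \<not> F differentiable at x} \<subseteq> A \<union> (\<Union>p\<in>{p. fst p < snd p}. B p)"
  proof
    fix x assume x: "x \<in> {x\<in>{c<..<d}. \<not> F differentiable at x}"
    show "x \<in> A \<union> (\<Union>p\<in>{p. fst p < snd p}. B p)"
    proof (rule ccontr)
      assume n: "\<not> ?thesis"
      have "F differentiable at x"
      proof (rule differentiable_or_oscillating)
        show "\<exists>e>0. \<exists>m. \<forall>s t. small_interval_at x e s t \<longrightarrow> \<bar>F t - F s\<bar> \<le> m * (t - s)"
        proof -
          have "\<not> (\<forall>e>0. \<forall>m. \<exists>s t. small_interval_at x e s t \<and> \<bar>F t - F s\<bar> > m * (t - s))"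
            using n x unfolding A_def by blast
          then show ?thesis by (meson not_less)
        qed
        fix r r' :: rat assume "r < r'"
        then have "x \<notin> B (r, r')" using n by force
        then show "\<exists>e>0. (\<forall>s t. small_interval_at x e s t \<longrightarrow> of_rat r * (t - s) \<le> F t - F s) \<or>
        (\<forall>s t. small_interval_at x e s t \<longrightarrow> F t - F s \<le> of_rat r' * (t - s))"
        proof -
          have "\<not> (\<forall>e>0. (\<exists>s t. small_interval_at x e s t \<and> F t - F s < of_rat r * (t - s)) \<and>
            (\<exists>s t. small_interval_at x e s t \<and> F t - F s > of_rat r' * (t - s)))"
            using \<open>x \<notin> B (r, r')\<close> x unfolding B_def by auto
          then show ?thesis by (meson not_less)
        qed
      qed
      then show False using x by simp
    qed
  qed
  ultimately show ?thesis by (rule negligible_subset)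
qed

section \<open>Transfer from bounded variation to absolute continuity\<close>

lemma variation_sum_system:
  assumes "variation_sum F u v s"
  shows "\<exists>(n::nat) U W. (\<forall>i<n. u \<le> U i \<and> U i \<le> W i \<and> W i \<le> v) \<and>
    disjoint_family_on (\<lambda>i. {U i<..<W i}) {..<n} \<and> (\<Sum>i<n. W i - U i) = v - u \<and>
    (\<Sum>i<n. \<bar>F (W i) - F (U i)\<bar>) = s"
  using assms
proof (induction rule: variation_sum.induct)
  case (refl u)
  show ?case by (intro exI[of _ 0] exI[of _ "\<lambda>_. u"]) (auto simp: disjoint_family_on_def)
next
  case (step u w s v)
  then obtain n :: nat and U W where UW: "\<forall>i<n. u \<le> U i \<and> U i \<le> W i \<and> W i \<le> w"
    "disjoint_family_on (\<lambda>i. {U i<..<W i}) {..<n}" "(\<Sum>i<n. W i - U i) = w - u"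
    "(\<Sum>i<n. \<bar>F (W i) - F (U i)\<bar>) = s" by blast
  define U' where "U' = U(n := w)"
  define W' where "W' = W(n := v)"
  have uw: "u \<le> w" using variation_sum_le[OF step.hyps(1)] .
  have eq: "U' i = U i" "W' i = W i" if "i < n" for i using that unfolding U'_def W'_def by auto
  have eqn: "U' n = w" "W' n = v" unfolding U'_def W'_def by auto
  have "\<forall>i<Suc n. u \<le> U' i \<and> U' i \<le> W' i \<and> W' i \<le> v"
    using UW(1) step.hyps(2) uw by (auto simp: less_Suc_eq eq eqn intro: order_trans)
  moreover have "disjoint_family_on (\<lambda>i. {U' i<..<W' i}) {..<Suc n}"
  proof -
    have "disjoint_family_on (\<lambda>i. {U' i<..<W' i}) {..<n}"
      using UW(2) unfolding disjoint_family_on_def by (auto simp: eq)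
    moreover have "{U' n<..<W' n} \<inter> (\<Union>i\<in>{..<n}. {U' i<..<W' i}) = {}"
      using UW(1) by (force simp: eq eqn)
    ultimately show ?thesis unfolding lessThan_Suc by (subst disjoint_family_on_insert) auto
  qed
  moreover have "(\<Sum>i<Suc n. W' i - U' i) = v - u" using UW(3) by (simp add: eq eqn)
  moreover have "(\<Sum>i<Suc n. \<bar>F (W' i) - F (U' i)\<bar>) = s + \<bar>F v - F w\<bar>" using UW(4) by (simp add: eq eqn)
  ultimately show ?case by blast
qed

text \<open>Every partition of an interval shorter than \<open>\<delta>\<close> is a system of total
  length below \<open>\<delta>\<close>, so absolute continuity with \<open>\<epsilon> = 1\<close>
  bounds all variations there by 1. Bounded variation on short intervals is enough, since
  differentiability is local.\<close>

lemma abs_continuous_bounded_variation: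
  assumes "abs_continuous_on {\<alpha>..\<beta>} F"
  obtains \<delta> where "\<delta> > 0"
    "\<And>c d. \<alpha> \<le> c \<Longrightarrow> d \<le> \<beta> \<Longrightarrow> d - c < \<delta> \<Longrightarrow> bounded_variation_on F c d"
proof -
  have "\<exists>\<delta>>0. \<forall>(n::nat) u v. (\<forall>i<n. u i \<le> v i \<and> {u i..v i} \<subseteq> {\<alpha>..\<beta>}) \<and>
      disjoint_family_on (\<lambda>i. {u i<..<v i}) {..<n} \<and> (\<Sum>i<n. v i - u i) < \<delta>
      \<longrightarrow> (\<Sum>i<n. \<bar>F (v i) - F (u i)\<bar>) < 1"
    using assms zero_less_one unfolding abs_continuous_on_def by blast
  then obtain \<delta> where \<delta>: "\<delta> > 0" "\<And>(n::nat) u v. (\<forall>i<n. u i \<le> v i \<and> {u i..v i} \<subseteq> {\<alpha>..\<beta>}) \<and>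
      disjoint_family_on (\<lambda>i. {u i<..<v i}) {..<n} \<and> (\<Sum>i<n. v i - u i) < \<delta>
      \<Longrightarrow> (\<Sum>i<n. \<bar>F (v i) - F (u i)\<bar>) < 1"
    by blast
  have "bounded_variation_on F c d" if cd: "\<alpha> \<le> c" "d \<le> \<beta>" "d - c < \<delta>" for c d
  proof -
    have "s \<le> 1" if uv: "c \<le> u" "v \<le> d" "variation_sum F u v s" for u v s
    proof -
      obtain n :: nat and U W where UW: "\<forall>i<n. u \<le> U i \<and> U i \<le> W i \<and> W i \<le> v"
        "disjoint_family_on (\<lambda>i. {U i<..<W i}) {..<n}" "(\<Sum>i<n. W i - U i) = v - u"
        "(\<Sum>i<n. \<bar>F (W i) - F (U i)\<bar>) = s" using variation_sum_system[OF uv(3)] by blast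
      have "(\<Sum>i<n. \<bar>F (W i) - F (U i)\<bar>) < 1"
      proof (rule \<delta>(2), intro conjI allI impI)
        show "{U i..W i} \<subseteq> {\<alpha>..\<beta>}" if "i < n" for i
          using UW(1)[rule_format, OF that] cd uv by auto
      qed (use UW(1-3) cd uv in auto)
      then show ?thesis using UW(4) by simp
    qed
    then show ?thesis unfolding bounded_variation_on_def by blast
  qed
  then show ?thesis using that \<delta>(1) by blast
qed

lemma abs_continuous_differentiable_AE:
  assumes "abs_continuous_on {\<alpha>..\<beta>} F"
  shows "negligible {x\<in>{\<alpha><..<\<beta>}. \<not> F differentiable at x}"
proof -
  obtain \<delta> where \<delta>: "\<delta> > 0"
    "\<And>c d. \<alpha> \<le> c \<Longrightarrow> d \<le> \<beta> \<Longrightarrow> d - c < \<delta> \<Longrightarrow> bounded_variation_on F c d"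
    using abs_continuous_bounded_variation[OF assms] by blast
  \<comment> \<open>Short intervals with rational end points: countably many, yet every inner point
    lies in one of them.\<close>
  define I where "I = {p :: rat \<times> rat. \<alpha> \<le> of_rat (fst p) \<and> of_rat (snd p) \<le> \<beta> \<and>
     (of_rat (snd p) :: real) - of_rat (fst p) < \<delta>}"
  define N where "N p = {x\<in>{of_rat (fst p)<..<of_rat (snd p)}. \<not> F differentiable at x}" for p :: "rat \<times> rat"
  have "negligible (\<Union>p\<in>I. N p)"
    using bounded_variation_differentiable_AE \<delta>(2) unfolding I_def N_def
    by (intro negligible_countable_Union) auto
  moreover have "{x\<in>{\<alpha><..<\<beta>}. \<not> F differentiable at x} \<subseteq> (\<Union>p\<in>I. N p)"
  proof
    fix x assume x: "x \<in> {x\<in>{\<alpha><..<\<beta>}. \<not> F differentiable at x}"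
    obtain l :: rat where l: "max \<alpha> (x - \<delta> / 3) < of_rat l" "of_rat l < x"
      using of_rat_dense[of "max \<alpha> (x - \<delta> / 3)" x] x \<delta>(1) by auto
    obtain u :: rat where u: "x < of_rat u" "of_rat u < min \<beta> (x + \<delta> / 3)"
      using of_rat_dense[of x "min \<beta> (x + \<delta> / 3)"] x \<delta>(1) by auto
    have "(l, u) \<in> I" "x \<in> N (l, u)" using l u x \<delta>(1) unfolding I_def N_def by auto
    then show "x \<in> (\<Union>p\<in>I. N p)" by blast
  qed
  ultimately show ?thesis by (rule negligible_subset)
qed

section \<open>Fundamental theorem of calculus for absolutely continuous functions\<close>

text \<open>A reindexing: the intervals of a tagged division are indexed by tag and cell, not by an
  initial segment of the naturals.\<close>

lemma abs_continuous_on_finite_family: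
  fixes F :: "real \<Rightarrow> real"
  assumes "abs_continuous_on S F" "\<epsilon> > 0"
  shows "\<exists>\<delta>>0. \<forall>(I :: 'i set) u v. finite I \<longrightarrow> (\<forall>i\<in>I. u i \<le> v i \<and> {u i..v i} \<subseteq> S) \<longrightarrow>
    disjoint_family_on (\<lambda>i. {u i<..<v i}) I \<longrightarrow> (\<Sum>i\<in>I. v i - u i) < \<delta> \<longrightarrow>
    (\<Sum>i\<in>I. \<bar>F (v i) - F (u i)\<bar>) < \<epsilon>"
proof -
  have "\<exists>\<delta>>0. \<forall>(n::nat) u v. (\<forall>i<n. u i \<le> v i \<and> {u i..v i} \<subseteq> S) \<and>
      disjoint_family_on (\<lambda>i. {u i<..<v i}) {..<n} \<and> (\<Sum>i<n. v i - u i) < \<delta>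
      \<longrightarrow> (\<Sum>i<n. \<bar>F (v i) - F (u i)\<bar>) < \<epsilon>"
    using assms unfolding abs_continuous_on_def by blast
  then obtain \<delta> where \<delta>: "\<delta> > 0" and system: "\<And>(n::nat) u v. (\<forall>i<n. u i \<le> v i \<and> {u i..v i} \<subseteq> S) \<and>
      disjoint_family_on (\<lambda>i. {u i<..<v i}) {..<n} \<and> (\<Sum>i<n. v i - u i) < \<delta>
      \<Longrightarrow> (\<Sum>i<n. \<bar>F (v i) - F (u i)\<bar>) < \<epsilon>"
    by blast
  show ?thesis
  proof (intro exI[of _ \<delta>] conjI allI impI \<delta>)
    fix I :: "'i set" and u v
    assume I: "finite I" "\<forall>i\<in>I. u i \<le> v i \<and> {u i..v i} \<subseteq> S"
      "disjoint_family_on (\<lambda>i. {u i<..<v i}) I" "(\<Sum>i\<in>I. v i - u i) < \<delta>"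
    obtain h where h: "bij_betw h {..<card I} I"
      using ex_bij_betw_nat_finite[OF I(1)] unfolding atLeast0LessThan by blast
    have hI: "h i \<in> I" if "i < card I" for i using bij_betwE[OF h] that by auto
    have "(\<Sum>i<card I. \<bar>F (v (h i)) - F (u (h i))\<bar>) < \<epsilon>"
    proof (rule system, intro conjI)
      show "\<forall>i<card I. u (h i) \<le> v (h i) \<and> {u (h i)..v (h i)} \<subseteq> S" using I(2) hI by blast
      show "disjoint_family_on (\<lambda>i. {u (h i)<..<v (h i)}) {..<card I}"
        unfolding disjoint_family_on_def
      proof (intro ballI impI)
        fix i j assume ij: "i \<in> {..<card I}" "j \<in> {..<card I}" "i \<noteq> j"
        then have "h i \<noteq> h j" using bij_betw_imp_inj_on[OF h] by (auto dest: inj_onD)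
        then show "{u (h i)<..<v (h i)} \<inter> {u (h j)<..<v (h j)} = {}"
          using I(3) hI ij unfolding disjoint_family_on_def by blast
      qed
      show "(\<Sum>i<card I. v (h i) - u (h i)) < \<delta>"
        using I(4) sum.reindex_bij_betw[OF h, of "\<lambda>i. v i - u i"] by simp
    qed
    then show "(\<Sum>i\<in>I. \<bar>F (v i) - F (u i)\<bar>) < \<epsilon>"
      using sum.reindex_bij_betw[OF h, of "\<lambda>i. \<bar>F (v i) - F (u i)\<bar>"] by simp
  qed
qed

text \<open>The gauge serves two purposes. At a tag outside \<open>N\<close> it makes the linear
  approximation of \<open>F\<close> accurate. At a tag in \<open>N\<close> it confines the cell to
  an open set \<open>U\<close> of measure below \<open>\<delta>\<close>; there the Riemann terms
  vanish because \<open>g\<close> does, and absolute continuity makes the increments of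
  \<open>F\<close> sum to little. Integrability of \<open>g\<close> is a result and not a
  premise.\<close>

lemma abs_continuous_has_integral:
  fixes F g :: "real \<Rightarrow> real"
  assumes ac: "abs_continuous_on {\<alpha>..\<beta>} F" and le: "\<alpha> \<le> \<beta>" and N: "negligible N"
    and der: "\<And>x. x \<in> {\<alpha>..\<beta>} \<Longrightarrow> x \<notin> N \<Longrightarrow> (F has_real_derivative g x) (at x)"
    and zero: "\<And>x. x \<in> N \<Longrightarrow> g x = 0"
  shows "(g has_integral F \<beta> - F \<alpha>) {\<alpha>..\<beta>}"
  unfolding has_integral_real
proof (intro allI impI)
  fix e :: real assume e: "e > 0"
  \<comment> \<open>Half of the error is reserved for tags outside \<open>N\<close>, the other half
    for tags in \<open>N\<close>; the added 1 avoids division by 0 when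
    \<open>\<alpha> = \<beta>\<close>.\<close>
  define \<eta> where "\<eta> = e / (2 * (\<beta> - \<alpha> + 1))"
  have \<eta>: "\<eta> > 0" "\<eta> * (\<beta> - \<alpha>) < e / 2" using e le unfolding \<eta>_def by (auto simp: field_simps)
  have "\<exists>\<delta>>0. \<forall>(I :: (real \<times> real set) set) u v. finite I \<longrightarrow> (\<forall>i\<in>I. u i \<le> v i \<and> {u i..v i} \<subseteq> {\<alpha>..\<beta>}) \<longrightarrow>
    disjoint_family_on (\<lambda>i. {u i<..<v i}) I \<longrightarrow> (\<Sum>i\<in>I. v i - u i) < \<delta> \<longrightarrow>
    (\<Sum>i\<in>I. \<bar>F (v i) - F (u i)\<bar>) < e / 2"
    by (rule abs_continuous_on_finite_family[OF ac]) (use e in simp)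
  then obtain \<delta> where \<delta>: "\<delta> > 0" and small: "\<And>(I :: (real \<times> real set) set) u v. finite I \<Longrightarrow>
    \<forall>i\<in>I. u i \<le> v i \<and> {u i..v i} \<subseteq> {\<alpha>..\<beta>} \<Longrightarrow>
    disjoint_family_on (\<lambda>i. {u i<..<v i}) I \<Longrightarrow> (\<Sum>i\<in>I. v i - u i) < \<delta> \<Longrightarrow>
    (\<Sum>i\<in>I. \<bar>F (v i) - F (u i)\<bar>) < e / 2"
    by blast
  obtain U where U: "open U" "N \<subseteq> U" "U - N \<in> lmeasurable" "emeasure lebesgue (U - N) < ennreal \<delta>"
    using sets_lebesgue_outer_open[OF negligible_imp_sets[OF N] \<delta>] by blast
  have Un: "U = (U - N) \<union> N" using U(2) by blast
  have Um: "U \<in> lmeasurable"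
    by (subst Un) (intro fmeasurable.Un U negligible_imp_measurable N)
  have "emeasure lebesgue U = emeasure lebesgue (U - N)"
    by (subst Un, rule emeasure_Un_null_set) (use U N in \<open>auto simp: negligible_iff_null_sets\<close>)
  then have Us: "measure lebesgue U < \<delta>"
  proof -
    assume "emeasure lebesgue U = emeasure lebesgue (U - N)"
    then have "ennreal (measure lebesgue U) < ennreal \<delta>"
      using U(4) emeasure_eq_measure2[OF Um] by metis
    then show ?thesis by (simp add: ennreal_less_iff)
  qed
  have "\<exists>d>0. \<forall>y. \<bar>y - x\<bar> < d \<longrightarrow> \<bar>F y - F x - g x * (y - x)\<bar> \<le> \<eta> * \<bar>y - x\<bar>"
    if "x \<in> {\<alpha>..\<beta>}" "x \<notin> N" for x
    using der[OF that] \<eta>(1) unfolding has_field_derivative_def has_derivative_at_alt by (auto simp: mult.commute)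
  then have "\<forall>x\<in>{\<alpha>..\<beta>} - N. \<exists>d>0. \<forall>y. \<bar>y - x\<bar> < d \<longrightarrow> \<bar>F y - F x - g x * (y - x)\<bar> \<le> \<eta> * \<bar>y - x\<bar>"
    by simp
  from bchoice[OF this] obtain d where
    d': "\<forall>x\<in>{\<alpha>..\<beta>} - N. 0 < d x \<and> (\<forall>y. \<bar>y - x\<bar> < d x \<longrightarrow> \<bar>F y - F x - g x * (y - x)\<bar> \<le> \<eta> * \<bar>y - x\<bar>)"
    ..
  have d: "\<And>x. x \<in> {\<alpha>..\<beta>} \<Longrightarrow> x \<notin> N \<Longrightarrow> d x > 0"
    "\<And>x y. x \<in> {\<alpha>..\<beta>} \<Longrightarrow> x \<notin> N \<Longrightarrow> \<bar>y - x\<bar> < d x \<Longrightarrow> \<bar>F y - F x - g x * (y - x)\<bar> \<le> \<eta> * \<bar>y - x\<bar>"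
    using d' by simp_all
  define \<gamma> where "\<gamma> x = (if x \<in> N then U else if x \<in> {\<alpha>..\<beta>} then ball x (d x) else ball x 1)" for x
  have gauge: "gauge \<gamma>"
    unfolding gauge_def \<gamma>_def using U(1,2) d(1) by auto
  have main: "norm ((\<Sum>(x,K)\<in>p. measure lborel K *\<^sub>R g x) - (F \<beta> - F \<alpha>)) < e"
    if p: "p tagged_division_of {\<alpha>..\<beta>}" "\<gamma> fine p" for p
  proof -
    have fin: "finite p" using p(1) by blast
    have K: "x \<in> K" "K \<subseteq> {\<alpha>..\<beta>}" "K \<subseteq> \<gamma> x" "K = {Inf K..Sup K}" "Inf K \<le> Sup K" "measure lborel K = Sup K - Inf K"
      if xKp: "(x, K) \<in> p" for x K
    proof -
      show xK: "x \<in> K" "K \<subseteq> {\<alpha>..\<beta>}" using tagged_division_ofD(2,3)[OF p(1) xKp] by auto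
      show "K \<subseteq> \<gamma> x" using p(2) xKp unfolding fine_def by blast
      obtain a b where ab: "K = {a..b}" using tagged_division_ofD(4)[OF p(1) xKp] by (auto simp: box_real)
      then have "a \<le> b" using xK by auto
      then show "K = {Inf K..Sup K}" "Inf K \<le> Sup K" "measure lborel K = Sup K - Inf K" using ab by auto
    qed
    define l where "l = (\<lambda>i :: real \<times> real set. Inf (snd i))"
    define r where "r = (\<lambda>i :: real \<times> real set. Sup (snd i))"
    define p1 where "p1 = {i\<in>p. fst i \<in> N}"
    define p2 where "p2 = {i\<in>p. fst i \<notin> N}"
    have pp: "p = p1 \<union> p2" "p1 \<inter> p2 = {}" "finite p1" "finite p2"
      unfolding p1_def p2_def using fin by auto
    define t where "t i = measure lborel (snd i) * g (fst i) - (F (r i) - F (l i))" for i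
    have "(\<Sum>(x,K)\<in>p. measure lborel K *\<^sub>R g x) - (F \<beta> - F \<alpha>) = (\<Sum>i\<in>p. t i)"
      unfolding additive_tagged_division_1[OF le p(1), of F, symmetric] t_def l_def r_def
      by (simp add: sum_subtractf split_beta)
    also have "\<dots> = sum t p1 + sum t p2" unfolding pp(1) using pp by (simp add: sum.union_disjoint)
    finally have eq: "norm ((\<Sum>(x,K)\<in>p. measure lborel K *\<^sub>R g x) - (F \<beta> - F \<alpha>)) \<le> (\<Sum>i\<in>p1. \<bar>t i\<bar>) + (\<Sum>i\<in>p2. \<bar>t i\<bar>)"
      using sum_abs[of t p1] sum_abs[of t p2] unfolding real_norm_def by linarith
    have disj: "disjoint_family_on (\<lambda>i. {l i<..<r i}) p"
      unfolding disjoint_family_on_def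
    proof (intro ballI impI)
      fix i j assume ij: "i \<in> p" "j \<in> p" "i \<noteq> j"
      obtain x K y L where *: "i = (x, K)" "j = (y, L)" by (cases i, cases j)
      have "interior K \<inter> interior L = {}"
        using tagged_division_ofD(5)[OF p(1), of x K y L] ij unfolding * by auto
      moreover have "interior K = {Inf K<..<Sup K}" "interior L = {Inf L<..<Sup L}"
        using arg_cong[OF K(4)[of x K], of interior] arg_cong[OF K(4)[of y L], of interior] ij unfolding * by simp_all
      ultimately show "{l i<..<r i} \<inter> {l j<..<r j} = {}" unfolding l_def r_def * by simp
    qed
    have len: "(\<Sum>i\<in>A. r i - l i) = measure lebesgue (\<Union>i\<in>A. {l i<..<r i})" if A: "A \<subseteq> p" for A
    proof -
      have "measure lebesgue (\<Union>i\<in>A. {l i<..<r i}) = (\<Sum>i\<in>A. measure lebesgue {l i<..<r i})"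
      proof (rule measure_UNION')
        show "finite A" using A fin finite_subset by blast
        show "pairwise (\<lambda>i j. disjnt {l i<..<r i} {l j<..<r j}) A"
          using A disj unfolding pairwise_def disjnt_def disjoint_family_on_def by blast
      qed auto
      also have "\<dots> = (\<Sum>i\<in>A. r i - l i)"
        using K(5) A unfolding l_def r_def by (intro sum.cong) auto
      finally show ?thesis by simp
    qed
    have sub1: "{l i<..<r i} \<subseteq> U" if "i \<in> p1" for i
    proof -
      have i: "(fst i, snd i) \<in> p" "fst i \<in> N" using that unfolding p1_def by auto
      have "{l i<..<r i} \<subseteq> {l i..r i}" by auto
      also have "\<dots> = snd i" using K(4)[OF i(1), symmetric] unfolding l_def r_def by simp
      also have "\<dots> \<subseteq> U" using K(3)[OF i(1)] i(2) unfolding \<gamma>_def by simp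
      finally show ?thesis .
    qed
    have p1p: "p1 \<subseteq> p" unfolding p1_def by auto
    have "(\<Sum>i\<in>p1. r i - l i) \<le> measure lebesgue U"
      unfolding len[OF p1p] using sub1 Um
      by (intro measure_mono_fmeasurable sets.finite_UN pp) auto
    then have lt: "(\<Sum>i\<in>p1. r i - l i) < \<delta>" using Us by simp
    have "(\<Sum>i\<in>p1. \<bar>F (r i) - F (l i)\<bar>) < e / 2"
    proof (rule small[OF pp(3) _ _ lt])
      show "disjoint_family_on (\<lambda>i. {l i<..<r i}) p1" using disj p1p unfolding disjoint_family_on_def by blast
      show "\<forall>i\<in>p1. l i \<le> r i \<and> {l i..r i} \<subseteq> {\<alpha>..\<beta>}"
      proof
        fix i assume "i \<in> p1"
        then have "(fst i, snd i) \<in> p" using p1p by auto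
        from K(2)[OF this] K(4)[OF this, symmetric] K(5)[OF this]
        show "l i \<le> r i \<and> {l i..r i} \<subseteq> {\<alpha>..\<beta>}" unfolding l_def r_def by simp
      qed
    qed
    moreover have "(\<Sum>i\<in>p1. \<bar>t i\<bar>) = (\<Sum>i\<in>p1. \<bar>F (r i) - F (l i)\<bar>)"
      unfolding t_def p1_def using zero by (intro sum.cong) auto
    moreover have "(\<Sum>i\<in>p2. \<bar>t i\<bar>) \<le> \<eta> * (\<beta> - \<alpha>)"
    proof -
      have "\<bar>t i\<bar> \<le> \<eta> * (r i - l i)" if i: "i \<in> p2" for i
      proof -
        obtain x L where iL: "i = (x, L)" by (cases i)
        have L: "(x, L) \<in> p" "x \<notin> N" using i unfolding p2_def iL by auto
        have x: "x \<in> {\<alpha>..\<beta>}" using K(1,2)[OF L(1)] by auto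
        have lr: "l i = Inf L" "r i = Sup L" unfolding l_def r_def iL by auto
        have Leq: "L = {l i..r i}" "l i \<le> r i" using K(4,5)[OF L(1)] unfolding lr by blast+
        then have "l i \<in> L" "r i \<in> L" by simp_all
        then have "\<bar>l i - x\<bar> < d x" "\<bar>r i - x\<bar> < d x"
          using K(3)[OF L(1)] L(2) x unfolding \<gamma>_def by (auto simp: dist_real_def subset_iff abs_minus_commute)
        then have "\<bar>F (l i) - F x - g x * (l i - x)\<bar> \<le> \<eta> * \<bar>l i - x\<bar>"
          "\<bar>F (r i) - F x - g x * (r i - x)\<bar> \<le> \<eta> * \<bar>r i - x\<bar>"
          using d(2)[OF x L(2)] by auto
        moreover have "l i \<le> x" "x \<le> r i" using K(1)[OF L(1)] Leq by auto
        \<comment> \<open>Both ends of the cell are compared with the same tag lying between them,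
          so the two error bounds \<open>\<eta> * (x - l i)\<close> and
          \<open>\<eta> * (r i - x)\<close> add up to \<open>\<eta>\<close> times the length of the
          cell.\<close>
        moreover have "t i = (F (l i) - F x - g x * (l i - x)) - (F (r i) - F x - g x * (r i - x))"
          unfolding t_def iL fst_conv snd_conv K(6)[OF L(1)] lr[unfolded iL] by (simp add: algebra_simps)
        ultimately show ?thesis by (simp add: algebra_simps)
      qed
      then have "(\<Sum>i\<in>p2. \<bar>t i\<bar>) \<le> \<eta> * (\<Sum>i\<in>p2. r i - l i)"
        unfolding sum_distrib_left by (rule sum_mono)
      also have "(\<Sum>i\<in>p2. r i - l i) \<le> (\<Sum>i\<in>p. r i - l i)"
        unfolding p2_def using fin K(5) unfolding l_def r_def by (intro sum_mono2) auto
      also have "(\<Sum>i\<in>p. r i - l i) = \<beta> - \<alpha>"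
        using additive_tagged_division_1[OF le p(1), of "\<lambda>x. x"] unfolding l_def r_def by (simp add: split_beta)
      finally show ?thesis using \<eta>(1) by simp
    qed
    ultimately show ?thesis using eq \<eta>(2) by linarith
  qed
  show "\<exists>\<gamma>. gauge \<gamma> \<and> (\<forall>p. p tagged_division_of {\<alpha>..\<beta>} \<and> \<gamma> fine p \<longrightarrow>
      norm ((\<Sum>(x,K)\<in>p. measure lborel K *\<^sub>R g x) - (F \<beta> - F \<alpha>)) < e)"
    by (intro exI[of _ \<gamma>] conjI allI impI gauge main) auto
qed

text \<open>Gauge integrability supplies measurability; a finite right-hand side then gives absolute
  integrability, and the gauge and Lebesgue integrals agree.\<close>

lemma has_integral_le_nn_integral:
  fixes g :: "real \<Rightarrow> real"
  assumes g: "(g has_integral D) S"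
  shows "ennreal \<bar>D\<bar> \<le> (\<integral>\<^sup>+x\<in>S. ennreal \<bar>g x\<bar> \<partial>lborel)"
proof (cases "(\<integral>\<^sup>+x\<in>S. ennreal \<bar>g x\<bar> \<partial>lborel) = \<infinity>")
  case False
  have eq: "(\<integral>\<^sup>+x\<in>S. ennreal \<bar>g x\<bar> \<partial>lborel) = (\<integral>\<^sup>+x. ennreal (norm (indicator S x *\<^sub>R g x)) \<partial>lebesgue)"
    unfolding nn_integral_completion by (intro nn_integral_cong) (auto simp: indicator_def)
  have int: "integrable lebesgue (\<lambda>x. indicator S x *\<^sub>R g x)"
    unfolding integrable_iff_bounded
    using has_integral_implies_lebesgue_measurable[OF g] False unfolding eq by (auto simp: less_top)
  then have "set_integrable lebesgue S g" unfolding set_integrable_def .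
  then have "D = (LINT x|lebesgue. indicator S x *\<^sub>R g x)"
    using set_lebesgue_integral_eq_integral(2)[of S g] integral_unique[OF g]
    unfolding set_lebesgue_integral_def by simp
  then show ?thesis using integral_norm_bound_ennreal[OF int] unfolding eq by simp
qed simp

lemma abs_continuous_diff_le_nn_integral:
  assumes ac: "abs_continuous_on {\<alpha>..\<beta>} F" and le: "\<alpha> \<le> \<beta>"
  shows "ennreal \<bar>F \<beta> - F \<alpha>\<bar> \<le> (\<integral>\<^sup>+x\<in>{\<alpha>..\<beta>}. ennreal \<bar>deriv F x\<bar> \<partial>lborel)"
proof -
  \<comment> \<open>The end points are adjoined because \<open>deriv\<close> is two-sided and
    nothing is known about \<open>F\<close> outside \<open>{\<alpha>..\<beta>}\<close>.\<close>
  define N where "N = {x\<in>{\<alpha><..<\<beta>}. \<not> F differentiable at x} \<union> {\<alpha>, \<beta>}"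
  have N: "negligible N"
    unfolding N_def by (intro negligible_Un abs_continuous_differentiable_AE ac) auto
  define g where "g x = (if x \<in> N then 0 else deriv F x)" for x
  have "(g has_integral F \<beta> - F \<alpha>) {\<alpha>..\<beta>}"
  proof (rule abs_continuous_has_integral[OF ac le N])
    fix x assume "x \<in> {\<alpha>..\<beta>}" "x \<notin> N"
    then show "(F has_real_derivative g x) (at x)"
      unfolding g_def N_def by (auto simp: DERIV_deriv_iff_real_differentiable)
  qed (auto simp: g_def)
  then have "ennreal \<bar>F \<beta> - F \<alpha>\<bar> \<le> (\<integral>\<^sup>+x\<in>{\<alpha>..\<beta>}. ennreal \<bar>g x\<bar> \<partial>lborel)"
    by (rule has_integral_le_nn_integral)
  \<comment> \<open>Default values of \<open>deriv\<close> on \<open>N\<close> can only enlarge the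
    integrand, since \<open>g\<close> is 0 there.\<close>
  also have "\<dots> \<le> (\<integral>\<^sup>+x\<in>{\<alpha>..\<beta>}. ennreal \<bar>deriv F x\<bar> \<partial>lborel)"
    by (intro nn_integral_mono) (auto simp: g_def indicator_def)
  finally show ?thesis .
qed

section \<open>Hardy inequalities\<close>

abbreviation integral01 :: "(real \<Rightarrow> real) \<Rightarrow> ennreal" where
  "integral01 \<phi> \<equiv> \<integral>\<^sup>+t. ennreal (\<phi> t) * indicator {0<..<1} t \<partial>lborel"

text \<open>Taken over \<open>lborel\<close>, although \<open>Lp_norm\<close> integrates over
  \<open>lebesgue\<close>: completing a measure does not change a nonnegative integral.\<close>

abbreviation integral11 :: "(real \<Rightarrow> real) \<Rightarrow> ennreal" where
  "integral11 \<phi> \<equiv> \<integral>\<^sup>+x\<in>{-1..1}. ennreal (\<phi> x) \<partial>lborel"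

section \<open>Young's and Jensen's inequalities for extended nonnegative integrals\<close>

text \<open>The tangent line to the power function at \<open>l\<close>, with equality at
  \<open>x = l\<close>. It is affine in \<open>x powr P\<close>, so it can be integrated before
  \<open>l\<close> is chosen.\<close>

lemma Young_powr:
  fixes x l P :: real
  assumes "0 \<le> x" "0 < l" "1 \<le> P"
  shows "x \<le> l * (1 - 1 / P) + l powr (1 - P) / P * x powr P"
proof (cases "x = 0")
  case True
  then show ?thesis using assms by (simp add: field_simps)
next
  case False
  have "(l powr (1 - P) * x powr P) powr (1 / P) * l powr (1 - 1 / P)
      \<le> 1 / P * (l powr (1 - P) * x powr P) + (1 - 1 / P) * l"
    using assms False by (intro Youngs_inequality_0) auto
  moreover have "(l powr (1 - P) * x powr P) powr (1 / P) * l powr (1 - 1 / P) = x"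
  proof -
    have "(l powr (1 - P) * x powr P) powr (1 / P) = l powr ((1 - P) / P) * x"
      using assms False by (simp add: powr_mult powr_powr)
    then have "(l powr (1 - P) * x powr P) powr (1 / P) * l powr (1 - 1 / P)
        = l powr ((1 - P) / P + (1 - 1 / P)) * x"
      by (simp add: powr_add)
    also have "(1 - P) / P + (1 - 1 / P) = 0" using assms by (simp add: field_simps)
    finally show ?thesis using assms by simp
  qed
  ultimately show ?thesis by (simp add: mult.commute)
qed

text \<open>Young's inequality is integrated against \<open>\<rho>\<close>, and part of
  \<open>v\<close> is absorbed on the left. Working with a number \<open>v\<close> below the
  integral leaves room for an infinite integral on the right.\<close>

lemma nn_integral_powr_Jensen:
  fixes \<phi> \<rho> :: "'a \<Rightarrow> real"
  assumes meas [measurable]: "\<phi> \<in> borel_measurable M" "\<rho> \<in> borel_measurable M"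
    and nonneg: "\<And>x. 0 \<le> \<phi> x" "\<And>x. 0 \<le> \<rho> x" "0 \<le> v" "0 < m" "1 \<le> P"
    and v: "ennreal v \<le> (\<integral>\<^sup>+x. ennreal (\<phi> x * \<rho> x) \<partial>M)"
    and mass: "(\<integral>\<^sup>+x. ennreal (\<rho> x) \<partial>M) \<le> ennreal m"
  shows "ennreal (v powr P) \<le> ennreal (m powr (P - 1)) * (\<integral>\<^sup>+x. ennreal (\<phi> x powr P * \<rho> x) \<partial>M)"
proof (cases "v = 0")
  case False
  then have v0: "v > 0" using nonneg by simp
  \<comment> \<open>The optimal scale: \<open>c1 * m\<close> becomes \<open>v - v / P\<close>, so
    exactly \<open>v / P\<close> survives the absorption.\<close>
  define l where "l = v / m"
  have l: "l > 0" using v0 nonneg unfolding l_def by simp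
  define J where "J = (\<integral>\<^sup>+x. ennreal (\<phi> x powr P * \<rho> x) \<partial>M)"
  define c1 where "c1 = l * (1 - 1 / P)"
  define c2 where "c2 = l powr (1 - P) / P"
  have c: "c1 \<ge> 0" "c2 > 0" using l nonneg unfolding c1_def c2_def by (auto simp: field_simps)
  have "ennreal v \<le> (\<integral>\<^sup>+x. ennreal (\<phi> x * \<rho> x) \<partial>M)" by (rule v)
  also have "\<dots> \<le> (\<integral>\<^sup>+x. ennreal c1 * ennreal (\<rho> x) + ennreal c2 * ennreal (\<phi> x powr P * \<rho> x) \<partial>M)"
  proof (rule nn_integral_mono)
    fix x
    have "\<phi> x * \<rho> x \<le> (c1 + c2 * \<phi> x powr P) * \<rho> x"
      using Young_powr[OF nonneg(1) l nonneg(5), of x] nonneg(2)[of x] unfolding c1_def c2_def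
      by (intro mult_right_mono) auto
    also have "\<dots> = c1 * \<rho> x + c2 * (\<phi> x powr P * \<rho> x)" by (simp add: algebra_simps)
    finally have "ennreal (\<phi> x * \<rho> x) \<le> ennreal (c1 * \<rho> x + c2 * (\<phi> x powr P * \<rho> x))" by (rule ennreal_leI)
    also have "\<dots> = ennreal c1 * ennreal (\<rho> x) + ennreal c2 * ennreal (\<phi> x powr P * \<rho> x)"
      using c nonneg(2)[of x] by (simp add: ennreal_plus ennreal_mult)
    finally show "ennreal (\<phi> x * \<rho> x) \<le> ennreal c1 * ennreal (\<rho> x) + ennreal c2 * ennreal (\<phi> x powr P * \<rho> x)" .
  qed
  also have "\<dots> = ennreal c1 * (\<integral>\<^sup>+x. ennreal (\<rho> x) \<partial>M) + ennreal c2 * J"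
    unfolding J_def by (subst nn_integral_add) (auto simp: nn_integral_cmult)
  also have "\<dots> \<le> ennreal c1 * ennreal m + ennreal c2 * J"
    by (intro add_mono mult_left_mono mass) auto
  finally have main: "ennreal v \<le> ennreal (c1 * m) + ennreal c2 * J"
    using c nonneg by (simp add: ennreal_mult)
  show ?thesis
  proof (cases "J = \<infinity>")
    case True
    then show ?thesis using nonneg unfolding J_def by (simp add: ennreal_mult_top)
  next
    case False
    then obtain j where j: "J = ennreal j" "j \<ge> 0" by (cases J) auto
    have "ennreal v \<le> ennreal (c1 * m + c2 * j)"
      using main c nonneg unfolding j(1) by (simp add: ennreal_plus ennreal_mult j(2))
    then have "v \<le> c1 * m + c2 * j" using c j nonneg by (subst (asm) ennreal_le_iff) auto
    moreover have "c1 * m = v - v / P" unfolding c1_def l_def using nonneg by (simp add: field_simps)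
    ultimately have "v / P \<le> l powr (1 - P) * j / P" unfolding c2_def by simp
    then have "v \<le> l powr (1 - P) * j" using nonneg by (simp add: divide_le_cancel)
    also have "l powr (1 - P) = v powr (1 - P) * m powr (P - 1)"
      unfolding l_def using v0 nonneg by (simp add: powr_divide powr_diff field_simps)
    finally have "v * v powr (P - 1) \<le> v powr (1 - P) * m powr (P - 1) * j * v powr (P - 1)"
      by (intro mult_right_mono) auto
    moreover have "v * v powr (P - 1) = v powr P" using v0 by (simp add: powr_diff)
    moreover have "v powr (1 - P) * v powr (P - 1) = 1" using v0 by (simp add: powr_add[symmetric])
    ultimately have "v powr P \<le> m powr (P - 1) * j"
      by (metis (no_types, lifting) mult.commute mult.left_commute mult.right_neutral)
    then show ?thesis unfolding J_def[symmetric] j(1) using j(2) by (simp add: ennreal_mult[symmetric] ennreal_leI)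
  qed
qed simp

lemma nn_integral_tail_swap:
  fixes w \<phi> :: "real \<Rightarrow> ennreal"
  assumes [measurable]: "w \<in> borel_measurable borel" "\<phi> \<in> borel_measurable borel"
  shows "(\<integral>\<^sup>+y. w y * (\<integral>\<^sup>+t. \<phi> t * indicator {y<..} t \<partial>lborel) \<partial>lborel) =
    (\<integral>\<^sup>+t. \<phi> t * (\<integral>\<^sup>+y. w y * indicator {..<t} y \<partial>lborel) \<partial>lborel)"
proof -
  have "(\<integral>\<^sup>+y. w y * (\<integral>\<^sup>+t. \<phi> t * indicator {y<..} t \<partial>lborel) \<partial>lborel) =
      (\<integral>\<^sup>+y. (\<integral>\<^sup>+t. w y * \<phi> t * (if y < t then 1 else 0) \<partial>lborel) \<partial>lborel)"
    by (subst nn_integral_cmult[symmetric]) (auto intro!: nn_integral_cong simp: indicator_def mult.assoc)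
  also have "\<dots> = (\<integral>\<^sup>+t. (\<integral>\<^sup>+y. w y * \<phi> t * (if y < t then 1 else 0) \<partial>lborel) \<partial>lborel)"
    by (rule lborel_pair.Fubini') measurable
  also have "\<dots> = (\<integral>\<^sup>+t. \<phi> t * (\<integral>\<^sup>+y. w y * indicator {..<t} y \<partial>lborel) \<partial>lborel)"
    by (subst nn_integral_cmult[symmetric]) (auto intro!: nn_integral_cong simp: indicator_def mult_ac)
  finally show ?thesis .
qed

lemma nn_integral_powr_0:
  assumes "-1 < \<beta>" "0 \<le> t"
  shows "(\<integral>\<^sup>+y. ennreal (y powr \<beta>) * indicator {0<..<t} y \<partial>lborel) = ennreal (t powr (\<beta> + 1) / (\<beta> + 1))"
proof -
  have "(\<integral>\<^sup>+y. ennreal (y powr \<beta>) * indicator {0<..<t} y \<partial>lborel) =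
      (\<integral>\<^sup>+y. ennreal (indicator {0..t} y * y powr \<beta>) \<partial>lborel)"
  proof (rule nn_integral_cong_AE)
    have "AE y in lborel. y \<noteq> t" by (rule AE_lborel_singleton)
    then show "AE y in lborel. ennreal (y powr \<beta>) * indicator {0<..<t} y = ennreal (indicator {0..t} y * y powr \<beta>)"
      by eventually_elim (auto simp: indicator_def)
  qed
  also have "\<dots> = ennreal (t powr (\<beta> + 1) / (\<beta> + 1))"
    by (rule nn_integral_has_integral_lebesgue[OF _ has_integral_powr_from_0[OF assms]]) auto
  finally show ?thesis .
qed

lemma nn_integral_powr_tail:
  assumes "0 < \<theta>" "0 < y" "y < 1"
  shows "(\<integral>\<^sup>+t. ennreal (indicator {y<..<1} t * t powr (- 1 - \<theta>)) \<partial>lborel) \<le> ennreal (y powr (- \<theta>) / \<theta>)"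
proof -
  have "((\<lambda>t. t powr (- 1 - \<theta>)) has_integral (- (1 powr (- \<theta>)) / \<theta> - (- (y powr (- \<theta>)) / \<theta>))) {y..1}"
  proof (rule fundamental_theorem_of_calculus)
    fix x assume x: "x \<in> {y..1}"
    show "((\<lambda>x. - (x powr (- \<theta>)) / \<theta>) has_vector_derivative x powr (- 1 - \<theta>)) (at x within {y..1})"
      unfolding has_real_derivative_iff_has_vector_derivative[symmetric]
      by (rule DERIV_subset[of _ _ _ UNIV]) (use x assms in \<open>auto intro!: derivative_eq_intros simp: powr_diff powr_minus field_simps\<close>)
  qed (use assms in simp)
  from nn_integral_has_integral_lebesgue[OF _ this]
  have *: "(\<integral>\<^sup>+t. ennreal (indicator {y..1} t * t powr (- 1 - \<theta>)) \<partial>lborel) = ennreal (- (1 powr (- \<theta>)) / \<theta> - (- (y powr (- \<theta>)) / \<theta>))"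
    by auto
  have "(\<integral>\<^sup>+t. ennreal (indicator {y<..<1} t * t powr (- 1 - \<theta>)) \<partial>lborel) \<le>
    (\<integral>\<^sup>+t. ennreal (indicator {y..1} t * t powr (- 1 - \<theta>)) \<partial>lborel)"
    by (intro nn_integral_mono) (auto simp: indicator_def)
  also have "\<dots> \<le> ennreal (y powr (- \<theta>) / \<theta>)"
    unfolding * using assms by (intro ennreal_leI) auto
  finally show ?thesis .
qed

section \<open>Weighted bounds for functions dominated by tail integrals\<close>

text \<open>The only property of a derivative that the Hardy inequalities use. \<open>B\<close>
  stands for its size at the interior starting point. Measurability is asked of \<open>g\<close>
  alone, so \<open>v\<close> may be modified freely, for example truncated.\<close>

definition tail_dominated :: "(real \<Rightarrow> real) \<Rightarrow> real \<Rightarrow> (real \<Rightarrow> real) \<Rightarrow> bool" where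
  "tail_dominated v B g \<longleftrightarrow> g \<in> borel_measurable borel \<and> (\<forall>t. 0 \<le> g t) \<and> 0 \<le> B \<and>
    (\<forall>y. 0 < y \<longrightarrow> y < 1 \<longrightarrow> 0 \<le> v y \<and>
      ennreal (v y) \<le> ennreal B + (\<integral>\<^sup>+t. ennreal (g t) * indicator {y<..<1} t \<partial>lborel))"

lemma powr_sum_le:
  fixes u w P :: real
  assumes "0 \<le> u" "0 \<le> w" "1 \<le> P"
  shows "(u + w) powr P \<le> 2 powr P * (u powr P + w powr P)"
proof -
  have "(u + w) powr P \<le> (2 * max u w) powr P" using assms by (intro powr_mono2) auto
  also have "\<dots> = 2 powr P * (max u w) powr P" using assms by (simp add: powr_mult)
  also have "(max u w) powr P \<le> u powr P + w powr P" by (auto simp: max_def)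
  finally show ?thesis by simp
qed

text \<open>On \<open>{y<..<1}\<close> write \<open>g t\<close> as
  \<open>g t * t powr (1 + \<theta>)\<close> times the density
  \<open>t powr (- 1 - \<theta>)\<close>, whose mass is at most
  \<open>y powr (- \<theta>) / \<theta>\<close>. Jensen's inequality moves the power
  \<open>P\<close> inside, Tonelli's theorem exchanges the integrals, and the inner one, of
  \<open>y powr \<beta>\<close> below \<open>t\<close>, restores the power
  \<open>(\<alpha> + 1) * P\<close> of \<open>t\<close>.\<close>

lemma Hardy_inequality:
  fixes P \<alpha> :: real
  assumes P: "1 \<le> P" and \<alpha>: "-1 < \<alpha> * P"
  obtains C where "0 < C" "\<And>v B g. tail_dominated v B g \<Longrightarrow>
    integral01 (\<lambda>y. v y powr P * y powr (\<alpha> * P)) \<le>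
    ennreal C * (ennreal (B powr P) +
      integral01 (\<lambda>t. g t powr P * t powr ((\<alpha> + 1) * P)))"
proof -
  \<comment> \<open>The tail mass needs \<open>0 < \<theta>\<close>, integrability at 0 needs
    \<open>-1 < \<beta>\<close>; this choice gives
    \<open>\<beta> + 1 = (\<alpha> * P + 1) * (P + 1) / (2 * P)\<close>.\<close>
  define \<theta> where "\<theta> = (\<alpha> * P + 1) / (2 * P)"
  define \<beta> where "\<beta> = \<alpha> * P - \<theta> * (P - 1)"
  have \<theta>: "\<theta> > 0" using P \<alpha> unfolding \<theta>_def by simp
  have \<beta>: "-1 < \<beta>"
  proof -
    have "\<beta> + 1 = (\<alpha> * P + 1) * (P + 1) / (2 * P)" unfolding \<beta>_def \<theta>_def using P by (simp add: field_simps)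
    then show ?thesis using P \<alpha> by (smt (verit) divide_pos_pos mult_pos_pos)
  qed
  define C0 where "C0 = 2 powr P * (1 / (\<alpha> * P + 1))"
  define C1 where "C1 = 2 powr P * ((1 / \<theta>) powr (P - 1) * (1 / (\<beta> + 1)))"
  have C: "C0 > 0" "C1 > 0" unfolding C0_def C1_def using \<alpha> \<beta> \<theta> by auto
  show ?thesis
  proof (rule that[of "max C0 C1"])
    show "0 < max C0 C1" using C by simp
    fix v B g assume td: "tail_dominated v B g"
    have g [measurable]: "g \<in> borel_measurable borel" and g0: "\<And>t. 0 \<le> g t" and B: "0 \<le> B"
      and v: "\<And>y. 0 < y \<Longrightarrow> y < 1 \<Longrightarrow> 0 \<le> v y"
        "\<And>y. 0 < y \<Longrightarrow> y < 1 \<Longrightarrow> ennreal (v y) \<le> ennreal B + (\<integral>\<^sup>+t. ennreal (g t) * indicator {y<..<1} t \<partial>lborel)"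
      using td unfolding tail_dominated_def by auto
    define J where "J = integral01 (\<lambda>t. g t powr P * t powr ((\<alpha> + 1) * P))"
    define \<phi> where "\<phi> t = ennreal (g t powr P * t powr ((1 + \<theta>) * (P - 1))) * indicator {0<..<1} t" for t
    have [measurable]: "\<phi> \<in> borel_measurable borel" unfolding \<phi>_def by measurable
    have [measurable]: "(\<lambda>y. \<integral>\<^sup>+t. \<phi> t * indicator {y<..} t \<partial>lborel) \<in> borel_measurable borel"
    proof -
      have "(\<lambda>y. \<integral>\<^sup>+t. \<phi> t * (if y < t then 1 else 0) \<partial>lborel) \<in> borel_measurable borel"
        by measurable
      then show ?thesis unfolding indicator_def by (simp add: greaterThan_def)
    qed
    have pw: "ennreal (v y powr P * y powr (\<alpha> * P)) \<le> ennreal (2 powr P * B powr P) * ennreal (y powr (\<alpha> * P))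
        + ennreal (2 powr P * (1 / \<theta>) powr (P - 1)) * (ennreal (y powr \<beta>) * (\<integral>\<^sup>+t. \<phi> t * indicator {y<..} t \<partial>lborel))"
      if y: "0 < y" "y < 1" for y
    proof -
      \<comment> \<open>\<open>B\<close> is split off before Jensen's inequality because it is
        integrated separately, against \<open>y powr (\<alpha> * P)\<close>.\<close>
      define w where "w = max 0 (v y - B)"
      have "ennreal w \<le> (\<integral>\<^sup>+t. ennreal (g t) * indicator {y<..<1} t \<partial>lborel)" (is "_ \<le> ?I")
      proof (cases ?I)
        case (real i)
        then have "v y \<le> B + i" using v(2)[OF y] B by (simp add: ennreal_plus[symmetric] del: ennreal_plus)
        then show ?thesis using real unfolding w_def by (simp add: ennreal_leI)
      qed simp
      also have "?I = (\<integral>\<^sup>+t. ennreal ((g t * t powr (1 + \<theta>)) * (indicator {y<..<1} t * t powr (- 1 - \<theta>))) \<partial>lborel)"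
        using y by (intro nn_integral_cong) (auto simp: indicator_def mult.assoc powr_add[symmetric])
      finally have "ennreal (w powr P) \<le> ennreal ((y powr (- \<theta>) / \<theta>) powr (P - 1)) *
         (\<integral>\<^sup>+t. ennreal ((g t * t powr (1 + \<theta>)) powr P * (indicator {y<..<1} t * t powr (- 1 - \<theta>))) \<partial>lborel)"
        using y \<theta> P g0
        by (intro nn_integral_powr_Jensen nn_integral_powr_tail) (auto simp: w_def)
      also have "(\<integral>\<^sup>+t. ennreal ((g t * t powr (1 + \<theta>)) powr P * (indicator {y<..<1} t * t powr (- 1 - \<theta>))) \<partial>lborel)
         = (\<integral>\<^sup>+t. \<phi> t * indicator {y<..} t \<partial>lborel)"
      proof (rule nn_integral_cong)
        fix t :: real
        show "ennreal ((g t * t powr (1 + \<theta>)) powr P * (indicator {y<..<1} t * t powr (- 1 - \<theta>))) = \<phi> t * indicator {y<..} t"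
        proof (cases "y < t \<and> t < 1")
          case True
          then have "(g t * t powr (1 + \<theta>)) powr P * t powr (- 1 - \<theta>) = g t powr P * (t powr ((1 + \<theta>) * P) * t powr (- 1 - \<theta>))"
            using y g0 by (simp add: powr_mult powr_powr)
          also have "t powr ((1 + \<theta>) * P) * t powr (- 1 - \<theta>) = t powr ((1 + \<theta>) * (P - 1))"
            unfolding powr_add[symmetric] by (simp add: algebra_simps)
          finally show ?thesis using True y unfolding \<phi>_def by simp
        qed (auto simp: \<phi>_def indicator_def)
      qed
      also have "(y powr (- \<theta>) / \<theta>) powr (P - 1) = (1 / \<theta>) powr (P - 1) * y powr (- \<theta> * (P - 1))"
        using y \<theta> by (simp add: powr_divide powr_powr)
      finally have wP: "ennreal (w powr P) \<le> ennreal ((1 / \<theta>) powr (P - 1) * y powr (- \<theta> * (P - 1))) * (\<integral>\<^sup>+t. \<phi> t * indicator {y<..} t \<partial>lborel)" .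
      have "v y powr P \<le> (B + w) powr P"
        using v(1)[OF y] P unfolding w_def by (intro powr_mono2) auto
      also have "\<dots> \<le> 2 powr P * (B powr P + w powr P)"
        using B P unfolding w_def by (intro powr_sum_le) auto
      finally have "v y powr P * y powr (\<alpha> * P) \<le> 2 powr P * (B powr P + w powr P) * y powr (\<alpha> * P)"
        by (intro mult_right_mono) auto
      then have "ennreal (v y powr P * y powr (\<alpha> * P)) \<le> ennreal (2 powr P * B powr P * y powr (\<alpha> * P) + 2 powr P * y powr (\<alpha> * P) * w powr P)"
        by (intro ennreal_leI) (simp add: algebra_simps)
      also have "\<dots> = ennreal (2 powr P * B powr P) * ennreal (y powr (\<alpha> * P)) + ennreal (2 powr P * y powr (\<alpha> * P)) * ennreal (w powr P)"
        by (simp add: ennreal_plus ennreal_mult)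
      also have "\<dots> \<le> ennreal (2 powr P * B powr P) * ennreal (y powr (\<alpha> * P)) +
         ennreal (2 powr P * y powr (\<alpha> * P)) * (ennreal ((1 / \<theta>) powr (P - 1) * y powr (- \<theta> * (P - 1))) * (\<integral>\<^sup>+t. \<phi> t * indicator {y<..} t \<partial>lborel))"
        by (intro add_mono mult_left_mono wP) auto
      also have "ennreal (2 powr P * y powr (\<alpha> * P)) * (ennreal ((1 / \<theta>) powr (P - 1) * y powr (- \<theta> * (P - 1))) * (\<integral>\<^sup>+t. \<phi> t * indicator {y<..} t \<partial>lborel))
         = ennreal (2 powr P * (1 / \<theta>) powr (P - 1)) * (ennreal (y powr \<beta>) * (\<integral>\<^sup>+t. \<phi> t * indicator {y<..} t \<partial>lborel))"
      proof -
        have "y powr \<beta> = y powr (\<alpha> * P) * y powr (- \<theta> * (P - 1))"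
          unfolding \<beta>_def powr_add[symmetric] by simp
        then show ?thesis by (simp add: ennreal_mult mult_ac)
      qed
      finally show ?thesis .
    qed
    have "integral01 (\<lambda>y. v y powr P * y powr (\<alpha> * P)) \<le>
      (\<integral>\<^sup>+y. ennreal (2 powr P * B powr P) * (ennreal (y powr (\<alpha> * P)) * indicator {0<..<1} y) +
        ennreal (2 powr P * (1 / \<theta>) powr (P - 1)) * ((ennreal (y powr \<beta>) * indicator {0<..<1} y) * (\<integral>\<^sup>+t. \<phi> t * indicator {y<..} t \<partial>lborel)) \<partial>lborel)"
    proof (rule nn_integral_mono)
      fix y :: real
      show "ennreal (v y powr P * y powr (\<alpha> * P)) * indicator {0<..<1} y \<le>
        ennreal (2 powr P * B powr P) * (ennreal (y powr (\<alpha> * P)) * indicator {0<..<1} y) +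
        ennreal (2 powr P * (1 / \<theta>) powr (P - 1)) * ((ennreal (y powr \<beta>) * indicator {0<..<1} y) * (\<integral>\<^sup>+t. \<phi> t * indicator {y<..} t \<partial>lborel))"
        using pw[of y] by (cases "0 < y \<and> y < 1") simp_all
    qed
    also have "\<dots> = ennreal (2 powr P * B powr P) * integral01 (\<lambda>y. y powr (\<alpha> * P)) +
       ennreal (2 powr P * (1 / \<theta>) powr (P - 1)) * (\<integral>\<^sup>+y. (ennreal (y powr \<beta>) * indicator {0<..<1} y) * (\<integral>\<^sup>+t. \<phi> t * indicator {y<..} t \<partial>lborel) \<partial>lborel)"
      by (subst nn_integral_add) (simp_all add: nn_integral_cmult)
    also have "integral01 (\<lambda>y. y powr (\<alpha> * P)) = ennreal (1 / (\<alpha> * P + 1))"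
      using nn_integral_powr_0[OF \<alpha>, of 1] by simp
    also have "(\<integral>\<^sup>+y. (ennreal (y powr \<beta>) * indicator {0<..<1} y) * (\<integral>\<^sup>+t. \<phi> t * indicator {y<..} t \<partial>lborel) \<partial>lborel)
       = (\<integral>\<^sup>+t. \<phi> t * (\<integral>\<^sup>+y. ennreal (y powr \<beta>) * indicator {0<..<1} y * indicator {..<t} y \<partial>lborel) \<partial>lborel)"
      by (rule nn_integral_tail_swap) measurable
    also have "\<dots> = (\<integral>\<^sup>+t. ennreal (1 / (\<beta> + 1)) * (ennreal (g t powr P * t powr ((\<alpha> + 1) * P)) * indicator {0<..<1} t) \<partial>lborel)"
    proof (rule nn_integral_cong)
      fix t :: real
      show "\<phi> t * (\<integral>\<^sup>+y. ennreal (y powr \<beta>) * indicator {0<..<1} y * indicator {..<t} y \<partial>lborel) =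
        ennreal (1 / (\<beta> + 1)) * (ennreal (g t powr P * t powr ((\<alpha> + 1) * P)) * indicator {0<..<1} t)"
      proof (cases "0 < t \<and> t < 1")
        case True
        have "(\<integral>\<^sup>+y. ennreal (y powr \<beta>) * indicator {0<..<1} y * indicator {..<t} y \<partial>lborel) =
          (\<integral>\<^sup>+y. ennreal (y powr \<beta>) * indicator {0<..<t} y \<partial>lborel)"
          using True by (intro nn_integral_cong) (auto simp: indicator_def)
        also have "\<dots> = ennreal (t powr (\<beta> + 1) / (\<beta> + 1))" using True by (intro nn_integral_powr_0 \<beta>) auto
        finally have 1: "(\<integral>\<^sup>+y. ennreal (y powr \<beta>) * indicator {0<..<1} y * indicator {..<t} y \<partial>lborel) = ennreal (t powr (\<beta> + 1) / (\<beta> + 1))" .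
        have e: "(1 + \<theta>) * (P - 1) + (\<beta> + 1) = (\<alpha> + 1) * P" unfolding \<beta>_def by (simp add: algebra_simps)
        have "t powr ((\<alpha> + 1) * P) = t powr ((1 + \<theta>) * (P - 1)) * t powr (\<beta> + 1)"
          by (simp only: e[symmetric] powr_add)
        then show ?thesis unfolding 1 \<phi>_def using True \<beta>
          by (simp add: ennreal_mult[symmetric])
      qed (auto simp: \<phi>_def indicator_def)
    qed
    also have "\<dots> = ennreal (1 / (\<beta> + 1)) * J"
      unfolding J_def by (rule nn_integral_cmult) measurable
    finally have "integral01 (\<lambda>y. v y powr P * y powr (\<alpha> * P)) \<le>
       ennreal (2 powr P * B powr P) * ennreal (1 / (\<alpha> * P + 1)) + ennreal (2 powr P * (1 / \<theta>) powr (P - 1)) * (ennreal (1 / (\<beta> + 1)) * J)" .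
    also have "\<dots> = ennreal C0 * ennreal (B powr P) + ennreal C1 * J"
    proof -
      have "ennreal x * (ennreal y * z) = ennreal (x * y) * z" if "0 \<le> x" "0 \<le> y" for x y z
        using that by (simp add: ennreal_mult mult.assoc)
      moreover have "ennreal (2 powr P * B powr P) * ennreal (1 / (\<alpha> * P + 1)) = ennreal C0 * ennreal (B powr P)"
        unfolding C0_def using \<alpha> by (simp add: ennreal_mult[symmetric] mult_ac)
      ultimately show ?thesis unfolding C1_def using \<beta> by (simp add: mult.assoc)
    qed
    also have "\<dots> \<le> ennreal (max C0 C1) * ennreal (B powr P) + ennreal (max C0 C1) * J"
      by (intro add_mono mult_right_mono ennreal_leI) auto
    also have "\<dots> = ennreal (max C0 C1) * (ennreal (B powr P) + J)" by (simp add: distrib_left)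
    finally show "integral01 (\<lambda>y. v y powr P * y powr (\<alpha> * P)) \<le>
      ennreal (max C0 C1) * (ennreal (B powr P) + integral01 (\<lambda>t. g t powr P * t powr ((\<alpha> + 1) * P)))"
      unfolding J_def .
  qed
qed

lemma Hardy_pointwise:
  fixes P \<alpha> :: real
  assumes P: "1 \<le> P" and \<alpha>: "-1 < \<alpha> * P"
  obtains C where "0 < C" "\<And>v B g y. tail_dominated v B g \<Longrightarrow> 0 < y \<Longrightarrow> y < 1 \<Longrightarrow>
    ennreal ((v y * y powr (\<alpha> + 1 / P)) powr P) \<le>
    ennreal C * (ennreal (B powr P) +
      integral01 (\<lambda>t. g t powr P * t powr ((\<alpha> + 1) * P)))"
proof -
  obtain C where C: "0 < C" and hardy: "\<And>v B g. tail_dominated v B g \<Longrightarrow>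
    integral01 (\<lambda>y. v y powr P * y powr (\<alpha> * P)) \<le>
    ennreal C * (ennreal (B powr P) +
      integral01 (\<lambda>t. g t powr P * t powr ((\<alpha> + 1) * P)))"
    using Hardy_inequality[OF P \<alpha>] by blast
  show ?thesis
  proof (rule that[of "(\<alpha> * P + 1) * C"])
    show "0 < (\<alpha> * P + 1) * C" using C \<alpha> by simp
    fix v B g and y :: real assume td: "tail_dominated v B g" and y: "0 < y" "y < 1"
    define R where "R = ennreal (B powr P) +
      integral01 (\<lambda>t. g t powr P * t powr ((\<alpha> + 1) * P))"
    define v' where "v' t = (if t \<le> y then v y else 0)" for t
    have vy: "0 \<le> v y" using td y unfolding tail_dominated_def by blast
    \<comment> \<open>The tail integral decreases in its lower limit, so it also dominates the step of height \<open>v y\<close> on \<open>(0, y]\<close>.\<close>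
    have td': "tail_dominated v' B g"
      unfolding tail_dominated_def
    proof (intro conjI allI impI)
      fix t :: real assume t: "0 < t" "t < 1"
      show "0 \<le> v' t" using vy unfolding v'_def by simp
      show "ennreal (v' t) \<le> ennreal B + (\<integral>\<^sup>+s. ennreal (g s) * indicator {t<..<1} s \<partial>lborel)"
      proof (cases "t \<le> y")
        case True
        have "ennreal (v y) \<le> ennreal B + (\<integral>\<^sup>+s. ennreal (g s) * indicator {y<..<1} s \<partial>lborel)"
          using td y unfolding tail_dominated_def by blast
        also have "\<dots> \<le> ennreal B + (\<integral>\<^sup>+s. ennreal (g s) * indicator {t<..<1} s \<partial>lborel)"
          using True by (intro add_mono nn_integral_mono mult_left_mono) (auto simp: indicator_def)
        finally show ?thesis using True unfolding v'_def by simp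
      qed (simp add: v'_def)
    qed (use td in \<open>auto simp: tail_dominated_def\<close>)
    have "ennreal (v y powr P) * ennreal (y powr (\<alpha> * P + 1) / (\<alpha> * P + 1)) =
        (\<integral>\<^sup>+t. ennreal (v y powr P) * (ennreal (t powr (\<alpha> * P)) * indicator {0<..<y} t) \<partial>lborel)"
      using nn_integral_powr_0[OF \<alpha>, of y] y by (subst nn_integral_cmult) simp_all
    also have "\<dots> \<le> integral01 (\<lambda>t. v' t powr P * t powr (\<alpha> * P))"
    proof (rule nn_integral_mono)
      fix t :: real
      show "ennreal (v y powr P) * (ennreal (t powr (\<alpha> * P)) * indicator {0<..<y} t)
        \<le> ennreal (v' t powr P * t powr (\<alpha> * P)) * indicator {0<..<1} t"
        using y by (cases "0 < t \<and> t < y") (auto simp: v'_def ennreal_mult)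
    qed
    also have "\<dots> \<le> ennreal C * R" unfolding R_def by (rule hardy[OF td'])
    finally have "ennreal (\<alpha> * P + 1) * (ennreal (v y powr P) * ennreal (y powr (\<alpha> * P + 1) / (\<alpha> * P + 1))) \<le>
       ennreal (\<alpha> * P + 1) * (ennreal C * R)" by (rule mult_left_mono) simp
    moreover have "ennreal (\<alpha> * P + 1) * (ennreal (v y powr P) * ennreal (y powr (\<alpha> * P + 1) / (\<alpha> * P + 1)))
       = ennreal ((v y * y powr (\<alpha> + 1 / P)) powr P)"
    proof -
      have "(v y * y powr (\<alpha> + 1 / P)) powr P = v y powr P * y powr (\<alpha> * P + 1)"
        using vy y P by (simp add: powr_mult powr_powr distrib_right)
      also have "\<dots> = (\<alpha> * P + 1) * (v y powr P * (y powr (\<alpha> * P + 1) / (\<alpha> * P + 1)))"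
        using \<alpha> by simp
      finally show ?thesis using \<alpha> by (simp only: ennreal_mult[symmetric])
         (subst ennreal_mult, auto simp: ennreal_mult[symmetric])
    qed
    ultimately show "ennreal ((v y * y powr (\<alpha> + 1 / P)) powr P) \<le> ennreal ((\<alpha> * P + 1) * C) *
      (ennreal (B powr P) + integral01 (\<lambda>t. g t powr P * t powr ((\<alpha> + 1) * P)))"
      unfolding R_def[symmetric] using \<alpha> C by (simp add: ennreal_mult mult.assoc)
  qed
qed

lemma powr_le_cancel_base:
  fixes x y P :: real
  assumes "0 < P" "0 \<le> x" "0 \<le> y" "x powr P \<le> y powr P"
  shows "x \<le> y"
  using assms by (meson not_le powr_less_mono2)

text \<open>The pointwise bound for \<open>\<alpha> = a - 1 / P\<close>, where \<open>0 < a\<close>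
  is the condition \<open>-1 < \<alpha> * P\<close>. One number \<open>N\<close> majorises both
  \<open>B\<close> and the norm of \<open>g\<close>, whence the factor 2 under the root.\<close>

lemma Hardy_sup:
  fixes P a :: real
  assumes P: "1 \<le> P" and a: "0 < a"
  obtains C where "0 < C" "\<And>v B g y N. tail_dominated v B g \<Longrightarrow> 0 < y \<Longrightarrow> y < 1 \<Longrightarrow> 0 \<le> N \<Longrightarrow> B \<le> N \<Longrightarrow>
     integral01 (\<lambda>t. g t powr P * t powr ((a - 1 / P + 1) * P)) \<le> ennreal (N powr P) \<Longrightarrow>
    v y * y powr a \<le> C * N"
proof -
  have \<alpha>: "-1 < (a - 1 / P) * P" using P a by (simp add: left_diff_distrib)
  obtain C where C: "0 < C" "\<And>v B g y. tail_dominated v B g \<Longrightarrow> 0 < y \<Longrightarrow> y < 1 \<Longrightarrow>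
    ennreal ((v y * y powr (a - 1 / P + 1 / P)) powr P) \<le>
    ennreal C * (ennreal (B powr P) +
      integral01 (\<lambda>t. g t powr P * t powr ((a - 1 / P + 1) * P)))"
    using Hardy_pointwise[OF P \<alpha>] by blast
  show ?thesis
  proof (rule that[of "(2 * C) powr (1 / P)"])
    show "0 < (2 * C) powr (1 / P)" using C by simp
    fix v B g and y N :: real assume *: "tail_dominated v B g" "0 < y" "y < 1" "0 \<le> N" "B \<le> N"
      "integral01 (\<lambda>t. g t powr P * t powr ((a - 1 / P + 1) * P)) \<le> ennreal (N powr P)"
    have B: "0 \<le> B" "0 \<le> v y" using * unfolding tail_dominated_def by auto
    have "ennreal ((v y * y powr a) powr P) \<le> ennreal C * (ennreal (N powr P) + ennreal (N powr P))"
    proof -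
      have "ennreal ((v y * y powr a) powr P) \<le> ennreal C * (ennreal (B powr P) +
          integral01 (\<lambda>t. g t powr P * t powr ((a - 1 / P + 1) * P)))"
        using C(2)[OF *(1-3)] unfolding diff_add_cancel .
      also have "\<dots> \<le> ennreal C * (ennreal (N powr P) + ennreal (N powr P))"
        by (intro mult_left_mono add_mono ennreal_leI powr_mono2 *(5,6)) (use B P in auto)
      finally show ?thesis .
    qed
    also have "\<dots> = ennreal (2 * C * N powr P)" using C(1) by (simp add: ennreal_plus[symmetric] ennreal_mult[symmetric] del: ennreal_plus)
    finally have "(v y * y powr a) powr P \<le> 2 * C * N powr P" using C(1) by (simp add: ennreal_le_iff)
    also have "\<dots> = ((2 * C) powr (1 / P) * N) powr P"
    proof -
      have "((2 * C) powr (1 / P)) powr P = 2 * C"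
        using C(1) P by (simp only: powr_powr) simp
      then show ?thesis using C(1) *(4) by (subst powr_mult) auto
    qed
    finally have fin: "(v y * y powr a) powr P \<le> ((2 * C) powr (1 / P) * N) powr P" .
    show "v y * y powr a \<le> (2 * C) powr (1 / P) * N"
      by (rule powr_le_cancel_base[OF _ _ _ fin]) (use B(2) P *(4) in simp_all)
  qed
qed

text \<open>A simple function below \<open>c * f\<close> becomes, after division by
  \<open>c\<close>, one below \<open>f\<close>. The inequality thus holds for integrands that may be
  nonmeasurable, such as those built from \<open>v\<close> in \<open>tail_dominated\<close>.\<close>

lemma nn_integral_cmult_le:
  fixes f :: "'a \<Rightarrow> ennreal"
  assumes "0 \<le> c"
  shows "(\<integral>\<^sup>+x. ennreal c * f x \<partial>M) \<le> ennreal c * (\<integral>\<^sup>+x. f x \<partial>M)"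
proof (cases "c = 0")
  case False
  then have c: "0 < c" using assms by simp
  have inv: "ennreal c * (ennreal (1 / c) * z) = z" "ennreal (1 / c) * (ennreal c * z) = z" for z
    using c by (simp_all add: mult.assoc[symmetric] ennreal_mult[symmetric])
  have "(\<integral>\<^sup>+x. s x \<partial>M) \<le> ennreal c * (\<integral>\<^sup>+x. f x \<partial>M)"
    if s: "simple_function M s" "s \<le> (\<lambda>x. ennreal c * f x)" for s
  proof -
    have [measurable]: "s \<in> borel_measurable M" using s(1) by (rule borel_measurable_simple_function)
    have "(\<integral>\<^sup>+x. s x \<partial>M) = (\<integral>\<^sup>+x. ennreal c * (ennreal (1 / c) * s x) \<partial>M)"
      unfolding inv ..
    also have "\<dots> = ennreal c * (\<integral>\<^sup>+x. ennreal (1 / c) * s x \<partial>M)"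
      by (rule nn_integral_cmult) measurable
    also have "\<dots> \<le> ennreal c * (\<integral>\<^sup>+x. f x \<partial>M)"
    proof (intro mult_left_mono nn_integral_mono)
      fix x
      have "ennreal (1 / c) * s x \<le> ennreal (1 / c) * (ennreal c * f x)"
        using s(2) by (intro mult_left_mono) (auto simp: le_fun_def)
      then show "ennreal (1 / c) * s x \<le> f x" unfolding inv .
    qed simp
    finally show ?thesis .
  qed
  then show ?thesis
    unfolding nn_integral_def[of M "\<lambda>x. ennreal c * f x"]
    by (intro SUP_least) (auto simp: nn_integral_eq_simple_integral[symmetric])
qed simp

text \<open>Of the \<open>Q\<close> factors \<open>v y\<close>, the surplus \<open>Q - P\<close> is
  estimated by the supremum bound and the remaining \<open>P\<close> by the integral bound. With
  \<open>\<alpha> = a + 1 / Q - 1 / P\<close> both bounds involve the same integral of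
  \<open>g\<close>.\<close>

lemma Hardy_interpolated:
  fixes P Q a :: real
  assumes P: "1 \<le> P" and Q: "P \<le> Q" and a: "- 1 / Q < a"
  obtains C where "0 < C" "\<And>v B g N. tail_dominated v B g \<Longrightarrow> 0 \<le> N \<Longrightarrow> B \<le> N \<Longrightarrow>
     integral01 (\<lambda>t. g t powr P * t powr ((a + 1 / Q - 1 / P + 1) * P)) \<le> ennreal (N powr P) \<Longrightarrow>
    integral01 (\<lambda>y. (v y * y powr a) powr Q) \<le> ennreal (C * N powr Q)"
proof -
  define \<alpha> where "\<alpha> = a + 1 / Q - 1 / P"
  have aQ: "0 < a + 1 / Q" using a by (simp add: minus_divide_left[symmetric])
  have \<alpha>: "-1 < \<alpha> * P" using P mult_pos_pos[OF aQ, of P] unfolding \<alpha>_def by (simp add: left_diff_distrib)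
  obtain C1 where C1: "0 < C1" and hardy: "\<And>v B g. tail_dominated v B g \<Longrightarrow>
    integral01 (\<lambda>y. v y powr P * y powr (\<alpha> * P)) \<le>
    ennreal C1 * (ennreal (B powr P) +
      integral01 (\<lambda>t. g t powr P * t powr ((\<alpha> + 1) * P)))"
    using Hardy_inequality[OF P \<alpha>] by blast
  obtain C2 where C2: "0 < C2" and sup: "\<And>v B g y N. tail_dominated v B g \<Longrightarrow> 0 < y \<Longrightarrow> y < 1 \<Longrightarrow> 0 \<le> N \<Longrightarrow> B \<le> N \<Longrightarrow>
     integral01 (\<lambda>t. g t powr P * t powr ((a + 1 / Q - 1 / P + 1) * P)) \<le> ennreal (N powr P) \<Longrightarrow>
    v y * y powr (a + 1 / Q) \<le> C2 * N"
    using Hardy_sup[OF P aQ] by blast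
  show ?thesis
  proof (rule that[of "2 * C1 * C2 powr (Q - P)"])
    show "0 < 2 * C1 * C2 powr (Q - P)" using C1 C2 by simp
    fix v B g and N :: real assume *: "tail_dominated v B g" "0 \<le> N" "B \<le> N"
      "integral01 (\<lambda>t. g t powr P * t powr ((a + 1 / Q - 1 / P + 1) * P)) \<le> ennreal (N powr P)"
    have B: "0 \<le> B" using * unfolding tail_dominated_def by auto
    have v0: "0 \<le> v y" if "0 < y" "y < 1" for y using * that unfolding tail_dominated_def by auto
    have pw: "(v y * y powr a) powr Q \<le> (C2 * N) powr (Q - P) * (v y powr P * y powr (\<alpha> * P))"
      if y: "0 < y" "y < 1" for y
    proof (cases "v y = 0")
      case False
      then have v: "0 < v y" using v0[OF y] by simp
      have "v y powr Q * y powr (a * Q) = (v y * y powr (a + 1 / Q)) powr (Q - P) * (v y powr P * y powr (\<alpha> * P))"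
      proof -
        \<comment> \<open>The powers of \<open>y\<close> balance: this identity is what determines
          \<open>\<alpha>\<close>.\<close>
        have e: "(a + 1 / Q) * (Q - P) + \<alpha> * P = a * Q"
          unfolding \<alpha>_def using P Q by (simp add: field_simps)
        have "(v y * y powr (a + 1 / Q)) powr (Q - P) * (v y powr P * y powr (\<alpha> * P)) =
          (v y powr (Q - P) * v y powr P) * (y powr ((a + 1 / Q) * (Q - P)) * y powr (\<alpha> * P))"
          using v y by (simp add: powr_mult powr_powr mult_ac)
        also have "\<dots> = v y powr Q * y powr (a * Q)" unfolding powr_add[symmetric] e by simp
        finally show ?thesis by simp
      qed
      also have "\<dots> \<le> (C2 * N) powr (Q - P) * (v y powr P * y powr (\<alpha> * P))"
        using sup[OF *(1) y *(2-4)] Q v y by (intro mult_right_mono powr_mono2) auto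
      finally show ?thesis using v y by (simp add: powr_mult powr_powr)
    qed simp
    have "integral01 (\<lambda>y. (v y * y powr a) powr Q) \<le>
      (\<integral>\<^sup>+y. ennreal ((C2 * N) powr (Q - P)) * (ennreal (v y powr P * y powr (\<alpha> * P)) * indicator {0<..<1} y) \<partial>lborel)"
    proof (rule nn_integral_mono)
      fix y :: real
      show "ennreal ((v y * y powr a) powr Q) * indicator {0<..<1} y \<le>
        ennreal ((C2 * N) powr (Q - P)) * (ennreal (v y powr P * y powr (\<alpha> * P)) * indicator {0<..<1} y)"
        using pw[of y] by (cases "0 < y \<and> y < 1") (simp_all add: ennreal_mult'[symmetric] ennreal_leI)
    qed
    also have "\<dots> \<le> ennreal ((C2 * N) powr (Q - P)) * integral01 (\<lambda>y. v y powr P * y powr (\<alpha> * P))"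
      by (rule nn_integral_cmult_le) simp
    also have "\<dots> \<le> ennreal ((C2 * N) powr (Q - P)) * (ennreal C1 * (ennreal (B powr P) +
      integral01 (\<lambda>t. g t powr P * t powr ((\<alpha> + 1) * P))))"
      by (intro mult_left_mono hardy[OF *(1)]) auto
    also have "\<dots> \<le> ennreal ((C2 * N) powr (Q - P)) * (ennreal C1 * (ennreal (N powr P) + ennreal (N powr P)))"
      using *(4) B *(3) P unfolding \<alpha>_def by (intro mult_left_mono add_mono ennreal_leI powr_mono2) auto
    also have "\<dots> = ennreal ((C2 * N) powr (Q - P) * (2 * C1 * N powr P))"
      using C1 by (simp add: ennreal_plus[symmetric] ennreal_mult[symmetric] del: ennreal_plus)
    also have "(C2 * N) powr (Q - P) * (2 * C1 * N powr P) = 2 * C1 * C2 powr (Q - P) * N powr Q"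
    proof -
      have "N powr Q = N powr (Q - P) * N powr P" unfolding powr_add[symmetric] by simp
      then show ?thesis using C2 *(2) by (simp add: powr_mult mult_ac)
    qed
    finally show "integral01 (\<lambda>y. (v y * y powr a) powr Q) \<le>
      ennreal (2 * C1 * C2 powr (Q - P) * N powr Q)" .
  qed
qed

section \<open>Iterated integration from an interior point\<close>

text \<open>The family \<open>u\<close> consists of successive derivatives as functions of the
  distance to an end point, and \<open>B\<close> bounds their values at distance 1. Each integration
  over \<open>{y<..<1}\<close> adds one more \<open>B\<close>, because the length is below 1, and
  one factor \<open>t\<close>. Thus \<open>t ^ j\<close> takes the place of the Taylor kernel
  \<open>(t - y) ^ j / fact j\<close>, which it majorises.\<close>

lemma Taylor_tail_dominated:
  fixes u :: "nat \<Rightarrow> real \<Rightarrow> real" and G :: "real \<Rightarrow> real"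
  assumes G: "G \<in> borel_measurable borel" "\<And>t. 0 \<le> G t" and B: "0 \<le> B" and k: "0 < k"
    and top: "\<And>y. 0 < y \<Longrightarrow> y < 1 \<Longrightarrow>
      ennreal \<bar>u (k - 1) y\<bar> \<le> ennreal B + (\<integral>\<^sup>+t. ennreal (G t) * indicator {y<..<1} t \<partial>lborel)"
    and down: "\<And>i y. i < k - 1 \<Longrightarrow> 0 < y \<Longrightarrow> y < 1 \<Longrightarrow>
      ennreal \<bar>u i y\<bar> \<le> ennreal B + (\<integral>\<^sup>+t. ennreal \<bar>u (Suc i) t\<bar> * indicator {y<..<1} t \<partial>lborel)"
  shows "tail_dominated (\<lambda>y. \<bar>u 0 y\<bar>) (real k * B) (\<lambda>t. t ^ (k - 1) * G t * indicator {0<..<1} t)"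
proof -
  note [measurable] = G(1)
  have step: "ennreal \<bar>u (k - 1 - j) y\<bar> \<le> ennreal (real (Suc j) * B) +
      (\<integral>\<^sup>+t. ennreal (t ^ j * G t) * indicator {y<..<1} t \<partial>lborel)"
    if "j \<le> k - 1" "0 < y" "y < 1" for j y
    using that
  proof (induction j arbitrary: y)
    case 0
    then show ?case using top by simp
  next
    case (Suc j)
    define \<phi> where "\<phi> t = ennreal (t ^ j * G t) * indicator {0<..<1} t" for t
    have [measurable]: "\<phi> \<in> borel_measurable borel" unfolding \<phi>_def by measurable
    have meas [measurable]: "(\<lambda>y. \<integral>\<^sup>+t. \<phi> t * indicator {y<..} t \<partial>lborel) \<in> borel_measurable borel"
    proof -
      have "(\<lambda>y. \<integral>\<^sup>+t. \<phi> t * (if y < t then 1 else 0) \<partial>lborel) \<in> borel_measurable borel"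
        by measurable
      then show ?thesis unfolding indicator_def by (simp add: greaterThan_def)
    qed
    have S: "k - 1 - j = Suc (k - 1 - Suc j)" using Suc.prems by linarith
    have "ennreal \<bar>u (k - 1 - Suc j) y\<bar> \<le> ennreal B + (\<integral>\<^sup>+s. ennreal \<bar>u (k - 1 - j) s\<bar> * indicator {y<..<1} s \<partial>lborel)"
      unfolding S by (rule down) (use Suc.prems in linarith)+
    also have "(\<integral>\<^sup>+s. ennreal \<bar>u (k - 1 - j) s\<bar> * indicator {y<..<1} s \<partial>lborel) \<le>
      (\<integral>\<^sup>+s. ennreal (real (Suc j) * B) * indicator {y<..<1} s +
         indicator {y<..<1} s * (\<integral>\<^sup>+t. \<phi> t * indicator {s<..} t \<partial>lborel) \<partial>lborel)"
    proof (rule nn_integral_mono)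
      fix s :: real
      show "ennreal \<bar>u (k - 1 - j) s\<bar> * indicator {y<..<1} s \<le> ennreal (real (Suc j) * B) * indicator {y<..<1} s +
         indicator {y<..<1} s * (\<integral>\<^sup>+t. \<phi> t * indicator {s<..} t \<partial>lborel)"
      proof (cases "y < s \<and> s < 1")
        case True
        have "ennreal \<bar>u (k - 1 - j) s\<bar> \<le> ennreal (real (Suc j) * B) +
           (\<integral>\<^sup>+t. ennreal (t ^ j * G t) * indicator {s<..<1} t \<partial>lborel)"
          using Suc.IH[of s] Suc.prems True by simp
        also have "(\<integral>\<^sup>+t. ennreal (t ^ j * G t) * indicator {s<..<1} t \<partial>lborel) = (\<integral>\<^sup>+t. \<phi> t * indicator {s<..} t \<partial>lborel)"
          using True Suc.prems by (intro nn_integral_cong) (auto simp: \<phi>_def indicator_def)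
        finally show ?thesis using True by simp
      qed simp
    qed
    also have "\<dots> = ennreal (real (Suc j) * B) * ennreal (1 - y) +
         (\<integral>\<^sup>+s. indicator {y<..<1} s * (\<integral>\<^sup>+t. \<phi> t * indicator {s<..} t \<partial>lborel) \<partial>lborel)"
      using Suc.prems by (subst nn_integral_add) (simp_all add: nn_integral_cmult_indicator)
    also have "(\<integral>\<^sup>+s. indicator {y<..<1} s * (\<integral>\<^sup>+t. \<phi> t * indicator {s<..} t \<partial>lborel) \<partial>lborel) =
         (\<integral>\<^sup>+t. \<phi> t * (\<integral>\<^sup>+s. indicator {y<..<1} s * indicator {..<t} s \<partial>lborel) \<partial>lborel)"
      by (rule nn_integral_tail_swap) measurable
    also have "\<dots> \<le> (\<integral>\<^sup>+t. ennreal (t ^ Suc j * G t) * indicator {y<..<1} t \<partial>lborel)"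
    proof (rule nn_integral_mono)
      fix t :: real
      show "\<phi> t * (\<integral>\<^sup>+s. indicator {y<..<1} s * indicator {..<t} s \<partial>lborel) \<le> ennreal (t ^ Suc j * G t) * indicator {y<..<1} t"
      proof (cases "y < t \<and> t < 1")
        case True
        have "(\<integral>\<^sup>+s. indicator {y<..<1} s * indicator {..<t} s \<partial>lborel) = (\<integral>\<^sup>+s. indicator {y<..<t} s \<partial>lborel)"
          using True by (intro nn_integral_cong) (auto simp: indicator_def)
        also have "\<dots> = ennreal (t - y)" using True by (simp add: nn_integral_indicator)
        \<comment> \<open>Enlarging \<open>t - y\<close> to \<open>t\<close> makes the kernel
          independent of \<open>y\<close>, as \<open>tail_dominated\<close> requires.\<close>
        also have "\<dots> \<le> ennreal t" using Suc.prems by (intro ennreal_leI) simp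
        finally have "\<phi> t * (\<integral>\<^sup>+s. indicator {y<..<1} s * indicator {..<t} s \<partial>lborel) \<le> ennreal (t ^ j * G t) * ennreal t"
          using True Suc.prems unfolding \<phi>_def by (simp add: mult_left_mono)
        also have "\<dots> = ennreal (t ^ Suc j * G t)"
          using True Suc.prems G(2)[of t] by (simp add: ennreal_mult[symmetric] mult_ac)
        finally show ?thesis using True by simp
      next
        case False
        have "(\<integral>\<^sup>+s. indicator {y<..<1} s * indicator {..<t} s \<partial>lborel) = (\<integral>\<^sup>+s. 0 \<partial>(lborel::real measure))" if "t \<le> y"
          using that by (intro nn_integral_cong) (auto simp: indicator_def)
        then show ?thesis using False unfolding \<phi>_def by (cases "t \<le> y") (auto simp: indicator_def)
      qed
    qed
    also have "ennreal (real (Suc j) * B) * ennreal (1 - y) \<le> ennreal (real (Suc j) * B)"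
      using Suc.prems B by (simp add: ennreal_mult[symmetric] ennreal_leI mult_left_le)
    finally have "ennreal \<bar>u (k - 1 - Suc j) y\<bar> \<le> ennreal B + (ennreal (real (Suc j) * B) +
       (\<integral>\<^sup>+t. ennreal (t ^ Suc j * G t) * indicator {y<..<1} t \<partial>lborel))"
      by (simp add: add_left_mono add_right_mono)
    also have "\<dots> = ennreal (real (Suc (Suc j)) * B) + (\<integral>\<^sup>+t. ennreal (t ^ Suc j * G t) * indicator {y<..<1} t \<partial>lborel)"
      using B by (simp add: add.assoc[symmetric] ennreal_plus[symmetric] algebra_simps del: ennreal_plus)
    finally show ?case .
  qed
  show ?thesis
    unfolding tail_dominated_def
  proof (intro conjI allI impI)
    fix y :: real assume y: "0 < y" "y < 1"
    have "ennreal \<bar>u 0 y\<bar> \<le> ennreal (real k * B) + (\<integral>\<^sup>+t. ennreal (t ^ (k - 1) * G t) * indicator {y<..<1} t \<partial>lborel)"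
      using step[of "k - 1" y] y k by simp
    also have "(\<integral>\<^sup>+t. ennreal (t ^ (k - 1) * G t) * indicator {y<..<1} t \<partial>lborel) =
      (\<integral>\<^sup>+t. ennreal (t ^ (k - 1) * G t * indicator {0<..<1} t) * indicator {y<..<1} t \<partial>lborel)"
      using y by (intro nn_integral_cong) (auto simp: indicator_def)
    finally show "ennreal \<bar>u 0 y\<bar> \<le> ennreal (real k * B) + \<dots>" .
  qed (use B G in \<open>auto simp: indicator_def\<close>)
qed

section \<open>Interior estimates of derivatives\<close>

lemma Lp_norm_le:
  assumes "p \<noteq> \<infinity>" "0 < enn2real p" "0 \<le> K"
    and le: "integral11 (\<lambda>x. \<bar>g x\<bar> powr enn2real p) \<le> ennreal (K powr enn2real p)"
  shows "Lp_norm p g \<le> ennreal K"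
proof -
  define I where "I = integral11 (\<lambda>x. \<bar>g x\<bar> powr enn2real p)"
  have I: "I \<noteq> \<infinity>" using le unfolding I_def[symmetric] by (auto simp: top_unique)
  have "enn2real I \<le> K powr enn2real p"
    using le enn2real_leI unfolding I_def[symmetric] by simp
  then have "enn2real I powr (1 / enn2real p) \<le> (K powr enn2real p) powr (1 / enn2real p)"
    using assms by (intro powr_mono2) auto
  also have "\<dots> = K" using assms by (simp only: powr_powr) simp
  finally show ?thesis
    using I assms unfolding Lp_norm_def nn_integral_completion I_def[symmetric] Let_def
    by (simp add: ennreal_leI)
qed

lemma Lp_norm_finite:
  assumes "p \<noteq> \<infinity>" "0 < enn2real p" "Lp_norm p g \<noteq> \<infinity>"
  shows "integral11 (\<lambda>x. \<bar>g x\<bar> powr enn2real p) = ennreal (enn2real (Lp_norm p g) powr enn2real p)"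
proof -
  define I where "I = integral11 (\<lambda>x. \<bar>g x\<bar> powr enn2real p)"
  have I: "I \<noteq> \<infinity>" and eq: "Lp_norm p g = ennreal (enn2real I powr (1 / enn2real p))"
    using assms unfolding Lp_norm_def nn_integral_completion I_def[symmetric] Let_def
    by (auto split: if_splits)
  have "enn2real (Lp_norm p g) powr enn2real p = enn2real I"
    unfolding eq using assms by (simp add: powr_powr)
  then show ?thesis unfolding I_def[symmetric] using I by (simp add: less_top)
qed

lemma Lp_norm_ge:
  assumes "p \<noteq> \<infinity>" "0 < enn2real p" "0 \<le> K"
    and ge: "ennreal (K powr enn2real p) \<le> integral11 (\<lambda>x. \<bar>g x\<bar> powr enn2real p)"
  shows "ennreal K \<le> Lp_norm p g"
proof (cases "Lp_norm p g = \<infinity>")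
  case False
  have "K powr enn2real p \<le> enn2real (Lp_norm p g) powr enn2real p"
    using ge unfolding Lp_norm_finite[OF assms(1,2) False] by (simp add: ennreal_le_iff)
  then have "K \<le> enn2real (Lp_norm p g)"
    using assms by (meson enn2real_nonneg not_le powr_less_mono2)
  then show ?thesis using False by (metis ennreal_enn2real ennreal_leI less_top infinity_ennreal_def)
qed simp

lemma Lp_norm_infinity_le:
  assumes "\<And>x. -1 < x \<Longrightarrow> x < 1 \<Longrightarrow> \<bar>g x\<bar> \<le> K"
  shows "Lp_norm \<infinity> g \<le> ennreal K"
  unfolding Lp_norm_def using assms by (auto intro!: SUP_least ennreal_leI)

lemma finite_exponent:
  fixes p :: ennreal
  assumes "1 \<le> p" "p \<noteq> \<infinity>"
  shows "1 \<le> enn2real p" "exponent_recip p = 1 / enn2real p" "p = ennreal (enn2real p)"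
proof -
  show "1 \<le> enn2real p" using assms by (cases p) (auto simp: ennreal_ge_1)
  show "exponent_recip p = 1 / enn2real p" using assms unfolding exponent_recip_def by simp
  show "p = ennreal (enn2real p)" using assms by (cases p) auto
qed

section \<open>Small values of successive derivatives\<close>

text \<open>The points are grouped in consecutive disjoint pairs. The mean value theorem gives one
  point per pair where the derivative is small, at the cost of a factor \<open>2 / \<delta>\<close>.
  Each round halves the number of points, so \<open>2 ^ n\<close> of them last for \<open>n\<close>
  rounds.\<close>

lemma small_derivative_point:
  fixes F :: "nat \<Rightarrow> real \<Rightarrow> real"
  assumes "0 < \<delta>"
    and "\<And>i x. i < n \<Longrightarrow> x \<in> {\<alpha>..\<beta>} \<Longrightarrow> (F i has_real_derivative F (Suc i) x) (at x)"
    and "\<And>j. Suc j < 2 ^ n \<Longrightarrow> \<delta> \<le> t (Suc j) - t j"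
    and "\<And>j. j < 2 ^ n \<Longrightarrow> t j \<in> {\<alpha>..\<beta>}" "\<And>j. j < 2 ^ n \<Longrightarrow> \<bar>F 0 (t j)\<bar> \<le> M"
  shows "\<exists>\<xi>\<in>{\<alpha>..\<beta>}. \<bar>F n \<xi>\<bar> \<le> (2 / \<delta>) ^ n * M"
  using assms(2-)
proof (induction n arbitrary: F t M)
  case 0
  then show ?case by (intro bexI[of _ "t 0"]) auto
next
  case (Suc n)
  have "\<exists>z. t (2 * j) < z \<and> z < t (2 * j + 1) \<and> \<bar>F 1 z\<bar> \<le> 2 / \<delta> * M" if j: "j < 2 ^ n" for j
  proof -
    have lt: "2 * j < 2 ^ Suc n" "2 * j + 1 < 2 ^ Suc n" using j by auto
    have d: "\<delta> \<le> t (2 * j + 1) - t (2 * j)" using Suc.prems(2)[of "2 * j"] lt by simp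
    have "\<exists>z>t (2 * j). z < t (2 * j + 1) \<and> F 0 (t (2 * j + 1)) - F 0 (t (2 * j)) = (t (2 * j + 1) - t (2 * j)) * F 1 z"
    proof (rule MVT2)
      show "t (2 * j) < t (2 * j + 1)" using d assms(1) by linarith
      fix x assume "t (2 * j) \<le> x" "x \<le> t (2 * j + 1)"
      then show "(F 0 has_real_derivative F 1 x) (at x)"
        using Suc.prems(1)[of 0 x] Suc.prems(3)[OF lt(1)] Suc.prems(3)[OF lt(2)] by auto
    qed
    then obtain z where z: "t (2 * j) < z" "z < t (2 * j + 1)"
      "F 0 (t (2 * j + 1)) - F 0 (t (2 * j)) = (t (2 * j + 1) - t (2 * j)) * F 1 z" by blast
    have "\<delta> * \<bar>F 1 z\<bar> \<le> (t (2 * j + 1) - t (2 * j)) * \<bar>F 1 z\<bar>" using d by (intro mult_right_mono) auto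
    also have "\<dots> = \<bar>F 0 (t (2 * j + 1)) - F 0 (t (2 * j))\<bar>" unfolding z(3) abs_mult using d assms(1) by simp
    also have "\<dots> \<le> 2 * M" using Suc.prems(4)[OF lt(1)] Suc.prems(4)[OF lt(2)] by linarith
    finally have "\<bar>F 1 z\<bar> \<le> 2 / \<delta> * M" using assms(1) by (simp add: pos_le_divide_eq mult.commute)
    then show ?thesis using z by blast
  qed
  then obtain s where s: "\<And>j. j < 2 ^ n \<Longrightarrow> t (2 * j) < s j \<and> s j < t (2 * j + 1) \<and> \<bar>F 1 (s j)\<bar> \<le> 2 / \<delta> * M"
    by metis
  have "\<exists>\<xi>\<in>{\<alpha>..\<beta>}. \<bar>F (Suc n) \<xi>\<bar> \<le> (2 / \<delta>) ^ n * (2 / \<delta> * M)"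
  proof (rule Suc.IH[of "\<lambda>i. F (Suc i)" s "2 / \<delta> * M"])
    show "(F (Suc i) has_real_derivative F (Suc (Suc i)) x) (at x)" if "i < n" "x \<in> {\<alpha>..\<beta>}" for i x
      using Suc.prems(1)[of "Suc i" x] that by simp
    show "\<delta> \<le> s (Suc j) - s j" if "Suc j < 2 ^ n" for j
    proof -
      \<comment> \<open>New points come from different pairs, so the gap between neighbouring pairs
        keeps them \<open>\<delta>\<close> apart.\<close>
      have "\<delta> \<le> t (Suc (2 * j + 1)) - t (2 * j + 1)" using Suc.prems(2)[of "2 * j + 1"] that by simp
      moreover have "s j < t (2 * j + 1)" "t (2 * Suc j) < s (Suc j)" using s[of j] s[of "Suc j"] that by auto
      ultimately show ?thesis by simp
    qed
    show "s j \<in> {\<alpha>..\<beta>}" if "j < 2 ^ n" for j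
      using s[OF that] Suc.prems(3)[of "2 * j"] Suc.prems(3)[of "2 * j + 1"] that by auto
    show "\<bar>F (Suc 0) (s j)\<bar> \<le> 2 / \<delta> * M" if "j < 2 ^ n" for j using s[OF that] by simp
  qed
  then show ?case by (simp add: mult_ac)
qed

text \<open>Every order has a point where its derivative is small. The highest order stays within
  \<open>K\<close> of that value; each lower order stays near its own small value because its
  derivative is already bounded. All constants are geometric and do not involve
  \<open>F\<close>.\<close>

lemma interior_derivative_bound:
  fixes F :: "nat \<Rightarrow> real \<Rightarrow> real"
  assumes m: "0 < m" and M: "0 \<le> M" and K: "0 \<le> K"
    and der: "\<And>i x. i < m - 1 \<Longrightarrow> x \<in> {-(1/2)..1/2} \<Longrightarrow> (F i has_real_derivative F (Suc i) x) (at x)"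
    and osc: "\<And>x y. x \<in> {-(1/2)..1/2} \<Longrightarrow> y \<in> {-(1/2)..1/2} \<Longrightarrow> \<bar>F (m - 1) y - F (m - 1) x\<bar> \<le> K"
    and small: "\<And>l. -(1/2) \<le> l \<Longrightarrow> l + 1 / 2 ^ Suc m \<le> 1/2 \<Longrightarrow> \<exists>t\<in>{l..l + 1 / 2 ^ Suc m}. \<bar>F 0 t\<bar> \<le> M"
    and i: "i < m" and x: "x \<in> {-(1/2)..1/2}"
  shows "\<bar>F i x\<bar> \<le> real m * (2 * 2 ^ Suc m) ^ m * (M + K)"
proof -
  \<comment> \<open>The interval of length 1 splits into \<open>2 ^ m\<close> cells of length
    \<open>2 * \<delta>\<close>. A small value is taken in the left half of each cell, so the chosen
    points are at least \<open>\<delta>\<close> apart.\<close>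
  define \<delta> :: real where "\<delta> = 1 / 2 ^ Suc m"
  define A :: real where "A = (2 * 2 ^ Suc m) ^ m"
  have \<delta>: "\<delta> > 0" "2 / \<delta> = 2 * 2 ^ Suc m" "2 * \<delta> * 2 ^ m = 1" unfolding \<delta>_def by auto
  have one: "(1::real) \<le> 2 * 2 ^ Suc m" using one_le_power[of "2::real" "Suc m"] by linarith
  have A1: "1 \<le> A" unfolding A_def by (intro one_le_power one)
  define l where "l j = -(1/2) + 2 * real j * \<delta>" for j :: nat
  have l: "-(1/2) \<le> l j" "l j + \<delta> \<le> 1/2" if "j < 2 ^ m" for j
  proof -
    show "-(1/2) \<le> l j" unfolding l_def using \<delta> by simp
    have "real j + 1 \<le> 2 ^ m" using that by (metis Suc_leI of_nat_Suc of_nat_le_iff of_nat_numeral of_nat_power add.commute)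
    then have "2 * \<delta> * (real j + 1) \<le> 2 * \<delta> * 2 ^ m" using \<delta> by (intro mult_left_mono) auto
    then show "l j + \<delta> \<le> 1/2" using \<delta> unfolding l_def by (simp add: algebra_simps)
  qed
  have "\<exists>t. t \<in> {l j..l j + \<delta>} \<and> \<bar>F 0 t\<bar> \<le> M" if "j < 2 ^ m" for j
    using small[of "l j"] l[OF that] unfolding \<delta>_def by blast
  then obtain t where t: "\<And>j. j < 2 ^ m \<Longrightarrow> t j \<in> {l j..l j + \<delta>} \<and> \<bar>F 0 (t j)\<bar> \<le> M" by metis
  have pt: "\<exists>\<xi>\<in>{-(1/2)..1/2}. \<bar>F i \<xi>\<bar> \<le> A * M" if i: "i < m" for i
  proof -
    have pow: "(2::nat) ^ i \<le> 2 ^ m" using i by (intro power_increasing) auto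
    have "\<exists>\<xi>\<in>{-(1/2)..1/2}. \<bar>F i \<xi>\<bar> \<le> (2 / \<delta>) ^ i * M"
    proof (rule small_derivative_point[OF \<delta>(1)])
      show "(F j has_real_derivative F (Suc j) x) (at x)" if "j < i" "x \<in> {-(1/2)..1/2}" for j x
        using der that i by simp
      show "\<delta> \<le> t (Suc j) - t j" if "Suc j < 2 ^ i" for j
        using t[of j] t[of "Suc j"] that pow unfolding l_def by (auto simp: algebra_simps)
      show "t j \<in> {-(1/2)..1/2}" if "j < 2 ^ i" for j
        using t[of j] l[of j] that pow by auto
      show "\<bar>F 0 (t j)\<bar> \<le> M" if "j < 2 ^ i" for j using t[of j] that pow by simp
    qed
    moreover have "(2 / \<delta>) ^ i * M \<le> A * M"
      unfolding A_def \<delta>(2) using one i M by (intro mult_right_mono power_increasing) auto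
    ultimately show ?thesis by force
  qed
  \<comment> \<open>Descending induction on the order. Since the interval has length 1, each descent
    adds at most one multiple of \<open>A * (M + K)\<close>.\<close>
  have down: "\<bar>F (m - 1 - j) x\<bar> \<le> real (Suc j) * (A * (M + K))" if "j \<le> m - 1" "x \<in> {-(1/2)..1/2}" for j x
    using that
  proof (induction j arbitrary: x)
    case 0
    obtain \<xi> where \<xi>: "\<xi> \<in> {-(1/2)..1/2}" "\<bar>F (m - 1) \<xi>\<bar> \<le> A * M" using pt[of "m - 1"] m by auto
    have "\<bar>F (m - 1) x\<bar> \<le> A * M + K" using osc[OF \<xi>(1) 0(2)] \<xi>(2) by linarith
    also have "K \<le> A * K" using mult_right_mono[OF A1 K] by simp
    finally show ?case by (simp add: algebra_simps)
  next
    case (Suc j)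
    define i where "i = m - 1 - Suc j"
    have i: "i < m - 1" "Suc i = m - 1 - j" using Suc.prems unfolding i_def by auto
    obtain \<xi> where \<xi>: "\<xi> \<in> {-(1/2)..1/2}" "\<bar>F i \<xi>\<bar> \<le> A * M"
      using pt[OF less_le_trans[OF i(1) diff_le_self]] by blast
    have "norm (F i x - F i \<xi>) \<le> (real (Suc j) * (A * (M + K))) * norm (x - \<xi>)"
    proof (rule field_differentiable_bound[of "{-(1/2)..1/2}" "F i" "F (Suc i)"])
      show "(F i has_field_derivative F (Suc i) z) (at z within {-(1/2)..1/2})" if "z \<in> {-(1/2)..1/2}" for z
        using der[OF i(1) that] has_field_derivative_at_within by blast
      show "norm (F (Suc i) z) \<le> real (Suc j) * (A * (M + K))" if "z \<in> {-(1/2)..1/2}" for z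
        using Suc.IH[of z] Suc.prems that unfolding i(2) by simp
    qed (use \<xi> Suc.prems in auto)
    also have "\<dots> \<le> (real (Suc j) * (A * (M + K))) * 1"
      using \<xi>(1) Suc.prems(2) A1 M K by (intro mult_left_mono) auto
    finally have "\<bar>F i x\<bar> \<le> A * M + real (Suc j) * (A * (M + K))" using \<xi>(2) by simp
    also have "A * M \<le> A * (M + K)" using A1 K by (intro mult_left_mono) auto
    finally show ?case unfolding i_def by (simp add: algebra_simps)
  qed
  have "\<bar>F i x\<bar> \<le> real (Suc (m - 1 - i)) * (A * (M + K))"
    using down[of "m - 1 - i" x] i x by simp
  also have "\<dots> \<le> real m * (A * (M + K))"
    using A1 M K i by (intro mult_right_mono) auto
  finally show ?thesis unfolding A_def by (simp add: mult.assoc)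
qed

text \<open>The minimum point of \<open>\<bar>f\<bar>\<close> on the interval works: the integral is
  at least \<open>\<delta>\<close> times the \<open>P\<close>-th power of that minimum times
  \<open>w0\<close>.\<close>

lemma exists_small_value:
  fixes f w :: "real \<Rightarrow> real"
  assumes P: "0 < P" and \<delta>: "0 < \<delta>" and lr: "-1 \<le> l" "l + \<delta> \<le> 1"
    and cont: "continuous_on {l..l + \<delta>} f"
    and w0: "0 < w0" "\<And>x. x \<in> {l..l + \<delta>} \<Longrightarrow> w0 \<le> w x"
    and N: "0 \<le> N" "integral11 (\<lambda>x. \<bar>f x * w x\<bar> powr P) \<le> ennreal (N powr P)"
  shows "\<exists>t\<in>{l..l + \<delta>}. \<bar>f t\<bar> \<le> N * (1 / \<delta>) powr (1 / P) / w0"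
proof -
  have "\<exists>t\<in>{l..l + \<delta>}. \<forall>x\<in>{l..l + \<delta>}. \<bar>f t\<bar> \<le> \<bar>f x\<bar>"
    using \<delta> by (intro continuous_attains_inf continuous_on_rabs cont) auto
  then obtain t where t: "t \<in> {l..l + \<delta>}" "\<And>x. x \<in> {l..l + \<delta>} \<Longrightarrow> \<bar>f t\<bar> \<le> \<bar>f x\<bar>" by blast
  have "ennreal ((\<bar>f t\<bar> * w0) powr P) * ennreal \<delta> = (\<integral>\<^sup>+x. ennreal ((\<bar>f t\<bar> * w0) powr P) * indicator {l..l + \<delta>} x \<partial>lborel)"
    using \<delta> by (subst nn_integral_cmult_indicator) auto
  also have "\<dots> \<le> integral11 (\<lambda>x. \<bar>f x * w x\<bar> powr P)"
  proof (rule nn_integral_mono)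
    fix x :: real
    show "ennreal ((\<bar>f t\<bar> * w0) powr P) * indicator {l..l + \<delta>} x \<le> ennreal (\<bar>f x * w x\<bar> powr P) * indicator {-1..1} x"
    proof (cases "x \<in> {l..l + \<delta>}")
      case True
      have "\<bar>f t\<bar> * w0 \<le> \<bar>f x\<bar> * \<bar>w x\<bar>"
        using t(2)[OF True] w0(2)[OF True] w0(1) by (intro mult_mono) auto
      then have "(\<bar>f t\<bar> * w0) powr P \<le> \<bar>f x * w x\<bar> powr P"
        unfolding abs_mult using P w0 by (intro powr_mono2) auto
      then show ?thesis using True lr by (auto simp: indicator_def intro: ennreal_leI)
    qed simp
  qed
  also have "\<dots> \<le> ennreal (N powr P)" by (rule N)
  finally have "(\<bar>f t\<bar> * w0) powr P * \<delta> \<le> N powr P"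
    using \<delta> by (simp add: ennreal_mult[symmetric] ennreal_le_iff)
  then have "(\<bar>f t\<bar> * w0) powr P \<le> N powr P * (1 / \<delta>)" using \<delta> by (simp add: field_simps)
  also have "\<dots> = (N * (1 / \<delta>) powr (1 / P)) powr P"
  proof -
    have "((1 / \<delta>) powr (1 / P)) powr P = 1 / \<delta>" using \<delta> P by (simp only: powr_powr) simp
    then show ?thesis using N \<delta> by (subst powr_mult) auto
  qed
  finally have "\<bar>f t\<bar> * w0 \<le> N * (1 / \<delta>) powr (1 / P)"
    using P N w0 by (smt (verit) abs_ge_zero mult_nonneg_nonneg powr_ge_zero powr_less_mono2)
  then show ?thesis using t(1) w0(1) by (intro bexI[of _ t]) (simp add: pos_le_divide_eq)
qed

section \<open>Sharpness\<close>

text \<open>On each side of the origin only one factor can be singular, the other lying in a power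
  of \<open>{1..2}\<close>; the sum with the common constant \<open>c\<close> covers both
  sides.\<close>

lemma nn_integral_Jacobi_finite:
  fixes A B :: real
  assumes A: "-1 < A" and B: "-1 < B"
  shows "integral11 (\<lambda>x. (1 - x) powr A * (1 + x) powr B) < \<infinity>"
proof -
  have fin: "(\<integral>\<^sup>+t. ennreal (t powr E) * indicator {0..2} t \<partial>lborel) < \<infinity>" if "-1 < E" for E
  proof -
    have "(\<integral>\<^sup>+t. ennreal (t powr E) * indicator {0..2} t \<partial>lborel) = (\<integral>\<^sup>+t. ennreal (indicator {0..2} t * t powr E) \<partial>lborel)"
      by (intro nn_integral_cong) (auto simp: indicator_def)
    also have "\<dots> = ennreal (2 powr (E + 1) / (E + 1))"
      by (rule nn_integral_has_integral_lebesgue[OF _ has_integral_powr_from_0[OF that]]) auto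
    finally show ?thesis by simp
  qed
  have minus: "(\<integral>\<^sup>+x. ennreal ((1 - x) powr A) * indicator {-1..1} x \<partial>lborel) = (\<integral>\<^sup>+t. ennreal (t powr A) * indicator {0..2} t \<partial>lborel)"
    by (subst nn_integral_real_affine[of "\<lambda>t. ennreal (t powr A) * indicator {0..2} t" "-1" 1])
      (auto intro!: nn_integral_cong simp: indicator_def)
  have plus: "(\<integral>\<^sup>+x. ennreal ((1 + x) powr B) * indicator {-1..1} x \<partial>lborel) = (\<integral>\<^sup>+t. ennreal (t powr B) * indicator {0..2} t \<partial>lborel)"
    by (subst nn_integral_real_affine[of "\<lambda>t. ennreal (t powr B) * indicator {0..2} t" "1" 1])
      (auto intro!: nn_integral_cong simp: indicator_def)
  define c :: real where "c = 2 powr \<bar>A\<bar> + 2 powr \<bar>B\<bar>"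
  have c: "0 \<le> c" "2 powr \<bar>A\<bar> \<le> c" "2 powr \<bar>B\<bar> \<le> c" unfolding c_def by auto
  have bd: "z powr E \<le> 2 powr \<bar>E\<bar>" if "1 \<le> z" "z \<le> 2" for z E :: real
  proof -
    have "z powr E \<le> z powr \<bar>E\<bar>" using that by (intro powr_mono) auto
    also have "\<dots> \<le> 2 powr \<bar>E\<bar>" using that by (intro powr_mono2) auto
    finally show ?thesis .
  qed
  have "integral11 (\<lambda>x. (1 - x) powr A * (1 + x) powr B) \<le>
    (\<integral>\<^sup>+x. ennreal c * (ennreal ((1 - x) powr A) * indicator {-1..1} x) + ennreal c * (ennreal ((1 + x) powr B) * indicator {-1..1} x) \<partial>lborel)"
  proof (rule nn_integral_mono)
    fix x :: real
    have "(1 - x) powr A * (1 + x) powr B \<le> c * (1 - x) powr A + c * (1 + x) powr B" if x: "-1 \<le> x" "x \<le> 1"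
    proof (cases "0 \<le> x")
      case True
      have "(1 - x) powr A * (1 + x) powr B \<le> (1 - x) powr A * c"
        using True x c(3) bd[of "1 + x" B] by (intro mult_left_mono) auto
      then show ?thesis using c(1) by (simp add: mult.commute add_increasing2)
    next
      case False
      have "(1 - x) powr A * (1 + x) powr B \<le> c * (1 + x) powr B"
        using False x c(2) bd[of "1 - x" A] by (intro mult_right_mono) auto
      then show ?thesis using c(1) by (simp add: add_increasing)
    qed
    then show "ennreal ((1 - x) powr A * (1 + x) powr B) * indicator {-1..1} x \<le>
      ennreal c * (ennreal ((1 - x) powr A) * indicator {-1..1} x) + ennreal c * (ennreal ((1 + x) powr B) * indicator {-1..1} x)"
      using c(1) by (auto simp: indicator_def ennreal_mult[symmetric] ennreal_plus[symmetric] simp del: ennreal_plus intro!: ennreal_leI)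
  qed
  also have "\<dots> = ennreal c * (\<integral>\<^sup>+t. ennreal (t powr A) * indicator {0..2} t \<partial>lborel) + ennreal c * (\<integral>\<^sup>+t. ennreal (t powr B) * indicator {0..2} t \<partial>lborel)"
    unfolding minus[symmetric] plus[symmetric] by (subst nn_integral_add) (simp_all add: nn_integral_cmult)
  also have "\<dots> < \<infinity>" using fin[OF A] fin[OF B] by (simp add: ennreal_mult_less_top)
  finally show ?thesis .
qed

section \<open>Weights seen from one end point\<close>

text \<open>With \<open>s\<close> equal to 1 or -1, \<open>1 - s * x\<close> is the distance to the
  end point \<open>s\<close>. The exponent \<open>A\<close> always belongs to that end point, so
  reflections become a change of \<open>s\<close>.\<close>

definition sided_weight :: "real \<Rightarrow> real \<Rightarrow> real \<Rightarrow> real \<Rightarrow> real" where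
  "sided_weight s A B x = (1 - s * x) powr A * (1 + s * x) powr B"

lemma sided_weight_1: "sided_weight 1 A B = jacobi_weight A B"
  unfolding sided_weight_def jacobi_weight_def by auto

lemma sided_weight_minus_1: "sided_weight (-1) A B = jacobi_weight B A"
  unfolding sided_weight_def jacobi_weight_def by (auto simp: mult.commute)

text \<open>\<open>K\<close> is the norm of the weight itself, finite because both exponents exceed
  \<open>- 1 / p\<close>. It is fixed before \<open>g\<close> and \<open>\<kappa>\<close>, which
  yields bounds uniform along a sequence.\<close>

lemma Lp_norm_le_weight:
  fixes p :: ennreal and s A B :: real
  assumes p: "1 \<le> p" "p \<noteq> \<infinity>" and s: "s = 1 \<or> s = -1"
    and A: "- exponent_recip p < A" and B: "- exponent_recip p < B"
  obtains K where "0 \<le> K" "\<And>g \<kappa>. 0 \<le> \<kappa> \<Longrightarrow> (\<And>x. -1 \<le> x \<Longrightarrow> x \<le> 1 \<Longrightarrow> \<bar>g x\<bar> \<le> \<kappa> * sided_weight s A B x) \<Longrightarrow>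
    Lp_norm p g \<le> ennreal (\<kappa> * K)"
proof -
  define P where "P = enn2real p"
  have P: "1 \<le> P" "exponent_recip p = 1 / P" using finite_exponent[OF p] unfolding P_def by auto
  have AP: "-1 < A * P" "-1 < B * P"
  proof -
    have "- (1 / P) * P < A * P" "- (1 / P) * P < B * P"
      using A B P by (intro mult_strict_right_mono; simp)+
    then show "-1 < A * P" "-1 < B * P" using P by auto
  qed
  define J where "J = integral11 (\<lambda>x. sided_weight s A B x powr P)"
  have pw: "sided_weight s A B x powr P = (1 - s * x) powr (A * P) * (1 + s * x) powr (B * P)" if "-1 \<le> x" "x \<le> 1" for x
    using that s unfolding sided_weight_def by (auto simp: powr_mult powr_powr)
  have "J = integral11 (\<lambda>x. (1 - s * x) powr (A * P) * (1 + s * x) powr (B * P))"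
    unfolding J_def using pw by (intro nn_integral_cong) (auto simp: indicator_def)
  also have "\<dots> < \<infinity>"
    using s nn_integral_Jacobi_finite[OF AP] nn_integral_Jacobi_finite[OF AP(2,1)] by (auto simp: mult.commute)
  finally obtain j where j: "J = ennreal j" "0 \<le> j" by (cases J) auto
  show ?thesis
  proof (rule that[of "j powr (1 / P)"])
    fix g and \<kappa> :: real assume \<kappa>: "0 \<le> \<kappa>" and g: "\<And>x. -1 \<le> x \<Longrightarrow> x \<le> 1 \<Longrightarrow> \<bar>g x\<bar> \<le> \<kappa> * sided_weight s A B x"
    show "Lp_norm p g \<le> ennreal (\<kappa> * j powr (1 / P))"
    proof (rule Lp_norm_le[OF p(2)], unfold P_def[symmetric])
      have [measurable]: "sided_weight s A B \<in> borel_measurable borel" unfolding sided_weight_def by measurable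
      have "integral11 (\<lambda>x. \<bar>g x\<bar> powr P) \<le>
        (\<integral>\<^sup>+x. ennreal (\<kappa> powr P) * (ennreal (sided_weight s A B x powr P) * indicator {-1..1} x) \<partial>lborel)"
      proof (rule nn_integral_mono)
        fix x :: real
        have "\<bar>g x\<bar> powr P \<le> \<kappa> powr P * sided_weight s A B x powr P" if "-1 \<le> x" "x \<le> 1"
        proof -
          have "\<bar>g x\<bar> powr P \<le> (\<kappa> * sided_weight s A B x) powr P"
            using g[OF that] P by (intro powr_mono2) auto
          also have "\<dots> = \<kappa> powr P * sided_weight s A B x powr P"
            using \<kappa> by (subst powr_mult) (auto simp: sided_weight_def)
          finally show ?thesis .
        qed
        then show "ennreal (\<bar>g x\<bar> powr P) * indicator {-1..1} x \<le> ennreal (\<kappa> powr P) * (ennreal (sided_weight s A B x powr P) * indicator {-1..1} x)"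
          by (auto simp: indicator_def ennreal_mult[symmetric] intro!: ennreal_leI)
      qed
      also have "\<dots> = ennreal (\<kappa> powr P) * J"
        unfolding J_def by (rule nn_integral_cmult) measurable
      also have "\<dots> = ennreal (\<kappa> powr P * j)" unfolding j(1) using j(2) by (simp add: ennreal_mult)
      also have "\<kappa> powr P * j = (\<kappa> * j powr (1 / P)) powr P"
      proof -
        have "(j powr (1 / P)) powr P = j" using P j(2) by (cases "j = 0") (simp_all add: powr_powr)
        then show ?thesis using \<kappa> by (subst powr_mult) auto
      qed
      finally show "integral11 (\<lambda>x. \<bar>g x\<bar> powr P) \<le> ennreal ((\<kappa> * j powr (1 / P)) powr P)" .
    qed (use P \<kappa> in auto)
  qed simp
qed

section \<open>Shifted powers as test functions\<close>

lemma deriv_shifted_powr: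
  fixes s \<delta> \<sigma> :: real
  assumes "0 < 1 - s * x + \<delta>"
  shows "((\<lambda>x. (- s) ^ j * (\<Prod>i<j. \<sigma> - real i) * (1 - s * x + \<delta>) powr (\<sigma> - real j)) has_real_derivative
     (- s) ^ Suc j * (\<Prod>i<Suc j. \<sigma> - real i) * (1 - s * x + \<delta>) powr (\<sigma> - real (Suc j))) (at x)"
proof -
  have "((\<lambda>x. (1 - s * x + \<delta>) powr (\<sigma> - real j)) has_real_derivative
     (\<sigma> - real j) * (1 - s * x + \<delta>) powr (\<sigma> - real j - 1) * (- s)) (at x)"
    using assms by (auto intro!: derivative_eq_intros)
  from DERIV_cmult[OF this, of "(- s) ^ j * (\<Prod>i<j. \<sigma> - real i)"]
  show ?thesis by (simp add: algebra_simps)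
qed

lemma funpow_deriv_shifted_powr:
  fixes s \<delta> \<sigma> :: real
  assumes "0 < 1 - s * x + \<delta>"
  shows "(deriv ^^ j) (\<lambda>x. (1 - s * x + \<delta>) powr \<sigma>) x =
    (- s) ^ j * (\<Prod>i<j. \<sigma> - real i) * (1 - s * x + \<delta>) powr (\<sigma> - real j)"
  using assms
proof (induction j arbitrary: x)
  case (Suc j)
  have op: "open {x. 0 < 1 - s * x + \<delta>}" by (intro open_Collect_less continuous_intros)
  have "((deriv ^^ j) (\<lambda>x. (1 - s * x + \<delta>) powr \<sigma>) has_field_derivative
      (- s) ^ Suc j * (\<Prod>i<Suc j. \<sigma> - real i) * (1 - s * x + \<delta>) powr (\<sigma> - real (Suc j))) (at x)"
    by (rule has_field_derivative_transform_within_open[OF deriv_shifted_powr[OF Suc.prems, of j \<sigma>] op])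
      (use Suc in auto)
  from DERIV_imp_deriv[OF this] show ?case by simp
qed simp

lemma Cm_on_shifted_powr:
  fixes s \<delta> \<sigma> :: real
  assumes "\<bar>s\<bar> \<le> 1" "0 < \<delta>"
  shows "Cm_on m {-1..1} (\<lambda>x. (1 - s * x + \<delta>) powr \<sigma>)"
proof -
  have pos: "0 < 1 - s * x + \<delta>" if "x \<in> {-1..1}" for x
  proof -
    have "\<bar>s * x\<bar> \<le> 1 * 1" unfolding abs_mult using that assms by (intro mult_mono) auto
    then show ?thesis using assms by linarith
  qed
  define F where "F i x = (- s) ^ i * (\<Prod>l<i. \<sigma> - real l) * (1 - s * x + \<delta>) powr (\<sigma> - real i)" for i x
  have der: "(F i has_real_derivative F (Suc i) x) (at x within {-1..1})" if "x \<in> {-1..1}" for i x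
    using has_field_derivative_at_within[OF deriv_shifted_powr[OF pos[OF that], of i \<sigma>]] unfolding F_def by blast
  then have "continuous_on {-1..1} (F m)" by (intro DERIV_continuous_on)
  then show ?thesis unfolding Cm_on_def using der by (intro exI[of _ F]) (auto simp: F_def)
qed

text \<open>The bound is uniform in \<open>\<delta>\<close>. For nonnegative \<open>\<tau>\<close>
  the base is at most 3; for negative \<open>\<tau>\<close> the shift only lowers the power. At
  \<open>y = 0\<close> both sides vanish, since \<open>0 powr e = 0\<close>.\<close>

lemma shifted_powr_le:
  fixes y \<delta> \<tau> e :: real
  assumes "0 \<le> y" "y \<le> 2" "0 < \<delta>" "\<delta> \<le> 1"
  shows "(y + \<delta>) powr \<tau> * y powr e \<le> 3 powr \<bar>\<tau>\<bar> * y powr (e + min \<tau> 0)"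
proof (cases "y = 0")
  case False
  then have y: "0 < y" using assms by simp
  have one: "1 \<le> (3::real) powr \<bar>\<tau>\<bar>" by (simp add: ge_one_powr_ge_zero)
  show ?thesis
  proof (cases "0 \<le> \<tau>")
    case True
    have "(y + \<delta>) powr \<tau> \<le> 3 powr \<bar>\<tau>\<bar>" using True assms y by (auto intro!: powr_mono2)
    then show ?thesis using True by (auto intro: mult_right_mono)
  next
    case False
    have "(y + \<delta>) powr \<tau> \<le> y powr \<tau>" using False assms y by (intro powr_mono2') auto
    then have "(y + \<delta>) powr \<tau> * y powr e \<le> y powr \<tau> * y powr e" by (intro mult_right_mono) auto
    also have "\<dots> = 1 * y powr (e + min \<tau> 0)" using False by (simp add: powr_add[symmetric] add.commute)
    also have "\<dots> \<le> 3 powr \<bar>\<tau>\<bar> * y powr (e + min \<tau> 0)" using one by (intro mult_right_mono) auto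
    finally show ?thesis .
  qed
qed simp

text \<open>Only countably many shifts hit a natural number. Keeping away from these ensures that no
  derivative of the power function vanishes identically.\<close>

lemma exists_noninteger_shift:
  fixes m w :: real
  assumes "0 < m"
  obtains \<eta> where "0 < \<eta>" "\<eta> < m" "\<And>i::nat. w - \<eta> \<noteq> real i"
proof -
  have "countable ((\<lambda>i. w - real i) ` (UNIV :: nat set))" by simp
  moreover have "uncountable {0<..<m}" using assms by (simp add: uncountable_open_interval)
  ultimately have "\<not> {0<..<m} \<subseteq> (\<lambda>i. w - real i) ` (UNIV :: nat set)"
    using countable_subset by blast
  then obtain \<eta> where \<eta>: "\<eta> \<in> {0<..<m}" "\<eta> \<notin> (\<lambda>i. w - real i) ` (UNIV :: nat set)" by blast
  have "w - \<eta> \<noteq> real i" for i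
  proof
    assume "w - \<eta> = real i"
    then have "\<eta> = w - real i" by simp
    then show False using \<eta>(2) by blast
  qed
  then show ?thesis using that \<eta>(1) by auto
qed

text \<open>Only the layer \<open>\<delta> / 2 \<le> 1 - s * x \<le> \<delta>\<close> is used. There
  \<open>1 - s * x\<close> and its shift are both comparable to \<open>\<delta>\<close>, and
  \<open>1 + s * x\<close> lies in \<open>{1..2}\<close>, so the integrand is at least a constant
  times \<open>\<delta> powr (- 1 / q - \<eta>)\<close> before taking powers. The length
  \<open>\<delta> / 2\<close> of the layer returns \<open>\<delta> powr (1 / q)\<close>; for
  infinite \<open>q\<close> one point of the layer is enough.\<close>

lemma shifted_powr_norm_lower:
  fixes q :: ennreal and s a b \<sigma> \<eta> :: real
  assumes q: "1 \<le> q" and s: "s = 1 \<or> s = -1" and ff: "(\<Prod>i<r. \<sigma> - real i) \<noteq> 0"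
    and \<sigma>: "\<sigma> - real r + a = - exponent_recip q - \<eta>" "\<sigma> - real r < 0"
  obtains \<kappa> where "0 < \<kappa>" "\<And>\<delta>. 0 < \<delta> \<Longrightarrow> \<delta> \<le> 1 \<Longrightarrow>
    ennreal (\<kappa> * \<delta> powr (- \<eta>)) \<le> Lp_norm q (\<lambda>x. (deriv ^^ r) (\<lambda>x. (1 - s * x + \<delta>) powr \<sigma>) x * sided_weight s a b x)"
proof -
  define c where "c = \<bar>\<Prod>i<r. \<sigma> - real i\<bar> * 2 powr (\<sigma> - real r) * 2 powr (- \<bar>a\<bar>) * 2 powr (- \<bar>b\<bar>)"
  have c: "0 < c" using ff unfolding c_def by simp
  have lower: "c * \<delta> powr (- exponent_recip q - \<eta>) \<le> \<bar>(deriv ^^ r) (\<lambda>x. (1 - s * x + \<delta>) powr \<sigma>) x * sided_weight s a b x\<bar>"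
    if \<delta>: "0 < \<delta>" "\<delta> \<le> 1" and x: "\<delta> / 2 \<le> 1 - s * x" "1 - s * x \<le> \<delta>" for \<delta> x
  proof -
    define y where "y = 1 - s * x"
    have y: "\<delta> / 2 \<le> y" "y \<le> \<delta>" "0 < y" using x \<delta> unfolding y_def by auto
    have z: "1 \<le> 1 + s * x" "1 + s * x \<le> 2" using x \<delta> by auto
    have "(deriv ^^ r) (\<lambda>x. (1 - s * x + \<delta>) powr \<sigma>) x = (- s) ^ r * (\<Prod>i<r. \<sigma> - real i) * (y + \<delta>) powr (\<sigma> - real r)"
      using x \<delta> unfolding y_def by (subst funpow_deriv_shifted_powr) auto
    moreover have "\<bar>(- s) ^ r\<bar> = 1" using s by (auto simp: power_abs)
    ultimately have eq: "\<bar>(deriv ^^ r) (\<lambda>x. (1 - s * x + \<delta>) powr \<sigma>) x * sided_weight s a b x\<bar> =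
      \<bar>\<Prod>i<r. \<sigma> - real i\<bar> * (y + \<delta>) powr (\<sigma> - real r) * y powr a * (1 + s * x) powr b"
      unfolding sided_weight_def y_def[symmetric] by (simp add: abs_mult mult.assoc)
    have 1: "2 powr (\<sigma> - real r) * \<delta> powr (\<sigma> - real r) \<le> (y + \<delta>) powr (\<sigma> - real r)"
    proof -
      have "(2 * \<delta>) powr (\<sigma> - real r) \<le> (y + \<delta>) powr (\<sigma> - real r)"
        using y \<delta> \<sigma>(2) by (intro powr_mono2') auto
      then show ?thesis using \<delta> by (simp add: powr_mult)
    qed
    have 2: "2 powr (- \<bar>a\<bar>) * \<delta> powr a \<le> y powr a"
    proof (cases "0 \<le> a")
      case True
      have "(\<delta> / 2) powr a \<le> y powr a" using True y \<delta> by (intro powr_mono2) auto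
      then show ?thesis using True \<delta> by (simp add: powr_divide powr_minus_divide)
    next
      case False
      have "2 powr (- \<bar>a\<bar>) * \<delta> powr a \<le> 1 * \<delta> powr a"
        using powr_mono[of "- \<bar>a\<bar>" 0 "2::real"] by (intro mult_right_mono) auto
      also have "\<dots> \<le> y powr a" using False y by (simp add: powr_mono2')
      finally show ?thesis .
    qed
    have 3: "2 powr (- \<bar>b\<bar>) \<le> (1 + s * x) powr b"
    proof -
      have "2 powr (- \<bar>b\<bar>) \<le> (1 + s * x) powr (- \<bar>b\<bar>)" using z by (intro powr_mono2') auto
      also have "\<dots> \<le> (1 + s * x) powr b" using z by (intro powr_mono) auto
      finally show ?thesis .
    qed
    have "\<delta> powr (- exponent_recip q - \<eta>) = \<delta> powr (\<sigma> - real r) * \<delta> powr a"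
      unfolding \<sigma>(1)[symmetric] powr_add ..
    then have "c * \<delta> powr (- exponent_recip q - \<eta>) =
       \<bar>\<Prod>i<r. \<sigma> - real i\<bar> * (2 powr (\<sigma> - real r) * \<delta> powr (\<sigma> - real r)) * (2 powr (- \<bar>a\<bar>) * \<delta> powr a) * 2 powr (- \<bar>b\<bar>)"
      unfolding c_def by (simp add: mult_ac)
    also have "\<dots> \<le> \<bar>\<Prod>i<r. \<sigma> - real i\<bar> * (y + \<delta>) powr (\<sigma> - real r) * y powr a * (1 + s * x) powr b"
      by (intro mult_mono 1 2 3) auto
    finally show ?thesis unfolding eq .
  qed
  define \<kappa> where "\<kappa> = c * 2 powr (- exponent_recip q)"
  show ?thesis
  proof (rule that[of \<kappa>])
    show "0 < \<kappa>" using c unfolding \<kappa>_def by simp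
    fix \<delta> :: real assume \<delta>: "0 < \<delta>" "\<delta> \<le> 1"
    define G where "G x = (deriv ^^ r) (\<lambda>x. (1 - s * x + \<delta>) powr \<sigma>) x * sided_weight s a b x" for x
    have G: "c * \<delta> powr (- exponent_recip q - \<eta>) \<le> \<bar>G x\<bar>" if "\<delta> / 2 \<le> 1 - s * x" "1 - s * x \<le> \<delta>" for x
      using lower[OF \<delta> that] unfolding G_def .
    have "ennreal (\<kappa> * \<delta> powr (- \<eta>)) \<le> Lp_norm q G"
    proof (cases "q = \<infinity>")
      case True
      have rec: "exponent_recip q = 0" using True unfolding exponent_recip_def by simp
      define x where "x = s * (1 - \<delta> * 3 / 4)"
      have sx: "s * x = 1 - \<delta> * 3 / 4" using s unfolding x_def by auto
      have x: "x \<in> {-1<..<1}" using s \<delta> unfolding x_def by auto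
      have "\<kappa> * \<delta> powr (- \<eta>) \<le> \<bar>G x\<bar>"
        using G[of x] \<delta> unfolding sx \<kappa>_def rec by simp
      then have "ennreal (\<kappa> * \<delta> powr (- \<eta>)) \<le> ennreal \<bar>G x\<bar>" by (rule ennreal_leI)
      also have "\<dots> \<le> Lp_norm q G" unfolding Lp_norm_def using True x by (auto intro!: SUP_upper)
      finally show ?thesis .
    next
      case False
      define Q where "Q = enn2real q"
      have Q: "1 \<le> Q" "exponent_recip q = 1 / Q" using finite_exponent[OF q False] unfolding Q_def by auto
      \<comment> \<open>The layer written for both signs:
        \<open>{1 - \<delta>..1 - \<delta> / 2}\<close> for \<open>s = 1\<close> and its mirror
        image for \<open>s = -1\<close>.\<close>
      define I where "I = {s * (1 - \<delta> / 2) - \<delta> / 4 - s * \<delta> / 4..s * (1 - \<delta> / 2) + \<delta> / 4 - s * \<delta> / 4}"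
      have I: "-1 \<le> x \<and> x \<le> 1 \<and> \<delta> / 2 \<le> 1 - s * x \<and> 1 - s * x \<le> \<delta>" if "x \<in> I" for x
        using that s \<delta> unfolding I_def by (auto simp: field_simps)
      have "(\<kappa> * \<delta> powr (- \<eta>)) powr Q = (c * \<delta> powr (- exponent_recip q - \<eta>)) powr Q * (\<delta> / 2)"
      proof -
        have "\<kappa> * \<delta> powr (- \<eta>) = (c * \<delta> powr (- exponent_recip q - \<eta>)) * (\<delta> / 2) powr (1 / Q)"
        proof -
          have "(\<delta> / 2) powr (1 / Q) = \<delta> powr (1 / Q) * 2 powr (- (1 / Q))"
            using \<delta> by (simp add: powr_divide powr_minus_divide)
          moreover have "\<delta> powr (- \<eta>) = \<delta> powr (- (1 / Q) - \<eta>) * \<delta> powr (1 / Q)"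
            unfolding powr_add[symmetric] by simp
          ultimately show ?thesis unfolding \<kappa>_def Q(2) by (simp add: mult_ac)
        qed
        moreover have "((\<delta> / 2) powr (1 / Q)) powr Q = \<delta> / 2"
          using \<delta> Q by (simp only: powr_powr) simp
        ultimately show ?thesis using c by (simp add: powr_mult)
      qed
      then have "ennreal ((\<kappa> * \<delta> powr (- \<eta>)) powr Q) = (\<integral>\<^sup>+x. ennreal ((c * \<delta> powr (- exponent_recip q - \<eta>)) powr Q) * indicator I x \<partial>lborel)"
      proof -
        assume eq: "(\<kappa> * \<delta> powr (- \<eta>)) powr Q = (c * \<delta> powr (- exponent_recip q - \<eta>)) powr Q * (\<delta> / 2)"
        have "emeasure lborel I = ennreal (\<delta> / 2)" using \<delta> unfolding I_def by simp
        moreover have "I \<in> sets lborel" unfolding I_def by simp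
        ultimately show ?thesis
          unfolding eq using \<delta> by (subst nn_integral_cmult_indicator) (simp_all add: ennreal_mult' del: times_divide_eq_right)
      qed
      also have "\<dots> \<le> integral11 (\<lambda>x. \<bar>G x\<bar> powr Q)"
      proof (rule nn_integral_mono)
        fix x :: real
        show "ennreal ((c * \<delta> powr (- exponent_recip q - \<eta>)) powr Q) * indicator I x \<le> ennreal (\<bar>G x\<bar> powr Q) * indicator {-1..1} x"
          using I[of x] G[of x] Q c by (auto simp: indicator_def intro!: ennreal_leI powr_mono2)
      qed
      finally show ?thesis
        using Q c unfolding Q_def by (intro Lp_norm_ge[OF False]) (auto simp: \<kappa>_def)
    qed
    then show "ennreal (\<kappa> * \<delta> powr (- \<eta>)) \<le> Lp_norm q (\<lambda>x. (deriv ^^ r) (\<lambda>x. (1 - s * x + \<delta>) powr \<sigma>) x * sided_weight s a b x)"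
      unfolding G_def .
  qed
qed

lemma ennreal_inverse_antimono:
  fixes x y :: ennreal
  assumes "x \<le> y"
  shows "inverse y \<le> inverse x"
proof (cases "x = 0 \<or> y = top")
  case False
  then obtain u v where uv: "x = ennreal u" "0 < u" "y = ennreal v"
    using assms by (cases x; cases y) (auto simp: less_le top_unique)
  then have "u \<le> v" using assms by (auto simp: ennreal_le_iff2)
  then show ?thesis using uv by (simp add: inverse_ennreal ennreal_leI le_imp_inverse_le)
qed auto

lemma sharpness_sided:
  fixes p q :: ennreal and s a b c d h \<epsilon> :: real and r k :: nat
  assumes p: "1 \<le> p" "p \<noteq> \<infinity>" and q: "p \<le> q" and s: "s = 1 \<or> s = -1"
    and a: "- exponent_recip q < a" and b: "- exponent_recip q < b"
    and c: "- exponent_recip p < c" and d: "- exponent_recip p < d"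
    and k: "0 < k" and h: "h = real k - (exponent_recip p - exponent_recip q)"
    and gap: "a - c < real r + (exponent_recip p - exponent_recip q)" and \<epsilon>: "0 < \<epsilon>"
  shows "\<exists>f :: nat \<Rightarrow> real \<Rightarrow> real.
          (\<forall>n. Cm_on (k + r) {-1..1} (f n)) \<and>
          ((\<lambda>n. Lp_norm q (\<lambda>x. (deriv ^^ r) (f n) x * sided_weight s a b x) *
             inverse (Lp_norm p (\<lambda>x. f n x * sided_weight s c d x) +
               Lp_norm p (\<lambda>x. (deriv ^^ (k + r)) (f n) x * sided_weight s (a + h + \<epsilon>) (b + h) x)))
           \<longlonglongrightarrow> \<infinity>)"
proof -
  define ip where "ip = exponent_recip p"
  define iq where "iq = exponent_recip q"
  have q1: "1 \<le> q" using p q by (rule_tac order_trans)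
  have ip: "ip \<le> 1" using finite_exponent[OF p] unfolding ip_def by simp
  \<comment> \<open>Two upper limits. With \<open>\<eta> < \<epsilon>\<close> the top derivative
    times its weight is bounded by a power with exponent
    \<open>- 1 / p + \<epsilon> - \<eta>\<close>, which is integrable to the power \<open>p\<close>.
    With \<open>\<eta> < c + r + 1 / p - 1 / q - a\<close> one has
    \<open>- 1 / p < c + \<sigma>\<close>, so \<open>f\<close> times its weight stays bounded in
    norm. The hypothesis \<open>gap\<close> says that the second limit is positive.\<close>
  obtain \<eta> where \<eta>: "0 < \<eta>" "\<eta> < min \<epsilon> (c + real r + ip - iq - a)"
    "\<And>i::nat. (real r - a - iq) - \<eta> \<noteq> real i"
    using exists_noninteger_shift[of "min \<epsilon> (c + real r + ip - iq - a)" "real r - a - iq"]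
      gap c \<epsilon> unfolding ip_def iq_def by (auto simp: algebra_simps)
  define \<sigma> where "\<sigma> = real r - a - iq - \<eta>"
  have \<sigma>: "\<sigma> - real r + a = - iq - \<eta>" "\<sigma> - real r < 0"
    using a \<eta>(1) unfolding \<sigma>_def iq_def by auto
  have ff: "(\<Prod>i<j. \<sigma> - real i) \<noteq> 0" for j
    using \<eta>(3) unfolding \<sigma>_def by (simp add: algebra_simps)
  obtain \<kappa> where \<kappa>: "0 < \<kappa>" "\<And>\<delta>. 0 < \<delta> \<Longrightarrow> \<delta> \<le> 1 \<Longrightarrow>
    ennreal (\<kappa> * \<delta> powr (- \<eta>)) \<le> Lp_norm q (\<lambda>x. (deriv ^^ r) (\<lambda>x. (1 - s * x + \<delta>) powr \<sigma>) x * sided_weight s a b x)"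
    using shifted_powr_norm_lower[OF q1 s ff \<sigma>(1)[unfolded iq_def] \<sigma>(2), of b] by blast
  obtain K1 where K1: "0 \<le> K1" "\<And>g \<kappa>. 0 \<le> \<kappa> \<Longrightarrow> (\<And>x. -1 \<le> x \<Longrightarrow> x \<le> 1 \<Longrightarrow> \<bar>g x\<bar> \<le> \<kappa> * sided_weight s (c + min \<sigma> 0) d x) \<Longrightarrow>
    Lp_norm p g \<le> ennreal (\<kappa> * K1)"
  proof (rule Lp_norm_le_weight[OF p s, of "c + min \<sigma> 0" d])
    show "- exponent_recip p < c + min \<sigma> 0"
      using \<eta>(2)[unfolded min_less_iff_conj] c unfolding \<sigma>_def ip_def by linarith
  qed (use d in auto)
  define \<tau> where "\<tau> = \<sigma> - real (k + r)"
  have \<tau>: "min \<tau> 0 = \<tau>" using \<sigma>(2) unfolding \<tau>_def by simp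
  obtain K2 where K2: "0 \<le> K2" "\<And>g \<kappa>. 0 \<le> \<kappa> \<Longrightarrow> (\<And>x. -1 \<le> x \<Longrightarrow> x \<le> 1 \<Longrightarrow> \<bar>g x\<bar> \<le> \<kappa> * sided_weight s (a + h + \<epsilon> + min \<tau> 0) (b + h) x) \<Longrightarrow>
    Lp_norm p g \<le> ennreal (\<kappa> * K2)"
  proof (rule Lp_norm_le_weight[OF p s, of "a + h + \<epsilon> + min \<tau> 0" "b + h"])
    show "- exponent_recip p < a + h + \<epsilon> + min \<tau> 0"
      using \<eta>(2) unfolding \<tau> unfolding \<tau>_def \<sigma>_def h ip_def iq_def by simp
    show "- exponent_recip p < b + h" using b k ip unfolding h ip_def iq_def by simp
  qed auto
  define \<delta> where "\<delta> n = inverse (real (Suc n))" for n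
  have \<delta>: "0 < \<delta> n" "\<delta> n \<le> 1" for n unfolding \<delta>_def by (auto simp: field_simps)
  define f where "f n x = (1 - s * x + \<delta> n) powr \<sigma>" for n x
  define C1 where "C1 = 3 powr \<bar>\<sigma>\<bar> * K1"
  define C2 where "C2 = (\<bar>\<Prod>i<k + r. \<sigma> - real i\<bar> * 3 powr \<bar>\<tau>\<bar>) * K2"
  have sx: "0 \<le> 1 - s * x" "1 - s * x \<le> 2" if "-1 \<le> x" "x \<le> 1" for x using s that by auto
  have B1: "Lp_norm p (\<lambda>x. f n x * sided_weight s c d x) \<le> ennreal C1" for n
    unfolding C1_def
  proof (rule K1(2))
    fix x :: real assume x: "-1 \<le> x" "x \<le> 1"
    have "\<bar>f n x * sided_weight s c d x\<bar> = ((1 - s * x + \<delta> n) powr \<sigma> * (1 - s * x) powr c) * (1 + s * x) powr d"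
      unfolding f_def sided_weight_def by (simp add: abs_mult)
    also have "\<dots> \<le> (3 powr \<bar>\<sigma>\<bar> * (1 - s * x) powr (c + min \<sigma> 0)) * (1 + s * x) powr d"
      by (intro mult_right_mono shifted_powr_le sx[OF x] \<delta>) auto
    finally show "\<bar>f n x * sided_weight s c d x\<bar> \<le> 3 powr \<bar>\<sigma>\<bar> * sided_weight s (c + min \<sigma> 0) d x"
      unfolding sided_weight_def by (simp add: mult.assoc)
  qed simp
  have B2: "Lp_norm p (\<lambda>x. (deriv ^^ (k + r)) (f n) x * sided_weight s (a + h + \<epsilon>) (b + h) x) \<le> ennreal C2" for n
    unfolding C2_def
  proof (rule K2(2))
    fix x :: real assume x: "-1 \<le> x" "x \<le> 1"
    have "(deriv ^^ (k + r)) (f n) x = (- s) ^ (k + r) * (\<Prod>i<k + r. \<sigma> - real i) * (1 - s * x + \<delta> n) powr \<tau>"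
      unfolding f_def \<tau>_def by (rule funpow_deriv_shifted_powr) (use sx[OF x] \<delta>[of n] in linarith)
    moreover have "\<bar>(- s) ^ (k + r)\<bar> = 1" using s by (auto simp: power_abs)
    ultimately have "\<bar>(deriv ^^ (k + r)) (f n) x * sided_weight s (a + h + \<epsilon>) (b + h) x\<bar> =
      \<bar>\<Prod>i<k + r. \<sigma> - real i\<bar> * ((1 - s * x + \<delta> n) powr \<tau> * (1 - s * x) powr (a + h + \<epsilon>)) * (1 + s * x) powr (b + h)"
      unfolding sided_weight_def by (simp add: abs_mult mult.assoc)
    also have "\<dots> \<le> \<bar>\<Prod>i<k + r. \<sigma> - real i\<bar> * (3 powr \<bar>\<tau>\<bar> * (1 - s * x) powr (a + h + \<epsilon> + min \<tau> 0)) * (1 + s * x) powr (b + h)"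
      by (intro mult_right_mono mult_left_mono shifted_powr_le sx[OF x] \<delta>) auto
    finally show "\<bar>(deriv ^^ (k + r)) (f n) x * sided_weight s (a + h + \<epsilon>) (b + h) x\<bar> \<le>
       \<bar>\<Prod>i<k + r. \<sigma> - real i\<bar> * 3 powr \<bar>\<tau>\<bar> * sided_weight s (a + h + \<epsilon> + min \<tau> 0) (b + h) x"
      unfolding sided_weight_def by (simp add: mult.assoc)
  qed simp
  \<comment> \<open>A common bound for the denominators; the summand 1 makes it positive and hence
    invertible.\<close>
  define M where "M = C1 + C2 + 1"
  have C12: "0 \<le> C1" "0 \<le> C2" using K1(1) K2(1) unfolding C1_def C2_def by auto
  then have "0 < M" unfolding M_def by linarith
  note C = C12 this
  define R where "R n = Lp_norm q (\<lambda>x. (deriv ^^ r) (f n) x * sided_weight s a b x) *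
             inverse (Lp_norm p (\<lambda>x. f n x * sided_weight s c d x) +
               Lp_norm p (\<lambda>x. (deriv ^^ (k + r)) (f n) x * sided_weight s (a + h + \<epsilon>) (b + h) x))" for n
  have ratio: "ennreal (\<kappa> / M * real (Suc n) powr \<eta>) \<le> R n" for n
  proof -
    have "\<delta> n powr (- \<eta>) = real (Suc n) powr \<eta>"
      unfolding \<delta>_def by (simp add: powr_minus inverse_powr)
    then have "ennreal (\<kappa> / M * real (Suc n) powr \<eta>) = ennreal (\<kappa> * \<delta> n powr (- \<eta>)) * ennreal (inverse M)"
      using \<kappa>(1) C(3) by (simp add: ennreal_mult[symmetric] field_simps)
    also have "ennreal (inverse M) = inverse (ennreal M)" using C(3) by (simp add: inverse_ennreal)
    also have "ennreal (\<kappa> * \<delta> n powr (- \<eta>)) * inverse (ennreal M) \<le> R n"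
      unfolding R_def
    proof (intro mult_mono)
      show "ennreal (\<kappa> * \<delta> n powr (- \<eta>)) \<le> Lp_norm q (\<lambda>x. (deriv ^^ r) (f n) x * sided_weight s a b x)"
        using \<kappa>(2)[OF \<delta>] unfolding f_def .
      have "Lp_norm p (\<lambda>x. f n x * sided_weight s c d x) +
               Lp_norm p (\<lambda>x. (deriv ^^ (k + r)) (f n) x * sided_weight s (a + h + \<epsilon>) (b + h) x) \<le> ennreal C1 + ennreal C2"
        by (intro add_mono B1 B2)
      also have "\<dots> \<le> ennreal M" unfolding M_def using C by (simp add: ennreal_plus[symmetric] ennreal_leI del: ennreal_plus)
      finally show "inverse (ennreal M) \<le> inverse (Lp_norm p (\<lambda>x. f n x * sided_weight s c d x) +
               Lp_norm p (\<lambda>x. (deriv ^^ (k + r)) (f n) x * sided_weight s (a + h + \<epsilon>) (b + h) x))"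
        by (rule ennreal_inverse_antimono)
    qed auto
    finally show ?thesis .
  qed
  have lim: "filterlim (\<lambda>n. \<kappa> / M * real (Suc n) powr \<eta>) at_top sequentially"
  proof (rule filterlim_tendsto_pos_mult_at_top[OF tendsto_const])
    show "0 < \<kappa> / M" using \<kappa>(1) C(3) by simp
    have "filterlim (\<lambda>n. real (Suc n)) at_top sequentially"
      by (rule filterlim_compose[OF filterlim_real_sequentially filterlim_Suc])
    then have "filterlim (\<lambda>n. exp (\<eta> * ln (real (Suc n)))) at_top sequentially"
      by (intro filterlim_compose[OF exp_at_top] filterlim_tendsto_pos_mult_at_top[OF tendsto_const \<eta>(1)]
          filterlim_compose[OF ln_at_top])
    then show "filterlim (\<lambda>n. real (Suc n) powr \<eta>) at_top sequentially"
      by (simp add: powr_def)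
  qed
  have "(\<lambda>n. R n) \<longlonglongrightarrow> \<infinity>"
    unfolding infinity_ennreal_def tendsto_top_iff_ennreal
  proof (intro allI impI)
    fix l :: real assume l: "0 \<le> l"
    have "\<forall>\<^sub>F n in sequentially. l < \<kappa> / M * real (Suc n) powr \<eta>"
      using lim unfolding filterlim_at_top_dense by blast
    then show "\<forall>\<^sub>F n in sequentially. ennreal l < R n"
    proof eventually_elim
      case (elim n)
      then have "ennreal l < ennreal (\<kappa> / M * real (Suc n) powr \<eta>)" using l by (simp add: ennreal_less_iff)
      then show ?case using ratio[of n] by (rule less_le_trans)
    qed
  qed
  moreover have "Cm_on (k + r) {-1..1} (f n)" for n
    unfolding f_def by (rule Cm_on_shifted_powr) (use s \<delta> in auto)
  ultimately show ?thesis unfolding R_def by blast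
qed

section \<open>The weighted inequality\<close>

text \<open>A Borel representative, so that reflections and Tonelli's theorem apply to it directly.\<close>

definition top_derivative_modulus :: "nat \<Rightarrow> (real \<Rightarrow> real) \<Rightarrow> (real \<Rightarrow> real) \<Rightarrow> bool" where
  "top_derivative_modulus m f G \<longleftrightarrow> G \<in> borel_measurable borel \<and> (\<forall>x. 0 \<le> G x) \<and>
    (AE x in lborel. x \<in> {-1<..<1} \<longrightarrow> G x = \<bar>(deriv ^^ m) f x\<bar>)"

text \<open>The weight is positive on the open interval and can be divided out there. At the end
  points it is 0, so no claim about them is made.\<close>

lemma top_derivative_modulus_exists:
  assumes "(\<lambda>x. (deriv ^^ m) f x * jacobi_weight a b x) \<in> borel_measurable (lebesgue_on {-1..1})"
  obtains G where "top_derivative_modulus m f G"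
proof -
  have W: "jacobi_weight a b \<in> borel_measurable (lebesgue_on {-1..1})"
    unfolding jacobi_weight_def by (intro measurable_restrict_space1 measurable_completion) measurable
  have "(\<lambda>x. (deriv ^^ m) f x * jacobi_weight a b x / jacobi_weight a b x) \<in> borel_measurable (lebesgue_on {-1..1})"
    using assms W by measurable
  then have "(\<lambda>x. if x \<in> {-1..1} then (deriv ^^ m) f x * jacobi_weight a b x / jacobi_weight a b x else 0) \<in> borel_measurable lebesgue"
    by (subst borel_measurable_if) auto
  then obtain G0 where G0: "G0 \<in> borel_measurable lborel"
    "AE x in lborel. (if x \<in> {-1..1} then (deriv ^^ m) f x * jacobi_weight a b x / jacobi_weight a b x else 0) = G0 x"
    using completion_ex_borel_measurable_real by blast
  have "top_derivative_modulus m f (\<lambda>x. \<bar>G0 x\<bar>)"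
    unfolding top_derivative_modulus_def
  proof (intro conjI)
    show "(\<lambda>x. \<bar>G0 x\<bar>) \<in> borel_measurable borel" using G0(1) by simp
    show "AE x in lborel. x \<in> {-1<..<1} \<longrightarrow> \<bar>G0 x\<bar> = \<bar>(deriv ^^ m) f x\<bar>"
      using G0(2) by eventually_elim (auto simp: jacobi_weight_def split: if_splits)
  qed simp
  then show ?thesis by (rule that)
qed

section \<open>Regularity of the derivatives on the open interval\<close>

lemma abs_continuous_on_imp_continuous_on:
  assumes "abs_continuous_on {\<alpha>..\<beta>} F"
  shows "continuous_on {\<alpha>..\<beta>} F"
  unfolding continuous_on_iff
proof (intro ballI allI impI)
  fix x e :: real assume x: "x \<in> {\<alpha>..\<beta>}" and e: "0 < e"
  have "\<exists>\<delta>>0. \<forall>(I :: nat set) u v. finite I \<longrightarrow> (\<forall>i\<in>I. u i \<le> v i \<and> {u i..v i} \<subseteq> {\<alpha>..\<beta>}) \<longrightarrow>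
    disjoint_family_on (\<lambda>i. {u i<..<v i}) I \<longrightarrow> (\<Sum>i\<in>I. v i - u i) < \<delta> \<longrightarrow>
    (\<Sum>i\<in>I. \<bar>F (v i) - F (u i)\<bar>) < e"
    by (rule abs_continuous_on_finite_family[OF assms e])
  then obtain \<delta> where \<delta>: "0 < \<delta>" and small: "\<And>(I :: nat set) u v. finite I \<Longrightarrow> \<forall>i\<in>I. u i \<le> v i \<and> {u i..v i} \<subseteq> {\<alpha>..\<beta>} \<Longrightarrow>
    disjoint_family_on (\<lambda>i. {u i<..<v i}) I \<Longrightarrow> (\<Sum>i\<in>I. v i - u i) < \<delta> \<Longrightarrow>
    (\<Sum>i\<in>I. \<bar>F (v i) - F (u i)\<bar>) < e" by blast
  show "\<exists>d>0. \<forall>y\<in>{\<alpha>..\<beta>}. dist y x < d \<longrightarrow> dist (F y) (F x) < e"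
  proof (intro exI[of _ \<delta>] conjI ballI impI \<delta>)
    fix y assume y: "y \<in> {\<alpha>..\<beta>}" "dist y x < \<delta>"
    have "(\<Sum>i\<in>{0::nat}. \<bar>F (max x y) - F (min x y)\<bar>) < e"
      by (rule small) (use x y in \<open>auto simp: dist_real_def disjoint_family_on_def\<close>)
    then show "dist (F y) (F x) < e" by (auto simp: dist_real_def max_def min_def split: if_splits)
  qed
qed

lemma deriv_abs_continuous_has_derivative:
  assumes "deriv_abs_continuous n f" "i < n" "x \<in> {-1<..<1}"
  shows "((deriv ^^ i) f has_real_derivative (deriv ^^ Suc i) f x) (at x)"
proof -
  have "(deriv ^^ i) f differentiable (at x within {-1<..<1})"
    using assms unfolding deriv_abs_continuous_def differentiable_on_def by blast
  then have "(deriv ^^ i) f differentiable (at x)"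
    using assms(3) by (simp add: at_within_open[of _ "{-1<..<1}"])
  then show ?thesis by (simp add: DERIV_deriv_iff_real_differentiable)
qed

lemma deriv_abs_continuous_continuous_on:
  assumes f: "deriv_abs_continuous n f" and i: "i \<le> n"
  shows "continuous_on {-1<..<1} ((deriv ^^ i) f)"
proof (cases "i < n")
  case True
  then show ?thesis using f unfolding deriv_abs_continuous_def
    by (intro differentiable_imp_continuous_on) blast
next
  case False
  then have "i = n" using i by simp
  have "isCont ((deriv ^^ n) f) x" if x: "x \<in> {-1<..<1}" for x
  proof -
    define \<alpha> where "\<alpha> = (x - 1) / 2"
    define \<beta> where "\<beta> = (x + 1) / 2"
    have ab: "-1 < \<alpha>" "\<alpha> < x" "x < \<beta>" "\<beta> < 1" using x unfolding \<alpha>_def \<beta>_def by auto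
    then have "abs_continuous_on {\<alpha>..\<beta>} ((deriv ^^ n) f)"
      using f unfolding deriv_abs_continuous_def abs_continuous_open_def by simp
    then have "continuous_on {\<alpha>..\<beta>} ((deriv ^^ n) f)" by (rule abs_continuous_on_imp_continuous_on)
    then show ?thesis by (rule continuous_on_interior) (use ab in simp)
  qed
  then show ?thesis unfolding \<open>i = n\<close> by (intro continuous_at_imp_continuous_on) blast
qed

lemma top_derivative_increment:
  assumes f: "deriv_abs_continuous n f" and G: "top_derivative_modulus (Suc n) f G"
    and xy: "-1 < x" "x \<le> y" "y < 1"
  shows "ennreal \<bar>(deriv ^^ n) f y - (deriv ^^ n) f x\<bar> \<le> (\<integral>\<^sup>+t\<in>{x..y}. ennreal (G t) \<partial>lborel)"
proof -
  have "abs_continuous_on {x..y} ((deriv ^^ n) f)"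
    using f xy unfolding deriv_abs_continuous_def abs_continuous_open_def by simp
  then have "ennreal \<bar>(deriv ^^ n) f y - (deriv ^^ n) f x\<bar> \<le> (\<integral>\<^sup>+t\<in>{x..y}. ennreal \<bar>(deriv ^^ Suc n) f t\<bar> \<partial>lborel)"
    using abs_continuous_diff_le_nn_integral[OF _ xy(2)] by simp
  also have "\<dots> = (\<integral>\<^sup>+t\<in>{x..y}. ennreal (G t) \<partial>lborel)"
  proof (rule nn_integral_cong_AE)
    have "AE t in lborel. t \<in> {-1<..<1} \<longrightarrow> G t = \<bar>(deriv ^^ Suc n) f t\<bar>"
      using G unfolding top_derivative_modulus_def by blast
    then show "AE t in lborel. ennreal \<bar>(deriv ^^ Suc n) f t\<bar> * indicator {x..y} t = ennreal (G t) * indicator {x..y} t"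
      by eventually_elim (use xy in \<open>auto simp: indicator_def\<close>)
  qed
  finally show ?thesis .
qed

lemma powr_ge_two_powr:
  fixes z e :: real
  assumes "1 / 2 \<le> z" "z \<le> 2"
  shows "2 powr (- \<bar>e\<bar>) \<le> z powr e" "z powr e \<le> 2 powr \<bar>e\<bar>"
proof -
  have l: "2 powr (- \<bar>e\<bar>) \<le> z powr e" if "1 / 2 \<le> z" "z \<le> 2" for z e :: real
  proof (cases "0 \<le> e")
    case True
    have "2 powr (- \<bar>e\<bar>) = (1 / 2) powr e" using True by (simp add: powr_divide powr_minus_divide)
    also have "\<dots> \<le> z powr e" using that True by (intro powr_mono2) auto
    finally show ?thesis .
  next
    case False
    then show ?thesis using that by (simp add: powr_mono2')
  qed
  show "2 powr (- \<bar>e\<bar>) \<le> z powr e" by (rule l[OF assms])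
  have "2 powr (- \<bar>- e\<bar>) \<le> z powr (- e)" by (rule l[OF assms])
  then have "inverse (2 powr \<bar>e\<bar>) \<le> inverse (z powr e)" by (simp add: powr_minus)
  then show "z powr e \<le> 2 powr \<bar>e\<bar>" using assms by (simp add: inverse_le_iff_le)
qed

text \<open>Only the values at 0 are kept: they are the constants of integration on both halves. On
  \<open>{-(1/2)..1/2}\<close> the weights are bounded below, so the two weighted norms control
  small values of \<open>f\<close> and the oscillation of the derivative of order
  \<open>n\<close>.\<close>

lemma interior_bound:
  fixes P a b c d :: real
  assumes P: "1 \<le> P"
  obtains C where "0 < C" "\<And>f G Nf Ng i. deriv_abs_continuous n f \<Longrightarrow> top_derivative_modulus (Suc n) f G \<Longrightarrow>
    0 \<le> Nf \<Longrightarrow> 0 \<le> Ng \<Longrightarrow>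
    integral11 (\<lambda>x. \<bar>f x * jacobi_weight c d x\<bar> powr P) \<le> ennreal (Nf powr P) \<Longrightarrow>
    integral11 (\<lambda>x. (G x * jacobi_weight a b x) powr P) \<le> ennreal (Ng powr P) \<Longrightarrow>
    i \<le> n \<Longrightarrow> \<bar>(deriv ^^ i) f 0\<bar> \<le> C * (Nf + Ng)"
proof -
  define w0 :: real where "w0 = 2 powr (- \<bar>c\<bar>) * 2 powr (- \<bar>d\<bar>)"
  define w1 :: real where "w1 = 2 powr (- \<bar>a\<bar>) * 2 powr (- \<bar>b\<bar>)"
  have w: "0 < w0" "0 < w1" unfolding w0_def w1_def by auto
  have wl: "w0 \<le> jacobi_weight c d x" "w1 \<le> jacobi_weight a b x" if "x \<in> {-(1/2)..1/2}" for x
    unfolding w0_def w1_def jacobi_weight_def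
    by (intro mult_mono powr_ge_two_powr; use that in auto)+
  \<comment> \<open>The cell half-width of \<open>interior_derivative_bound\<close> for
    \<open>m = Suc n\<close>.\<close>
  define \<delta> :: real where "\<delta> = 1 / 2 ^ Suc (Suc n)"
  have \<delta>: "0 < \<delta>" unfolding \<delta>_def by simp
  define c0 where "c0 = (1 / \<delta>) powr (1 / P) / w0"
  have c0: "0 < c0" using \<delta> w unfolding c0_def by simp
  define A :: real where "A = real (Suc n) * (2 * 2 ^ Suc (Suc n)) ^ Suc n"
  have A: "0 < A" unfolding A_def by simp
  show ?thesis
  proof (rule that[of "A * (c0 + 1 / w1)"])
    show "0 < A * (c0 + 1 / w1)" using A c0 w by (simp add: add_pos_pos)
    fix f G and Nf Ng :: real and i
    assume f: "deriv_abs_continuous n f" and G: "top_derivative_modulus (Suc n) f G"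
      and N: "0 \<le> Nf" "0 \<le> Ng"
      and If: "integral11 (\<lambda>x. \<bar>f x * jacobi_weight c d x\<bar> powr P) \<le> ennreal (Nf powr P)"
      and Ig: "integral11 (\<lambda>x. (G x * jacobi_weight a b x) powr P) \<le> ennreal (Ng powr P)"
      and i: "i \<le> n"
    have Gm [measurable]: "G \<in> borel_measurable borel" and G0: "\<And>x. 0 \<le> G x"
      using G unfolding top_derivative_modulus_def by auto
    have cont: "continuous_on {-1<..<1} f" using deriv_abs_continuous_continuous_on[OF f, of 0] by simp
    have osc: "\<bar>(deriv ^^ n) f y - (deriv ^^ n) f x\<bar> \<le> Ng / w1"
      if xy: "x \<in> {-(1/2)..1/2}" "y \<in> {-(1/2)..1/2}" "x \<le> y" for x y
    proof -
      define v where "v = \<bar>(deriv ^^ n) f y - (deriv ^^ n) f x\<bar>"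
      have "ennreal v \<le> (\<integral>\<^sup>+t\<in>{x..y}. ennreal (G t) \<partial>lborel)"
        unfolding v_def by (rule top_derivative_increment[OF f G]) (use xy in auto)
      also have "\<dots> \<le> (\<integral>\<^sup>+t. ennreal (G t * indicator {-(1/2)..1/2} t) \<partial>lborel)"
        using xy by (intro nn_integral_mono) (auto simp: indicator_def)
      finally have "ennreal v \<le> (\<integral>\<^sup>+t. ennreal (G t * indicator {-(1/2)..1/2} t) \<partial>lborel)" .
      \<comment> \<open>The density is the indicator of an interval of length 1, so Jensen's
        inequality costs no constant.\<close>
      then have "ennreal (v powr P) \<le> ennreal (1 powr (P - 1)) * (\<integral>\<^sup>+t. ennreal (G t powr P * indicator {-(1/2)..1/2} t) \<partial>lborel)"
        using P G0 by (intro nn_integral_powr_Jensen) (auto simp: v_def ennreal_indicator)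
      then have "ennreal (w1 powr P) * ennreal (v powr P) \<le> ennreal (w1 powr P) * (\<integral>\<^sup>+t. ennreal (G t powr P * indicator {-(1/2)..1/2} t) \<partial>lborel)"
        by (intro mult_left_mono) auto
      also have "\<dots> = (\<integral>\<^sup>+t. ennreal (w1 powr P) * ennreal (G t powr P * indicator {-(1/2)..1/2} t) \<partial>lborel)"
        by (rule nn_integral_cmult[symmetric]) measurable
      also have "\<dots> \<le> integral11 (\<lambda>x. (G x * jacobi_weight a b x) powr P)"
      proof (rule nn_integral_mono)
        fix t :: real
        show "ennreal (w1 powr P) * ennreal (G t powr P * indicator {-(1/2)..1/2} t) \<le> ennreal ((G t * jacobi_weight a b t) powr P) * indicator {-1..1} t"
        proof (cases "t \<in> {-(1/2)..1/2}")
          case True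
          have "w1 powr P * G t powr P = (G t * w1) powr P" using w G0[of t] by (simp add: powr_mult mult.commute)
          also have "\<dots> \<le> (G t * jacobi_weight a b t) powr P"
            using wl(2)[OF True] w G0[of t] P by (intro powr_mono2 mult_left_mono) auto
          finally show ?thesis using True by (simp add: ennreal_mult[symmetric] ennreal_leI)
        qed simp
      qed
      also note Ig
      finally have "w1 powr P * v powr P \<le> Ng powr P"
        by (simp add: ennreal_mult[symmetric] ennreal_le_iff)
      then have "(w1 * v) powr P \<le> Ng powr P" using w by (simp add: powr_mult v_def)
      then have "w1 * v \<le> Ng" by (rule powr_le_cancel_base[rotated 3]) (use P N w in \<open>auto simp: v_def\<close>)
      then show ?thesis using w unfolding v_def by (simp add: pos_le_divide_eq mult.commute)
    qed
    have "\<bar>(deriv ^^ i) f 0\<bar> \<le> real (Suc n) * (2 * 2 ^ Suc (Suc n)) ^ Suc n * (Nf * (1 / \<delta>) powr (1 / P) / w0 + Ng / w1)"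
    proof (rule interior_derivative_bound[where F = "\<lambda>j. (deriv ^^ j) f" and m = "Suc n"])
      show "((deriv ^^ j) f has_real_derivative (deriv ^^ Suc j) f x) (at x)"
        if "j < Suc n - 1" "x \<in> {-(1/2)..1/2}" for j x
        by (rule deriv_abs_continuous_has_derivative[OF f]) (use that in auto)
      show "\<bar>(deriv ^^ (Suc n - 1)) f y - (deriv ^^ (Suc n - 1)) f x\<bar> \<le> Ng / w1"
        if "x \<in> {-(1/2)..1/2}" "y \<in> {-(1/2)..1/2}" for x y
        using osc[of x y] osc[of y x] that by (cases "x \<le> y") (auto simp: abs_minus_commute)
      show "\<exists>t\<in>{l..l + 1 / 2 ^ Suc (Suc n)}. \<bar>(deriv ^^ 0) f t\<bar> \<le> Nf * (1 / \<delta>) powr (1 / P) / w0"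
        if l: "-(1/2) \<le> l" "l + 1 / 2 ^ Suc (Suc n) \<le> 1/2" for l
        unfolding \<delta>_def[symmetric] funpow_0
      proof (rule exists_small_value[of P \<delta> l f w0 "jacobi_weight c d" Nf])
        have sub: "{l..l + \<delta>} \<subseteq> {-(1/2)..1/2}" using l unfolding \<delta>_def by auto
        show "continuous_on {l..l + \<delta>} f" by (rule continuous_on_subset[OF cont]) (use sub in force)
        show "w0 \<le> jacobi_weight c d x" if "x \<in> {l..l + \<delta>}" for x using wl(1) that sub by blast
        show "-1 \<le> l" using l by linarith
        show "l + \<delta> \<le> 1" using l unfolding \<delta>_def by linarith
        show "0 < P" using P by linarith
      qed (fact \<delta> w N If)+
    qed (use w N i in auto)
    also have "\<dots> = A * (c0 * Nf + 1 / w1 * Ng)" unfolding A_def c0_def by simp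
    also have "\<dots> \<le> A * ((c0 + 1 / w1) * Nf + (c0 + 1 / w1) * Ng)"
      using A c0 w N by (intro mult_left_mono add_mono mult_right_mono) auto
    also have "\<dots> = A * (c0 + 1 / w1) * (Nf + Ng)" by (simp only: distrib_left[of "c0 + 1 / w1", symmetric] mult.assoc)
    finally show "\<bar>(deriv ^^ i) f 0\<bar> \<le> A * (c0 + 1 / w1) * (Nf + Ng)" .
  qed
qed

section \<open>Estimates next to one end point\<close>

text \<open>The substitution \<open>x = s - s * y\<close> turns integration from the origin towards
  the end point \<open>s\<close> into a tail integral over \<open>{y<..<1}\<close>. The top order
  relies on absolute continuity, the lower orders on the ordinary fundamental theorem.\<close>

lemma one_sided_tail_dominated:
  fixes s B :: real
  assumes s: "s = 1 \<or> s = -1" and k: "0 < k" and B: "0 \<le> B"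
    and f: "deriv_abs_continuous (r + k - 1) f" and G: "top_derivative_modulus (r + k) f G"
    and bound: "\<And>i. i \<le> r + k - 1 \<Longrightarrow> \<bar>(deriv ^^ i) f 0\<bar> \<le> B"
  shows "tail_dominated (\<lambda>y. \<bar>(deriv ^^ r) f (s - s * y)\<bar>) (real k * B)
    (\<lambda>t. t ^ (k - 1) * G (s - s * t) * indicator {0<..<1} t)"
proof -
  have Gm [measurable]: "G \<in> borel_measurable borel" and G0: "\<And>x. 0 \<le> G x"
    using G unfolding top_derivative_modulus_def by auto
  define u where "u i y = (deriv ^^ (r + i)) f (s - s * y)" for i y
  define n where "n = r + k - 1"
  have n: "r + k = Suc n" "r + (k - 1) = n" using k unfolding n_def by auto
  have sy: "s - s * y \<in> {-1<..<1}" if "0 < y" "y \<le> 1" for y using s that by auto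
  have ends: "ennreal B1 \<le> ennreal B + I" if "ennreal \<bar>B1 - B2\<bar> \<le> I" "\<bar>B2\<bar> \<le> B" "0 \<le> B1" for B1 B2 :: real and I :: ennreal
  proof -
    have "ennreal B1 \<le> ennreal (B + \<bar>B1 - B2\<bar>)" using that by (intro ennreal_leI) auto
    also have "\<dots> \<le> ennreal B + I" using that B by (simp add: ennreal_plus add_left_mono)
    finally show ?thesis .
  qed
  have abs_ends: "ennreal \<bar>B1\<bar> \<le> ennreal B + I" if I: "ennreal \<bar>B1 - B2\<bar> \<le> I" and B2: "\<bar>B2\<bar> \<le> B" for B1 B2 :: real and I :: ennreal
  proof (rule ends[of _ "\<bar>B2\<bar>"])
    have "ennreal \<bar>\<bar>B1\<bar> - \<bar>B2\<bar>\<bar> \<le> ennreal \<bar>B1 - B2\<bar>" by (intro ennreal_leI) linarith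
    then show "ennreal \<bar>\<bar>B1\<bar> - \<bar>B2\<bar>\<bar> \<le> I" using I by (rule order_trans)
  qed (use B2 in auto)
  have "tail_dominated (\<lambda>y. \<bar>u 0 y\<bar>) (real k * B) (\<lambda>t. t ^ (k - 1) * G (s - s * t) * indicator {0<..<1} t)"
  proof (rule Taylor_tail_dominated[where u = u and G = "\<lambda>t. G (s - s * t)"])
    show "(\<lambda>t. G (s - s * t)) \<in> borel_measurable borel" by measurable
    fix y :: real assume y: "0 < y" "y < 1"
    show "ennreal \<bar>u (k - 1) y\<bar> \<le> ennreal B + (\<integral>\<^sup>+t. ennreal (G (s - s * t)) * indicator {y<..<1} t \<partial>lborel)"
    proof (rule abs_ends)
      \<comment> \<open>The minimum and maximum order the origin and \<open>s - s * y\<close>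
        correctly for both signs of \<open>s\<close>.\<close>
      define S where "S = {min 0 (s - s * y)..max 0 (s - s * y)}"
      have "ennreal \<bar>u (k - 1) y - (deriv ^^ n) f 0\<bar> \<le> (\<integral>\<^sup>+x\<in>S. ennreal (G x) \<partial>lborel)"
      proof -
        have "ennreal \<bar>(deriv ^^ n) f (max 0 (s - s * y)) - (deriv ^^ n) f (min 0 (s - s * y))\<bar> \<le> (\<integral>\<^sup>+x\<in>S. ennreal (G x) \<partial>lborel)"
          unfolding S_def
          by (rule top_derivative_increment[OF f[folded n_def] G[unfolded n(1)]]) (use y s in auto)
        then show ?thesis unfolding u_def n(2) by (auto simp: max_def min_def abs_minus_commute split: if_splits)
      qed
      also have "(\<integral>\<^sup>+x\<in>S. ennreal (G x) \<partial>lborel) = (\<integral>\<^sup>+t. ennreal (G (s - s * t)) * indicator S (s - s * t) \<partial>lborel)"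
        using nn_integral_real_affine[of "\<lambda>x. ennreal (G x) * indicator S x" "- s" s] s unfolding S_def by auto
      also have "\<dots> = (\<integral>\<^sup>+t. ennreal (G (s - s * t)) * indicator {y<..<1} t \<partial>lborel)"
      proof (rule nn_integral_cong_AE)
        have "AE t in lborel. t \<noteq> y" "AE t in lborel. t \<noteq> 1" by (rule AE_lborel_singleton)+
        then show "AE t in lborel. ennreal (G (s - s * t)) * indicator S (s - s * t) = ennreal (G (s - s * t)) * indicator {y<..<1} t"
          by eventually_elim (use s y in \<open>auto simp: S_def indicator_def\<close>)
      qed
      finally show "ennreal \<bar>u (k - 1) y - (deriv ^^ n) f 0\<bar> \<le> (\<integral>\<^sup>+t. ennreal (G (s - s * t)) * indicator {y<..<1} t \<partial>lborel)" .
      show "\<bar>(deriv ^^ n) f 0\<bar> \<le> B" using bound[of n] unfolding n_def by simp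
    qed
  next
    fix i and y :: real assume i: "i < k - 1" and y: "0 < y" "y < 1"
    show "ennreal \<bar>u i y\<bar> \<le> ennreal B + (\<integral>\<^sup>+t. ennreal \<bar>u (Suc i) t\<bar> * indicator {y<..<1} t \<partial>lborel)"
    proof (rule abs_ends)
      have "((\<lambda>t. - s * u (Suc i) t) has_integral u i 1 - u i y) {y..1}"
      proof (rule fundamental_theorem_of_calculus)
        fix t assume t: "t \<in> {y..1}"
        have "((deriv ^^ (r + i)) f has_real_derivative (deriv ^^ Suc (r + i)) f (s - s * t)) (at (s - s * t))"
          by (rule deriv_abs_continuous_has_derivative[OF f]) (use i t y sy[of t] in auto)
        \<comment> \<open>The chain rule factor \<open>- s\<close> has absolute value 1 and
          disappears in the estimate.\<close>
        then have "(u i has_real_derivative u (Suc i) t * (- s)) (at t)"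
          unfolding u_def add_Suc_right by (rule DERIV_chain2[where g = "\<lambda>y. s - s * y"]) (auto intro!: derivative_eq_intros)
        then show "(u i has_vector_derivative - s * u (Suc i) t) (at t within {y..1})"
          unfolding has_real_derivative_iff_has_vector_derivative[symmetric]
          by (simp add: has_field_derivative_at_within mult.commute)
      qed (use y in simp)
      from has_integral_le_nn_integral[OF this]
      have "ennreal \<bar>u i y - u i 1\<bar> \<le> (\<integral>\<^sup>+t\<in>{y..1}. ennreal \<bar>- s * u (Suc i) t\<bar> \<partial>lborel)"
        by (simp only: abs_minus_commute)
      also have "\<dots> = (\<integral>\<^sup>+t. ennreal \<bar>u (Suc i) t\<bar> * indicator {y<..<1} t \<partial>lborel)"
      proof (rule nn_integral_cong_AE)
        have "AE t in lborel. t \<noteq> y" "AE t in lborel. t \<noteq> 1" by (rule AE_lborel_singleton)+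
        then show "AE t in lborel. ennreal \<bar>- s * u (Suc i) t\<bar> * indicator {y..1} t = ennreal \<bar>u (Suc i) t\<bar> * indicator {y<..<1} t"
          by eventually_elim (use s in \<open>auto simp: indicator_def\<close>)
      qed
      finally show "ennreal \<bar>u i y - u i 1\<bar> \<le> (\<integral>\<^sup>+t. ennreal \<bar>u (Suc i) t\<bar> * indicator {y<..<1} t \<partial>lborel)" .
      show "\<bar>u i 1\<bar> \<le> B" using bound[of "r + i"] i unfolding u_def by simp
    qed
  qed (use B k G0 in auto)
  then show ?thesis unfolding u_def by simp
qed

text \<open>At distance \<open>t\<close> from the end point the sided weight is
  \<open>t powr A * (2 - t) powr B\<close>. The factor \<open>t ^ (k - 1)\<close> and the weight
  \<open>t powr \<gamma>\<close> make up \<open>t powr A\<close>, and the bounded factor costs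
  \<open>2 powr \<bar>B\<bar>\<close>.\<close>

lemma one_sided_top_norm:
  fixes s P A B N \<gamma> :: real
  assumes s: "s = 1 \<or> s = -1" and P: "1 \<le> P" and N: "0 \<le> N"
    and G [measurable]: "G \<in> borel_measurable borel" and G0: "\<And>x. 0 \<le> G x"
    and I: "integral11 (\<lambda>x. (G x * sided_weight s A B x) powr P) \<le> ennreal (N powr P)"
    and A: "A = real (k - 1) + \<gamma>"
  shows "integral01 (\<lambda>t. (t ^ (k - 1) * G (s - s * t) * indicator {0<..<1} t) powr P * t powr (\<gamma> * P))
    \<le> ennreal ((2 powr \<bar>B\<bar> * N) powr P)"
proof -
  define c :: real where "c = 2 powr \<bar>B\<bar>"
  have c: "0 < c" unfolding c_def by simp
  have [measurable]: "sided_weight s A B \<in> borel_measurable borel" unfolding sided_weight_def by measurable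
  have "integral01 (\<lambda>t. (t ^ (k - 1) * G (s - s * t) * indicator {0<..<1} t) powr P * t powr (\<gamma> * P))
    \<le> (\<integral>\<^sup>+t. ennreal (c powr P) * (ennreal ((G (s - s * t) * sided_weight s A B (s - s * t)) powr P) * indicator {-1..1} (s - s * t)) \<partial>lborel)"
  proof (rule nn_integral_mono)
    fix t :: real
    show "ennreal ((t ^ (k - 1) * G (s - s * t) * indicator {0<..<1} t) powr P * t powr (\<gamma> * P)) * indicator {0<..<1} t
      \<le> ennreal (c powr P) * (ennreal ((G (s - s * t) * sided_weight s A B (s - s * t)) powr P) * indicator {-1..1} (s - s * t))"
    proof (cases "0 < t \<and> t < 1")
      case True
      have in1: "s - s * t \<in> {-1..1}" using s True by auto
      have ss: "s * s = 1" using s by auto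
      have y: "1 - s * (s - s * t) = t" "1 + s * (s - s * t) = 2 - t"
        using ss by (simp_all add: right_diff_distrib mult.assoc[symmetric])
      have "(t ^ (k - 1) * G (s - s * t)) powr P * t powr (\<gamma> * P) = (G (s - s * t) * t powr A) powr P"
      proof -
        have "t ^ (k - 1) = t powr real (k - 1)" using True by (simp add: powr_realpow)
        then show ?thesis unfolding A using True G0 by (simp add: powr_mult powr_powr powr_add distrib_right mult_ac)
      qed
      also have "\<dots> \<le> (c * (G (s - s * t) * sided_weight s A B (s - s * t))) powr P"
      proof (rule powr_mono2)
        have "inverse c \<le> (2 - t) powr B"
          using powr_ge_two_powr(1)[of "2 - t" B] True unfolding c_def by (simp add: powr_minus)
        then have "1 \<le> c * (2 - t) powr B" using c by (simp add: field_simps)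
        then have "G (s - s * t) * t powr A * 1 \<le> G (s - s * t) * t powr A * (c * (2 - t) powr B)"
          using G0 by (intro mult_left_mono) auto
        then show "G (s - s * t) * t powr A \<le> c * (G (s - s * t) * sided_weight s A B (s - s * t))"
          unfolding sided_weight_def y by (simp add: mult_ac)
      qed (use P G0 in auto)
      also have "\<dots> = c powr P * (G (s - s * t) * sided_weight s A B (s - s * t)) powr P"
        using c G0 by (subst powr_mult) (auto simp: sided_weight_def)
      finally show ?thesis using True in1 by (simp add: ennreal_mult[symmetric] ennreal_leI)
    qed simp
  qed
  also have "\<dots> = ennreal (c powr P) * (\<integral>\<^sup>+t. ennreal ((G (s - s * t) * sided_weight s A B (s - s * t)) powr P) * indicator {-1..1} (s - s * t) \<partial>lborel)"
    by (rule nn_integral_cmult) measurable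
  also have "(\<integral>\<^sup>+t. ennreal ((G (s - s * t) * sided_weight s A B (s - s * t)) powr P) * indicator {-1..1} (s - s * t) \<partial>lborel)
     = integral11 (\<lambda>x. (G x * sided_weight s A B x) powr P)"
    using nn_integral_real_affine[of "\<lambda>x. ennreal ((G x * sided_weight s A B x) powr P) * indicator {-1..1} x" "- s" s] s by auto
  also have "ennreal (c powr P) * \<dots> \<le> ennreal (c powr P) * ennreal (N powr P)"
    by (intro mult_left_mono I) auto
  also have "\<dots> = ennreal ((c * N) powr P)" using c N by (simp add: ennreal_mult[symmetric] powr_mult)
  finally show ?thesis unfolding c_def .
qed

text \<open>The norm over one half of the interval, in the distance variable. Infinite
  \<open>q\<close> needs its own clause, because \<open>enn2real\<close> sends infinity to
  0.\<close>

definition one_sided_norm_le :: "ennreal \<Rightarrow> real \<Rightarrow> (real \<Rightarrow> real) \<Rightarrow> (real \<Rightarrow> real) \<Rightarrow> real \<Rightarrow> bool" where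
  "one_sided_norm_le q s D W K \<longleftrightarrow>
    (q = \<infinity> \<longrightarrow> (\<forall>y. 0 < y \<longrightarrow> y < 1 \<longrightarrow> \<bar>D (s - s * y)\<bar> * W (s - s * y) \<le> K)) \<and>
    (q \<noteq> \<infinity> \<longrightarrow> integral01 (\<lambda>y. (\<bar>D (s - s * y)\<bar> * W (s - s * y)) powr enn2real q) \<le> ennreal (K powr enn2real q))"

text \<open>Tail domination turns the bounds at the origin and on the top derivative into a Hardy
  situation. Finite and infinite \<open>q\<close> differ only in which Hardy bound is
  applied.\<close>

lemma one_sided_bound:
  fixes p q :: ennreal and s A B h :: real
  assumes p: "1 \<le> p" "p \<noteq> \<infinity>" and q: "p \<le> q" and s: "s = 1 \<or> s = -1"
    and A: "- exponent_recip q < A"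
    and k: "0 < k" and h: "h = real k - (exponent_recip p - exponent_recip q)"
  obtains C where "0 < C"
    "\<And>f G N M. deriv_abs_continuous (r + k - 1) f \<Longrightarrow> top_derivative_modulus (r + k) f G \<Longrightarrow> 0 \<le> N \<Longrightarrow> 0 \<le> M \<Longrightarrow>
      integral11 (\<lambda>x. (G x * sided_weight s (A + h) (B + h) x) powr enn2real p) \<le> ennreal (N powr enn2real p) \<Longrightarrow>
      (\<And>i. i \<le> r + k - 1 \<Longrightarrow> \<bar>(deriv ^^ i) f 0\<bar> \<le> M) \<Longrightarrow>
      one_sided_norm_le q s ((deriv ^^ r) f) (sided_weight s A B) (C * (N + M))"
proof -
  define P where "P = enn2real p"
  have P: "1 \<le> P" "exponent_recip p = 1 / P" using finite_exponent[OF p] unfolding P_def by auto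
  define iq where "iq = exponent_recip q"
  \<comment> \<open>This is \<open>\<alpha> + 1\<close> in Hardy's inequality, with
    \<open>\<alpha> = A + 1 / q - 1 / p\<close>. The definition of \<open>h\<close> amounts to
    \<open>A + h = (k - 1) + \<gamma>\<close>.\<close>
  define \<gamma> where "\<gamma> = A + iq - 1 / P + 1"
  have \<gamma>: "A + h = real (k - 1) + \<gamma>" using k P(2) unfolding \<gamma>_def h iq_def by (simp add: of_nat_diff)
  define cB :: real where "cB = 2 powr \<bar>B\<bar>"
  \<comment> \<open>The two summands let \<open>cH * (N + M)\<close> majorise both the norm of the
    kernel and the constant \<open>real k * M\<close>, as the Hardy bounds demand of a single
    number.\<close>
  define cH :: real where "cH = 2 powr \<bar>B + h\<bar> + real k"
  have cc: "0 < cB" "0 < cH" using k unfolding cB_def cH_def by (auto intro: add_pos_nonneg)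
  have weight: "sided_weight s A B (s - s * y) \<le> cB * y powr A" "0 \<le> sided_weight s A B (s - s * y)" if y: "0 < y" "y < 1" for y
  proof -
    have ss: "s * s = 1" using s by auto
    have "1 - s * (s - s * y) = y" "1 + s * (s - s * y) = 2 - y"
      using ss by (simp_all add: right_diff_distrib mult.assoc[symmetric])
    then have "sided_weight s A B (s - s * y) = y powr A * (2 - y) powr B" unfolding sided_weight_def by simp
    moreover have "(2 - y) powr B \<le> cB" unfolding cB_def using y by (intro powr_ge_two_powr) auto
    ultimately show "sided_weight s A B (s - s * y) \<le> cB * y powr A" by (simp add: mult.commute[of cB] mult_left_mono)
    show "0 \<le> sided_weight s A B (s - s * y)" unfolding sided_weight_def by simp
  qed
  have td: "tail_dominated (\<lambda>y. \<bar>(deriv ^^ r) f (s - s * y)\<bar>) (real k * M) (\<lambda>t. t ^ (k - 1) * G (s - s * t) * indicator {0<..<1} t)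
     \<and> real k * M \<le> cH * (N + M) \<and> 0 \<le> cH * (N + M) \<and>
     integral01 (\<lambda>t. (t ^ (k - 1) * G (s - s * t) * indicator {0<..<1} t) powr P * t powr (\<gamma> * P))
     \<le> ennreal ((cH * (N + M)) powr P)"
    if f: "deriv_abs_continuous (r + k - 1) f" and G: "top_derivative_modulus (r + k) f G" and NM: "0 \<le> N" "0 \<le> M"
      and I: "integral11 (\<lambda>x. (G x * sided_weight s (A + h) (B + h) x) powr P) \<le> ennreal (N powr P)"
      and bound: "\<And>i. i \<le> r + k - 1 \<Longrightarrow> \<bar>(deriv ^^ i) f 0\<bar> \<le> M" for f G N M
  proof (intro conjI)
    show "tail_dominated (\<lambda>y. \<bar>(deriv ^^ r) f (s - s * y)\<bar>) (real k * M) (\<lambda>t. t ^ (k - 1) * G (s - s * t) * indicator {0<..<1} t)"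
      by (rule one_sided_tail_dominated[OF s k NM(2) f G bound])
    show "real k * M \<le> cH * (N + M)" using NM unfolding cH_def by (intro mult_mono) auto
    show "0 \<le> cH * (N + M)" using NM cc by simp
    have "integral01 (\<lambda>t. (t ^ (k - 1) * G (s - s * t) * indicator {0<..<1} t) powr P * t powr (\<gamma> * P))
      \<le> ennreal ((2 powr \<bar>B + h\<bar> * N) powr P)"
      by (rule one_sided_top_norm[OF s P(1) NM(1) _ _ I \<gamma>]) (use G in \<open>auto simp: top_derivative_modulus_def\<close>)
    also have "\<dots> \<le> ennreal ((cH * (N + M)) powr P)"
      using NM P unfolding cH_def by (intro ennreal_leI powr_mono2 mult_mono) auto
    finally show "integral01 (\<lambda>t. (t ^ (k - 1) * G (s - s * t) * indicator {0<..<1} t) powr P * t powr (\<gamma> * P))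
     \<le> ennreal ((cH * (N + M)) powr P)" .
  qed
  show ?thesis
  proof (cases "q = \<infinity>")
    case True
    have iq0: "iq = 0" using True unfolding iq_def exponent_recip_def by simp
    have A0: "0 < A" using A iq0 unfolding iq_def by simp
    have \<gamma>0: "\<gamma> = A - 1 / P + 1" unfolding \<gamma>_def iq0 by simp
    obtain C where C: "0 < C" "\<And>v B g y N. tail_dominated v B g \<Longrightarrow> 0 < y \<Longrightarrow> y < 1 \<Longrightarrow> 0 \<le> N \<Longrightarrow> B \<le> N \<Longrightarrow>
     integral01 (\<lambda>t. g t powr P * t powr ((A - 1 / P + 1) * P)) \<le> ennreal (N powr P) \<Longrightarrow>
    v y * y powr A \<le> C * N" using Hardy_sup[OF P(1) A0] by blast
    show ?thesis
    proof (rule that[of "cB * (C * cH)"])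
      show "0 < cB * (C * cH)" using cc C by simp
      fix f G and N M :: real
      assume *: "deriv_abs_continuous (r + k - 1) f" "top_derivative_modulus (r + k) f G" "0 \<le> N" "0 \<le> M"
        "integral11 (\<lambda>x. (G x * sided_weight s (A + h) (B + h) x) powr enn2real p) \<le> ennreal (N powr enn2real p)"
        "\<And>i. i \<le> r + k - 1 \<Longrightarrow> \<bar>(deriv ^^ i) f 0\<bar> \<le> M"
      note t = td[OF *(1-4) *(5)[folded P_def] *(6)]
      have "\<bar>(deriv ^^ r) f (s - s * y)\<bar> * sided_weight s A B (s - s * y) \<le> cB * (C * cH) * (N + M)" if y: "0 < y" "y < 1" for y
      proof -
        have "\<bar>(deriv ^^ r) f (s - s * y)\<bar> * sided_weight s A B (s - s * y) \<le> \<bar>(deriv ^^ r) f (s - s * y)\<bar> * (cB * y powr A)"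
          by (intro mult_left_mono weight y) auto
        also have "\<dots> = cB * (\<bar>(deriv ^^ r) f (s - s * y)\<bar> * y powr A)" by simp
        also have "\<dots> \<le> cB * (C * (cH * (N + M)))"
          using C(2)[of "\<lambda>y. \<bar>(deriv ^^ r) f (s - s * y)\<bar>" "real k * M" _ y "cH * (N + M)"] t y cc unfolding \<gamma>0
          by (intro mult_left_mono) auto
        finally show ?thesis by (simp add: mult.assoc)
      qed
      then show "one_sided_norm_le q s ((deriv ^^ r) f) (sided_weight s A B) (cB * (C * cH) * (N + M))"
        using True unfolding one_sided_norm_le_def by blast
    qed
  next
    case False
    define Q where "Q = enn2real q"
    have q1: "1 \<le> q" using p(1) q by (rule order_trans)
    have Q: "1 \<le> Q" "iq = 1 / Q" using finite_exponent[OF q1 False] unfolding Q_def iq_def by auto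
    have PQ: "P \<le> Q" unfolding P_def Q_def using q False by (intro enn2real_mono) (auto simp: less_top)
    have AQ: "- 1 / Q < A" using A Q(2) unfolding iq_def by simp
    obtain C where C: "0 < C" "\<And>v B g N. tail_dominated v B g \<Longrightarrow> 0 \<le> N \<Longrightarrow> B \<le> N \<Longrightarrow>
     integral01 (\<lambda>t. g t powr P * t powr ((A + 1 / Q - 1 / P + 1) * P)) \<le> ennreal (N powr P) \<Longrightarrow>
    integral01 (\<lambda>y. (v y * y powr A) powr Q) \<le> ennreal (C * N powr Q)"
      using Hardy_interpolated[OF P(1) PQ AQ] by blast
    show ?thesis
    proof (rule that[of "cB * (C powr (1 / Q) * cH)"])
      show "0 < cB * (C powr (1 / Q) * cH)" using cc C by simp
      fix f G and N M :: real
      assume *: "deriv_abs_continuous (r + k - 1) f" "top_derivative_modulus (r + k) f G" "0 \<le> N" "0 \<le> M"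
        "integral11 (\<lambda>x. (G x * sided_weight s (A + h) (B + h) x) powr enn2real p) \<le> ennreal (N powr enn2real p)"
        "\<And>i. i \<le> r + k - 1 \<Longrightarrow> \<bar>(deriv ^^ i) f 0\<bar> \<le> M"
      note t = td[OF *(1-4) *(5)[folded P_def] *(6)]
      have "integral01 (\<lambda>y. (\<bar>(deriv ^^ r) f (s - s * y)\<bar> * sided_weight s A B (s - s * y)) powr Q)
        \<le> (\<integral>\<^sup>+y. ennreal (cB powr Q) * (ennreal ((\<bar>(deriv ^^ r) f (s - s * y)\<bar> * y powr A) powr Q) * indicator {0<..<1} y) \<partial>lborel)"
      proof (rule nn_integral_mono)
        fix y :: real
        show "ennreal ((\<bar>(deriv ^^ r) f (s - s * y)\<bar> * sided_weight s A B (s - s * y)) powr Q) * indicator {0<..<1} y \<le>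
          ennreal (cB powr Q) * (ennreal ((\<bar>(deriv ^^ r) f (s - s * y)\<bar> * y powr A) powr Q) * indicator {0<..<1} y)"
        proof (cases "0 < y \<and> y < 1")
          case True
          have "(\<bar>(deriv ^^ r) f (s - s * y)\<bar> * sided_weight s A B (s - s * y)) powr Q \<le> (cB * (\<bar>(deriv ^^ r) f (s - s * y)\<bar> * y powr A)) powr Q"
          proof (rule powr_mono2)
            have "\<bar>(deriv ^^ r) f (s - s * y)\<bar> * sided_weight s A B (s - s * y) \<le> \<bar>(deriv ^^ r) f (s - s * y)\<bar> * (cB * y powr A)"
              using weight[of y] True by (intro mult_left_mono) auto
            then show "\<bar>(deriv ^^ r) f (s - s * y)\<bar> * sided_weight s A B (s - s * y) \<le> cB * (\<bar>(deriv ^^ r) f (s - s * y)\<bar> * y powr A)"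
              by (simp add: mult_ac)
          qed (use Q weight[of y] True in auto)
          also have "\<dots> = cB powr Q * (\<bar>(deriv ^^ r) f (s - s * y)\<bar> * y powr A) powr Q"
            using cc by (subst powr_mult) auto
          finally show ?thesis using True by (simp add: ennreal_mult[symmetric] ennreal_leI)
        qed simp
      qed
      also have "\<dots> \<le> ennreal (cB powr Q) * integral01 (\<lambda>y. (\<bar>(deriv ^^ r) f (s - s * y)\<bar> * y powr A) powr Q)"
        by (rule nn_integral_cmult_le) simp
      also have "\<dots> \<le> ennreal (cB powr Q) * ennreal (C * (cH * (N + M)) powr Q)"
        using t unfolding \<gamma>_def Q(2) by (intro mult_left_mono C(2)[of _ "real k * M"]) auto
      also have "\<dots> = ennreal ((cB * (C powr (1 / Q) * cH) * (N + M)) powr Q)"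
      proof -
        have "(C powr (1 / Q)) powr Q = C" using C(1) Q(1) by (simp only: powr_powr) simp
        then have "(cB * (C powr (1 / Q) * (cH * (N + M)))) powr Q = cB powr Q * (C * (cH * (N + M)) powr Q)"
          using cc *(3,4) C(1) by (simp only: powr_mult[of cB] powr_mult[of "C powr (1 / Q)"] mult_nonneg_nonneg add_nonneg_nonneg less_imp_le powr_ge_zero)
        then show ?thesis using C(1) by (simp add: ennreal_mult[symmetric] mult.assoc)
      qed
      finally show "one_sided_norm_le q s ((deriv ^^ r) f) (sided_weight s A B) (cB * (C powr (1 / Q) * cH) * (N + M))"
        using False unfolding Q_def one_sided_norm_le_def by blast
    qed
  qed
qed

text \<open>Outside the open interval \<open>D\<close> is arbitrary. Cutting it off to
  \<open>E\<close> gives a Borel function, to which the affine change of variables applies without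
  changing either integral.\<close>

lemma half_line_integral:
  fixes D W :: "real \<Rightarrow> real" and Q s :: real
  assumes s: "s = 1 \<or> s = -1" and D: "continuous_on {-1<..<1} D" and W [measurable]: "W \<in> borel_measurable borel"
  shows "(\<integral>\<^sup>+x. ennreal (\<bar>D x * W x\<bar> powr Q) * indicator {0<..<1} (s * x) \<partial>lborel) =
    integral01 (\<lambda>y. \<bar>D (s - s * y) * W (s - s * y)\<bar> powr Q)"
proof -
  define E where "E x = indicator {-1<..<1} x *\<^sub>R D x" for x
  have [measurable]: "E \<in> borel_measurable borel"
    unfolding E_def by (rule borel_measurable_continuous_on_indicator[OF _ D]) simp
  define H where "H x = ennreal (\<bar>E x * W x\<bar> powr Q) * indicator {0<..<1} (s * x)" for x
  have [measurable]: "H \<in> borel_measurable borel" unfolding H_def by measurable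
  have ss: "s * s = 1" using s by auto
  have sy: "s * (s - s * y) = 1 - y" for y using ss by (simp add: right_diff_distrib mult.assoc[symmetric])
  have "(\<integral>\<^sup>+x. ennreal (\<bar>D x * W x\<bar> powr Q) * indicator {0<..<1} (s * x) \<partial>lborel) = (\<integral>\<^sup>+x. H x \<partial>lborel)"
    using s by (intro nn_integral_cong) (auto simp: H_def E_def indicator_def)
  also have "\<dots> = (\<integral>\<^sup>+y. H (s - s * y) \<partial>lborel)"
    using nn_integral_real_affine[of H "- s" s] s by auto
  also have "\<dots> = integral01 (\<lambda>y. \<bar>D (s - s * y) * W (s - s * y)\<bar> powr Q)"
    unfolding H_def sy using s by (intro nn_integral_cong) (auto simp: E_def indicator_def)
  finally show ?thesis .
qed

section \<open>Gluing the two halves\<close>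

lemma weighted_derivative_inequality:
  fixes p q :: ennreal and a b c d h :: real and r k :: nat
  assumes p: "1 \<le> p" "p \<noteq> \<infinity>" and q: "p \<le> q"
    and a: "- exponent_recip q < a" and b: "- exponent_recip q < b"
    and k: "0 < k" and h: "h = real k - (exponent_recip p - exponent_recip q)"
  shows "\<exists>C>0. \<forall>f :: real \<Rightarrow> real.
        deriv_abs_continuous (r + k - 1) f \<and>
        in_Lp p (\<lambda>x. (deriv ^^ (r + k)) f x * jacobi_weight (a + h) (b + h) x)
        \<longrightarrow> Lp_norm q (\<lambda>x. (deriv ^^ r) f x * jacobi_weight a b x)
            \<le> ennreal C *
              (Lp_norm p (\<lambda>x. f x * jacobi_weight c d x) +
               Lp_norm p (\<lambda>x. (deriv ^^ (r + k)) f x * jacobi_weight (a + h) (b + h) x))"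
proof -
  define P where "P = enn2real p"
  have P: "1 \<le> P" using finite_exponent[OF p] unfolding P_def by auto
  define n where "n = r + k - 1"
  have n: "r + k = Suc n" using k unfolding n_def by simp
  obtain CI where CI: "0 < CI" "\<And>f G Nf Ng i. deriv_abs_continuous n f \<Longrightarrow> top_derivative_modulus (Suc n) f G \<Longrightarrow>
    0 \<le> Nf \<Longrightarrow> 0 \<le> Ng \<Longrightarrow>
    integral11 (\<lambda>x. \<bar>f x * jacobi_weight c d x\<bar> powr P) \<le> ennreal (Nf powr P) \<Longrightarrow>
    integral11 (\<lambda>x. (G x * jacobi_weight (a + h) (b + h) x) powr P) \<le> ennreal (Ng powr P) \<Longrightarrow>
    i \<le> n \<Longrightarrow> \<bar>(deriv ^^ i) f 0\<bar> \<le> CI * (Nf + Ng)"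
    using interior_bound[OF P] by blast
  \<comment> \<open>For the left end point the two exponents change places, so that the sided weight
    is the given Jacobi weight in both cases.\<close>
  define A where "A s = (if s = 1 then a else b)" for s :: real
  define B where "B s = (if s = 1 then b else a)" for s :: real
  have AB: "sided_weight s (A s) (B s) = jacobi_weight a b"
    "sided_weight s (A s + h) (B s + h) = jacobi_weight (a + h) (b + h)" if "s = 1 \<or> s = -1" for s
    using that unfolding A_def B_def by (auto simp: sided_weight_1 sided_weight_minus_1)
  define side where "side s C \<longleftrightarrow> (\<forall>f G N M. deriv_abs_continuous n f \<longrightarrow> top_derivative_modulus (Suc n) f G \<longrightarrow> 0 \<le> N \<longrightarrow> 0 \<le> M \<longrightarrow>
      integral11 (\<lambda>x. (G x * jacobi_weight (a + h) (b + h) x) powr P) \<le> ennreal (N powr P) \<longrightarrow>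
      (\<forall>i\<le>n. \<bar>(deriv ^^ i) f 0\<bar> \<le> M) \<longrightarrow>
      one_sided_norm_le q s ((deriv ^^ r) f) (jacobi_weight a b) (C * (N + M)))" for s C :: real
  have sides: "\<exists>C>0. side s C"
    if s: "s = 1 \<or> s = -1" for s
  proof -
    have "- exponent_recip q < A s" using a b unfolding A_def by simp
    note bound = one_sided_bound[OF p q s this k h, where B = "B s" and r = r, unfolded AB[OF s] P_def[symmetric], folded n_def, unfolded n]
    show ?thesis
    proof (rule bound)
      fix C
      assume C: "0 < C" "\<And>f G N M. deriv_abs_continuous n f \<Longrightarrow> top_derivative_modulus (Suc n) f G \<Longrightarrow> 0 \<le> N \<Longrightarrow> 0 \<le> M \<Longrightarrow>
      integral11 (\<lambda>x. (G x * jacobi_weight (a + h) (b + h) x) powr P) \<le> ennreal (N powr P) \<Longrightarrow>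
      (\<And>i. i \<le> n \<Longrightarrow> \<bar>(deriv ^^ i) f 0\<bar> \<le> M) \<Longrightarrow>
      one_sided_norm_le q s ((deriv ^^ r) f) (jacobi_weight a b) (C * (N + M))"
      have "side s C"
        unfolding side_def
      proof (intro allI)
        fix f G N M
        show "deriv_abs_continuous n f \<longrightarrow> top_derivative_modulus (Suc n) f G \<longrightarrow> 0 \<le> N \<longrightarrow> 0 \<le> M \<longrightarrow>
          integral11 (\<lambda>x. (G x * jacobi_weight (a + h) (b + h) x) powr P) \<le> ennreal (N powr P) \<longrightarrow>
          (\<forall>i\<le>n. \<bar>(deriv ^^ i) f 0\<bar> \<le> M) \<longrightarrow>
          one_sided_norm_le q s ((deriv ^^ r) f) (jacobi_weight a b) (C * (N + M))"
          using C(2)[of f G N M] by blast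
      qed
      then show ?thesis using C(1) by blast
    qed
  qed
  obtain C1 where C1: "0 < C1" "side 1 C1" using sides[of 1] by blast
  obtain C2 where C2: "0 < C2" "side (-1) C2" using sides[of "-1"] by blast
  \<comment> \<open>The factor \<open>C1 + C2 + 1\<close> dominates the bounds on both halves and
    the value at the origin, \<open>1 + CI\<close> pays for replacing the values at the origin by
    norms, and 2 pays for adding the halves.\<close>
  define C where "C = 2 * ((C1 + C2 + 1) * (1 + CI))"
  have C: "0 < C" using C1(1) C2(1) CI(1) unfolding C_def by simp
  have "Lp_norm q (\<lambda>x. (deriv ^^ r) f x * jacobi_weight a b x) \<le> ennreal C *
      (Lp_norm p (\<lambda>x. f x * jacobi_weight c d x) + Lp_norm p (\<lambda>x. (deriv ^^ (r + k)) f x * jacobi_weight (a + h) (b + h) x))"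
    if f: "deriv_abs_continuous (r + k - 1) f" and inL: "in_Lp p (\<lambda>x. (deriv ^^ (r + k)) f x * jacobi_weight (a + h) (b + h) x)" for f
  proof (cases "Lp_norm p (\<lambda>x. f x * jacobi_weight c d x) = \<infinity>")
    case True
    then show ?thesis using C by (simp add: ennreal_mult_top)
  next
    case fin: False
    define Nf where "Nf = enn2real (Lp_norm p (\<lambda>x. f x * jacobi_weight c d x))"
    define Ng where "Ng = enn2real (Lp_norm p (\<lambda>x. (deriv ^^ (r + k)) f x * jacobi_weight (a + h) (b + h) x))"
    have fin': "Lp_norm p (\<lambda>x. (deriv ^^ (r + k)) f x * jacobi_weight (a + h) (b + h) x) \<noteq> \<infinity>"
      using inL unfolding in_Lp_def by auto
    have N: "0 \<le> Nf" "0 \<le> Ng" unfolding Nf_def Ng_def by auto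
    have norms: "Lp_norm p (\<lambda>x. f x * jacobi_weight c d x) = ennreal Nf"
      "Lp_norm p (\<lambda>x. (deriv ^^ (r + k)) f x * jacobi_weight (a + h) (b + h) x) = ennreal Ng"
      using fin fin' unfolding Nf_def Ng_def by (simp_all add: less_top)
    have f': "deriv_abs_continuous n f" using f unfolding n_def .
    obtain G where G: "top_derivative_modulus (Suc n) f G"
      using top_derivative_modulus_exists[of "r + k" f "a + h" "b + h"] inL unfolding in_Lp_def n by blast
    have If: "integral11 (\<lambda>x. \<bar>f x * jacobi_weight c d x\<bar> powr P) \<le> ennreal (Nf powr P)"
      using Lp_norm_finite[OF p(2) _ fin] P unfolding Nf_def P_def by simp
    have Ig: "integral11 (\<lambda>x. (G x * jacobi_weight (a + h) (b + h) x) powr P) \<le> ennreal (Ng powr P)"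
    proof -
      have "integral11 (\<lambda>x. (G x * jacobi_weight (a + h) (b + h) x) powr P) =
        integral11 (\<lambda>x. \<bar>(deriv ^^ (r + k)) f x * jacobi_weight (a + h) (b + h) x\<bar> powr P)"
      proof (rule nn_integral_cong_AE)
        have "AE x in lborel. x \<in> {-1<..<1} \<longrightarrow> G x = \<bar>(deriv ^^ (r + k)) f x\<bar>"
          using G unfolding top_derivative_modulus_def n by blast
        moreover have "AE x in lborel. x \<noteq> (-1::real)" "AE x in lborel. x \<noteq> (1::real)" by (rule AE_lborel_singleton)+
        ultimately show "AE x in lborel. ennreal ((G x * jacobi_weight (a + h) (b + h) x) powr P) * indicator {-1..1} x =
          ennreal (\<bar>(deriv ^^ (r + k)) f x * jacobi_weight (a + h) (b + h) x\<bar> powr P) * indicator {-1..1} x"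
          by eventually_elim (auto simp: indicator_def abs_mult jacobi_weight_def)
      qed
      then show ?thesis using Lp_norm_finite[OF p(2) _ fin'] P unfolding Ng_def P_def by simp
    qed
    define M where "M = CI * (Nf + Ng)"
    have M: "0 \<le> M" using CI(1) N unfolding M_def by simp
    have bound: "\<forall>i\<le>n. \<bar>(deriv ^^ i) f 0\<bar> \<le> M"
      unfolding M_def using CI(2)[OF f' G N If Ig] by blast
    define T where "T = (1 + CI) * (Nf + Ng)"
    have T: "0 \<le> T" "M \<le> T" "Ng + M \<le> T" using CI(1) N unfolding T_def M_def by (auto simp: distrib_right)
    have side: "one_sided_norm_le q s ((deriv ^^ r) f) (jacobi_weight a b) (C * (Ng + M))" if "side s C" for s C
      using that[unfolded side_def, THEN spec, THEN spec, THEN spec, THEN spec, THEN mp, OF f', THEN mp, OF G,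
          THEN mp, OF N(2), THEN mp, OF M, THEN mp, OF Ig, THEN mp, OF bound] .
    note s1 = side[OF C1(2), unfolded one_sided_norm_le_def] and s2 = side[OF C2(2), unfolded one_sided_norm_le_def]
    note C1 = C1(1) and C2 = C2(1)
    define S where "S = (C1 + C2 + 1) * T"
    have S: "C1 * (Ng + M) \<le> S" "C2 * (Ng + M) \<le> S" "M \<le> S" "0 \<le> S"
    proof -
      show "C1 * (Ng + M) \<le> S" "C2 * (Ng + M) \<le> S"
        unfolding S_def using C1 C2 T M N by (auto intro!: mult_mono)
      have "1 * M \<le> S" unfolding S_def using C1 C2 T M by (intro mult_mono) auto
      then show "M \<le> S" by simp
      then show "0 \<le> S" using M by linarith
    qed
    have CS: "C * (Nf + Ng) = 2 * S" unfolding C_def S_def T_def by simp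
    have "Lp_norm q (\<lambda>x. (deriv ^^ r) f x * jacobi_weight a b x) \<le> ennreal (2 * S)"
    proof (cases "q = \<infinity>")
      case True
      show ?thesis
        unfolding True
      proof (rule Lp_norm_infinity_le)
        fix x :: real assume x: "-1 < x" "x < 1"
        have w: "0 \<le> jacobi_weight a b x" unfolding jacobi_weight_def by simp
        have "\<bar>(deriv ^^ r) f x\<bar> * jacobi_weight a b x \<le> S"
        proof -
          consider "0 < x" | "x < 0" | "x = 0" by linarith
          then show ?thesis
          proof cases
            case 1
            have "\<bar>(deriv ^^ r) f x\<bar> * jacobi_weight a b x \<le> C1 * (Ng + M)"
              using s1 True x 1 by (auto dest: spec[of _ "1 - x"])
            then show ?thesis using S by linarith
          next
            case 2
            have "\<bar>(deriv ^^ r) f x\<bar> * jacobi_weight a b x \<le> C2 * (Ng + M)"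
              using s2 True x 2 by (auto dest: spec[of _ "1 + x"])
            then show ?thesis using S by linarith
          next
            \<comment> \<open>The origin belongs to neither half; there the weight is 1 and the
              interior bound applies.\<close>
            case 3
            have "\<bar>(deriv ^^ r) f x\<bar> * jacobi_weight a b x \<le> M"
              using bound k unfolding 3 n_def jacobi_weight_def by simp
            then show ?thesis using S by linarith
          qed
        qed
        then show "\<bar>(deriv ^^ r) f x * jacobi_weight a b x\<bar> \<le> 2 * S" using w S(4) by (simp add: abs_mult)
      qed
    next
      case False
      define Q where "Q = enn2real q"
      have q1: "1 \<le> q" using p(1) q by (rule order_trans)
      have Q: "1 \<le> Q" using finite_exponent[OF q1 False] unfolding Q_def by auto
      have cont: "continuous_on {-1<..<1} ((deriv ^^ r) f)"
        by (rule deriv_abs_continuous_continuous_on[OF f']) (use k in \<open>simp add: n_def\<close>)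
      have [measurable]: "jacobi_weight a b \<in> borel_measurable borel" unfolding jacobi_weight_def by measurable
      have w: "\<bar>jacobi_weight a b x\<bar> = jacobi_weight a b x" for x unfolding jacobi_weight_def by simp
      define H where "H s x = ennreal (\<bar>(deriv ^^ r) f x * jacobi_weight a b x\<bar> powr Q) * indicator {0<..<1} (s * x)" for s x :: real
      have meas: "H s \<in> borel_measurable borel" if "s = 1 \<or> s = -1" for s
      proof -
        have [measurable]: "(\<lambda>x. indicator {-1<..<1} x *\<^sub>R (deriv ^^ r) f x) \<in> borel_measurable borel"
          by (rule borel_measurable_continuous_on_indicator[OF _ cont]) simp
        have eq: "H s = (\<lambda>x. ennreal (\<bar>(indicator {-1<..<1} x *\<^sub>R (deriv ^^ r) f x) * jacobi_weight a b x\<bar> powr Q) * indicator {0<..<1} (s * x))"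
          using that by (auto simp: H_def indicator_def fun_eq_iff)
        show ?thesis unfolding eq by measurable
      qed
      have IH1: "(\<integral>\<^sup>+x. H 1 x \<partial>lborel) \<le> ennreal (S powr Q)"
      proof -
        have "(\<integral>\<^sup>+x. H 1 x \<partial>lborel) \<le> ennreal ((C1 * (Ng + M)) powr Q)"
          using s1 False half_line_integral[of 1 "(deriv ^^ r) f" "jacobi_weight a b" Q] cont
          unfolding H_def Q_def by (simp add: abs_mult w)
        also have "\<dots> \<le> ennreal (S powr Q)" using S C1 N M Q by (intro ennreal_leI powr_mono2) auto
        finally show ?thesis .
      qed
      have IH2: "(\<integral>\<^sup>+x. H (-1) x \<partial>lborel) \<le> ennreal (S powr Q)"
      proof -
        have "(\<integral>\<^sup>+x. H (-1) x \<partial>lborel) \<le> ennreal ((C2 * (Ng + M)) powr Q)"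
          using s2 False half_line_integral[of "-1" "(deriv ^^ r) f" "jacobi_weight a b" Q] cont
          unfolding H_def Q_def by (simp add: abs_mult w)
        also have "\<dots> \<le> ennreal (S powr Q)" using S C2 N M Q by (intro ennreal_leI powr_mono2) auto
        finally show ?thesis .
      qed
      show ?thesis
      proof (rule Lp_norm_le[OF False], unfold Q_def[symmetric])
        have "integral11 (\<lambda>x. \<bar>(deriv ^^ r) f x * jacobi_weight a b x\<bar> powr Q) = (\<integral>\<^sup>+x. H 1 x + H (-1) x \<partial>lborel)"
        proof (rule nn_integral_cong_AE)
          have "AE x in lborel. x \<noteq> (-1::real)" "AE x in lborel. x \<noteq> (0::real)" "AE x in lborel. x \<noteq> (1::real)"
            by (rule AE_lborel_singleton)+
          then show "AE x in lborel. ennreal (\<bar>(deriv ^^ r) f x * jacobi_weight a b x\<bar> powr Q) * indicator {-1..1} x = H 1 x + H (-1) x"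
            by eventually_elim (auto simp: H_def indicator_def)
        qed
        also have "\<dots> = (\<integral>\<^sup>+x. H 1 x \<partial>lborel) + (\<integral>\<^sup>+x. H (-1) x \<partial>lborel)"
          by (rule nn_integral_add) (use meas in auto)
        also have "\<dots> \<le> ennreal (S powr Q) + ennreal (S powr Q)" by (intro add_mono IH1 IH2)
        also have "\<dots> = ennreal (2 * S powr Q)" by (simp add: ennreal_plus[symmetric] del: ennreal_plus)
        also have "\<dots> \<le> ennreal ((2 * S) powr Q)"
        proof (rule ennreal_leI)
          \<comment> \<open>Since \<open>1 \<le> Q\<close>, doubling the base absorbs the sum of two
            equal \<open>Q\<close>-th powers.\<close>
          have "2 powr 1 \<le> (2::real) powr Q" using Q by (intro powr_mono) auto
          then have "2 * S powr Q \<le> 2 powr Q * S powr Q" by (intro mult_right_mono) auto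
          then show "2 * S powr Q \<le> (2 * S) powr Q" using S(4) by (simp add: powr_mult)
        qed
        finally show "integral11 (\<lambda>x. \<bar>(deriv ^^ r) f x * jacobi_weight a b x\<bar> powr Q) \<le> ennreal ((2 * S) powr Q)" .
      qed (use Q S in auto)
    qed
    also have "ennreal (2 * S) = ennreal C * (ennreal Nf + ennreal Ng)"
      unfolding CS[symmetric] using C N by (simp add: ennreal_mult ennreal_plus)
    finally show ?thesis unfolding norms .
  qed
  then show ?thesis using C by blast
qed

theorem lemma1:
  fixes p q :: ennreal and a b c d h :: real and r k :: nat
  assumes "1 \<le> p" and "p \<le> q" and "(p, q) \<noteq> (\<infinity>, \<infinity>)"
    and "a > - exponent_recip q" and "b > - exponent_recip q"
    and "c > - exponent_recip p" and "d > - exponent_recip p"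
    and "k > 0"
    and "h = real k - (exponent_recip p - exponent_recip q)"
  shows
    "(\<exists>C>0. \<forall>f :: real \<Rightarrow> real.
        deriv_abs_continuous (r + k - 1) f \<and>
        in_Lp p (\<lambda>x. (deriv ^^ (r + k)) f x * jacobi_weight (a + h) (b + h) x)
        \<longrightarrow> Lp_norm q (\<lambda>x. (deriv ^^ r) f x * jacobi_weight a b x)
            \<le> ennreal C *
              (Lp_norm p (\<lambda>x. f x * jacobi_weight c d x) +
               Lp_norm p (\<lambda>x. (deriv ^^ (r + k)) f x * jacobi_weight (a + h) (b + h) x)))
     \<and>
     (a - c < real r + (exponent_recip p - exponent_recip q) \<longrightarrow>
       (\<forall>\<epsilon>>0. \<exists>f :: nat \<Rightarrow> real \<Rightarrow> real.
          (\<forall>n. Cm_on (k + r) {-1..1} (f n)) \<and>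
          ((\<lambda>n. Lp_norm q (\<lambda>x. (deriv ^^ r) (f n) x * jacobi_weight a b x) *
             inverse (Lp_norm p (\<lambda>x. f n x * jacobi_weight c d x) +
               Lp_norm p (\<lambda>x. (deriv ^^ (k + r)) (f n) x * jacobi_weight (a + h + \<epsilon>) (b + h) x)))
           \<longlonglongrightarrow> \<infinity>)))
     \<and>
     (b - d < real r + (exponent_recip p - exponent_recip q) \<longrightarrow>
       (\<forall>\<epsilon>>0. \<exists>f :: nat \<Rightarrow> real \<Rightarrow> real.
          (\<forall>n. Cm_on (k + r) {-1..1} (f n)) \<and>
          ((\<lambda>n. Lp_norm q (\<lambda>x. (deriv ^^ r) (f n) x * jacobi_weight a b x) *
             inverse (Lp_norm p (\<lambda>x. f n x * jacobi_weight c d x) +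
               Lp_norm p (\<lambda>x. (deriv ^^ (k + r)) (f n) x * jacobi_weight (a + h) (b + h + \<epsilon>) x)))
           \<longlonglongrightarrow> \<infinity>)))"
proof (intro conjI impI allI)
  \<comment> \<open>An infinite \<open>p\<close> would force an infinite \<open>q\<close>, which is
    the excluded pair.\<close>
  have p: "p \<noteq> \<infinity>" using assms(2,3) by (auto simp: top_unique)
  note upper = weighted_derivative_inequality[OF assms(1) p assms(2,4,5,8,9)]
  show "\<exists>C>0. \<forall>f :: real \<Rightarrow> real.
        deriv_abs_continuous (r + k - 1) f \<and>
        in_Lp p (\<lambda>x. (deriv ^^ (r + k)) f x * jacobi_weight (a + h) (b + h) x)
        \<longrightarrow> Lp_norm q (\<lambda>x. (deriv ^^ r) f x * jacobi_weight a b x)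
            \<le> ennreal C *
              (Lp_norm p (\<lambda>x. f x * jacobi_weight c d x) +
               Lp_norm p (\<lambda>x. (deriv ^^ (r + k)) f x * jacobi_weight (a + h) (b + h) x))"
    by (rule upper)
  fix \<epsilon> :: real assume \<epsilon>: "0 < \<epsilon>"
  show "\<exists>f :: nat \<Rightarrow> real \<Rightarrow> real.
          (\<forall>n. Cm_on (k + r) {-1..1} (f n)) \<and>
          ((\<lambda>n. Lp_norm q (\<lambda>x. (deriv ^^ r) (f n) x * jacobi_weight a b x) *
             inverse (Lp_norm p (\<lambda>x. f n x * jacobi_weight c d x) +
               Lp_norm p (\<lambda>x. (deriv ^^ (k + r)) (f n) x * jacobi_weight (a + h + \<epsilon>) (b + h) x)))
           \<longlonglongrightarrow> \<infinity>)"
    if "a - c < real r + (exponent_recip p - exponent_recip q)"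
    using sharpness_sided[OF assms(1) p assms(2), of 1 a b c d k h r \<epsilon>] assms that \<epsilon>
    unfolding sided_weight_1 by simp
  show "\<exists>f :: nat \<Rightarrow> real \<Rightarrow> real.
          (\<forall>n. Cm_on (k + r) {-1..1} (f n)) \<and>
          ((\<lambda>n. Lp_norm q (\<lambda>x. (deriv ^^ r) (f n) x * jacobi_weight a b x) *
             inverse (Lp_norm p (\<lambda>x. f n x * jacobi_weight c d x) +
               Lp_norm p (\<lambda>x. (deriv ^^ (k + r)) (f n) x * jacobi_weight (a + h) (b + h + \<epsilon>) x)))
           \<longlonglongrightarrow> \<infinity>)"
    if "b - d < real r + (exponent_recip p - exponent_recip q)"
    \<comment> \<open>Seen from the left end point, \<open>a\<close> and \<open>b\<close> change
      places, as do \<open>c\<close> and \<open>d\<close>.\<close>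
    using sharpness_sided[OF assms(1) p assms(2), of "-1" b a d c k h r \<epsilon>] assms that \<epsilon>
    unfolding sided_weight_minus_1 by simp
qed

end
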